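(* Let $n\ge2$. The number $Ab_1(n)$ of families of non-equivalent 1-abelian complex structures $J_M$ of maximal type on nilpotent Lie algebras of dimension $2n$ is bounded below by $$Ab_1(n)\ \ge\ \Big\lfloor\frac{n+1}{2}\Big\rfloor+a(n-1)-1+s(n-1).$$ Here $a(\cdot)$ and $s(\cdot)$ are the numbers of block decompositions of regular matrices and of singular matrices of maximal type defined in the context, and "families" are understood as specified there.
   Context: 1-abelian structures. For a complex structure $J$ on a real Lie algebra $\mathfrak g$, $\mathfrak g^{1,0}\subset\mathfrak g_{\mathbb C}^*$ is the space of $(1,0)$-forms, $d$ the Chevalley–Eilenberg differential. $J$ is abelian if $[Jx,Jy]=[x,y]$; an abelian $J$ on a $2n$-dimensional nilpotent Lie algebra is 1-abelian if $\dim\ker(\bar\partial|_{\mathfrak g^{1,0}})=n-1$. Each 1-abelian structure is given, in a suitable basis $\{\omega^i\}$ of $\mathfrak g^{1,0}$, by $d\omega^1=\dots=d\omega^{n-1}=0$, $d\omega^n=\sum_{j,k}M_{jk}\omega^j\wedge\overline{\omega^k}$ with $0\ne M\in M_{n-1}(\mathbb C)$, and is denoted $J_M$. Two complex structures $J_1,J_2$ are equivalent if there is a $\mathbb C$-linear isomorphism $\mathfrak g^{1,0}_{J_1}\to\mathfrak g^{1,0}_{J_2}$ commuting with $d$ (extended by conjugation and wedge product). Block decompositions. Matrices $A,B\in M_k(\mathbb C)$ are *congruent if $B=PAP^*$ with $P$ invertible, $P^*=\bar P^T$. By Horn–Sergeichuk, every $M\in M_k(\mathbb C)$ is *congruent to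 a direct sum, unique up to permutation of summands, of blocks $J_m(0)$ (nilpotent Jordan blocks), $\lambda\Delta_m$ with $|\lambda|=1$, and $H_{2m}(\mu)$ with $|\mu|>1$, where $\Delta_m$ has entries $1$ at positions $(j,m+1-j)$, $i$ at positions $(j,m+2-j)$ ($2\le j\le m$) and $0$ elsewhere, and $H_{2m}(\mu)=\begin{pmatrix}0&I_m\\ J_m(\mu)&0\end{pmatrix}$, $J_m(\mu)$ being the upper Jordan block. A block $\lambda\Delta_m$ corresponds to a Jordan block $J_m(\lambda^2)$ of the *cosquare $C=(R^* )^{-1}R$ of the regular part $R$ (the sum of the blocks $\lambda\Delta_m$, $H_{2m}(\mu)$), and $H_{2m}(\mu)$ to $J_m(\mu)\oplus J_m(\bar\mu^{-1})$. The block decomposition (configuration) of $M$ is the following combinatorial data, in which the values of the eigenvalues and the signs $\pm$ of blocks are forgotten: the sizes (with multiplicity) of the blocks $J_m(0)$; for each distinct eigenvalue of modulus $1$ of $C$, the partition formed by the sizes of its Jordan blocks, these partitions being listed without order; and for each distinct eigenvalue $\mu$ of $C$ with $|\mu|>1$, the partition formed by the sizes of its Jordan blocks, again listed without order. Equivalent structures have the same configuration. The numbers. $a(m)$ is the number of block decompositions of regular (invertible) matrices of order $m$, with $a(0)=1$. A singular $M\in M_m(\mathbb C)$ of rank $r$ is of maximal type if $m_1=m_2$, where $m_1=m-r$ and $m_2=\mathrm{rank}(N)$ for $SMS^*=\begin{pmatrix}M'&N\\0&0_{m_1}\end{pmatrix}$ with $S$ invertible such that the last $m_1$ rows of $SM$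 vanish (equivalently, no block $J_1(0)$ occurs); $J_M$ with $M$ regular is also counted as of maximal type ($m_1=m_2=0$). For $\lfloor\frac{m+1}2\rfloor\le r\le m-1$ let $\mathcal D$ be the set of tuples $\vec m=(m_3,\dots,m_{2r-m+2})$ of non-negative integers that are non-increasing with $m_3\le m-r$ and $\sum_k m_k\le 2r-m$ (if $2r=m$, $\mathcal D$ contains only the empty tuple), let $d(\vec m)=2r-m-\sum_k m_k$, and set $$s(m,r)=\sum_{\vec m\in\mathcal D}a(d(\vec m)),\qquad s(m)=\sum_{r=\lfloor (m+1)/2\rfloor}^{m-1}s(m,r),$$ an empty sum being $0$. Families. $Ab_1(n)$ is the number of families into which the equivalence classes of 1-abelian complex structures of maximal type on $2n$-dimensional nilpotent Lie algebras are divided, where structures with different block decompositions lie in different families, and non-equivalent structures $J_M$ with $M$ a regular Hermitian matrix lie in different families. *)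

theory Defs
  imports
    "HOL-Analysis.Linear_Algebra"
    "HOL-Library.Function_Algebras"
    "HOL-Library.Disjoint_Sets"
    "HOL-Library.Multiset"
    "Jordan_Normal_Form.Matrix"
    "Jordan_Normal_Form.Conjugate"
    "Jordan_Normal_Form.Schur_Decomposition"
    "Jordan_Normal_Form.Gauss_Jordan_Elimination"
    "Jordan_Normal_Form.DL_Rank"
    "Jordan_Normal_Form.Jordan_Normal_Form"
begin

section \<open>Lie algebras with a complex structure\<close>

text \<open>A real Lie algebra is a bracket on a real vector space type; a structure is a pair
  consisting of a bracket and an endomorphism \<open>J\<close>. Up to isomorphism every real Lie algebra of
  dimension \<open>2n\<close> lives on any given type \<open>'a::euclidean_space\<close> with \<open>DIM('a) = 2n\<close>; the inner
  product plays no role.\<close>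

type_synonym 'a bracket = "'a \<Rightarrow> 'a \<Rightarrow> 'a"
type_synonym 'a cstruct = "'a bracket \<times> ('a \<Rightarrow> 'a)"

definition lie_bracket :: "'a::real_vector bracket \<Rightarrow> bool" where
  "lie_bracket br \<longleftrightarrow> bilinear br \<and> (\<forall>x. br x x = 0) \<and>
     (\<forall>x y z. br x (br y z) + br y (br z x) + br z (br x y) = 0)"

primrec lower_central :: "'a::real_vector bracket \<Rightarrow> nat \<Rightarrow> 'a set" where
  "lower_central br 0 = UNIV"
| "lower_central br (Suc k) = span {br x y | x y. y \<in> lower_central br k}"

definition nilpotent_bracket :: "'a::real_vector bracket \<Rightarrow> bool" where
  "nilpotent_bracket br \<longleftrightarrow> (\<exists>k. lower_central br k = {0})"

definition complex_structure :: "'a::real_vector bracket \<Rightarrow> ('a \<Rightarrow> 'a) \<Rightarrow> bool" where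
  "complex_structure br J \<longleftrightarrow> linear J \<and> (\<forall>x. J (J x) = - x) \<and>
     (\<forall>x y. br (J x) (J y) - br x y - J (br (J x) y) - J (br x (J y)) = 0)"

definition abelian_structure :: "'a::real_vector bracket \<Rightarrow> ('a \<Rightarrow> 'a) \<Rightarrow> bool" where
  "abelian_structure br J \<longleftrightarrow> complex_structure br J \<and> (\<forall>x y. br (J x) (J y) = br x y)"

text \<open>The complexified dual is identified with the space of real-linear maps to \<open>complex\<close>, and
  complex-valued 2-forms with alternating real-bilinear maps to \<open>complex\<close>.\<close>

definition cforms1 :: "('a::real_vector \<Rightarrow> complex) set" where
  "cforms1 = {\<alpha>. linear \<alpha>}"

definition cforms2 :: "('a::real_vector \<Rightarrow> 'a \<Rightarrow> complex) set" where
  "cforms2 = {\<beta>. bilinear \<beta> \<and> (\<forall>x. \<beta> x x = 0)}"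

definition forms10 :: "('a::real_vector \<Rightarrow> 'a) \<Rightarrow> ('a \<Rightarrow> complex) set" where
  "forms10 J = {\<alpha> \<in> cforms1. \<forall>x. \<alpha> (J x) = \<i> * \<alpha> x}"

definition conj_form :: "('a \<Rightarrow> complex) \<Rightarrow> 'a \<Rightarrow> complex" where
  "conj_form \<alpha> = (\<lambda>x. cnj (\<alpha> x))"

definition wedge :: "('a \<Rightarrow> complex) \<Rightarrow> ('a \<Rightarrow> complex) \<Rightarrow> 'a \<Rightarrow> 'a \<Rightarrow> complex" where
  "wedge \<alpha> \<beta> = (\<lambda>x y. \<alpha> x * \<beta> y - \<alpha> y * \<beta> x)"

definition ce_d :: "'a bracket \<Rightarrow> ('a \<Rightarrow> complex) \<Rightarrow> 'a \<Rightarrow> 'a \<Rightarrow> complex" where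
  "ce_d br \<alpha> = (\<lambda>x y. - \<alpha> (br x y))"

text \<open>For a 2-form \<open>\<beta>\<close>, \<open>\<beta>(Jx,Jy)\<close> equals \<open>\<beta>(x,y)\<close> in type (1,1) and \<open>-\<beta>(x,y)\<close> in types (2,0)
  and (0,2), whence the formula for the (1,1)-component.\<close>

definition part11 ::
  "('a \<Rightarrow> 'a) \<Rightarrow> ('a \<Rightarrow> 'a \<Rightarrow> complex) \<Rightarrow> 'a \<Rightarrow> 'a \<Rightarrow> complex" where
  "part11 J \<beta> = (\<lambda>x y. (\<beta> x y + \<beta> (J x) (J y)) / 2)"

definition dbar :: "'a bracket \<Rightarrow> ('a \<Rightarrow> 'a) \<Rightarrow> ('a \<Rightarrow> complex) \<Rightarrow> 'a \<Rightarrow> 'a \<Rightarrow> complex" where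
  "dbar br J \<alpha> = part11 J (ce_d br \<alpha>)"

definition cscale :: "complex \<Rightarrow> ('a \<Rightarrow> complex) \<Rightarrow> 'a \<Rightarrow> complex" where
  "cscale c f = (\<lambda>x. c * f x)"

interpretation cfun: vector_space "cscale :: complex \<Rightarrow> ('a \<Rightarrow> complex) \<Rightarrow> 'a \<Rightarrow> complex"
  by standard (auto simp: cscale_def fun_eq_iff algebra_simps)

definition one_abelian :: "nat \<Rightarrow> 'a::real_vector bracket \<Rightarrow> ('a \<Rightarrow> 'a) \<Rightarrow> bool" where
  "one_abelian n br J \<longleftrightarrow> lie_bracket br \<and> nilpotent_bracket br \<and> abelian_structure br J \<and>
     cfun.dim {\<alpha> \<in> forms10 J. dbar br J \<alpha> = (\<lambda>x y. 0)} = n - 1"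

text \<open>The structure is \<open>J\<^sub>M\<close>. Indices start at 0, so the non-closed basis form is
  \<open>\<omega> (n - 1)\<close>.\<close>

definition presented_by ::
  "nat \<Rightarrow> 'a::real_vector bracket \<Rightarrow> ('a \<Rightarrow> 'a) \<Rightarrow> complex mat \<Rightarrow> bool" where
  "presented_by n br J M \<longleftrightarrow>
     M \<in> carrier_mat (n - 1) (n - 1) \<and> M \<noteq> 0\<^sub>m (n - 1) (n - 1) \<and>
     (\<exists>\<omega> :: nat \<Rightarrow> 'a \<Rightarrow> complex.
        inj_on \<omega> {..<n} \<and> cfun.independent (\<omega> ` {..<n}) \<and>
        cfun.span (\<omega> ` {..<n}) = forms10 J \<and>
        (\<forall>i < n - 1. ce_d br (\<omega> i) = (\<lambda>x y. 0)) \<and>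
        ce_d br (\<omega> (n - 1)) =
          (\<lambda>x y. \<Sum>j<n - 1. \<Sum>k<n - 1. M $$ (j, k) * wedge (\<omega> j) (conj_form (\<omega> k)) x y))"

text \<open>\<open>F\<close> is the linear map on (1,0)-forms together with its extension to all 1-forms by
  conjugation, and \<open>G\<close> its extension to 2-forms by wedge products.\<close>

definition equivalent_structures :: "'a::real_vector cstruct \<Rightarrow> 'a cstruct \<Rightarrow> bool" where
  "equivalent_structures X Y \<longleftrightarrow> (case (X, Y) of ((br1, J1), (br2, J2)) \<Rightarrow>
     \<exists>(F :: ('a \<Rightarrow> complex) \<Rightarrow> 'a \<Rightarrow> complex)
      (G :: ('a \<Rightarrow> 'a \<Rightarrow> complex) \<Rightarrow> 'a \<Rightarrow> 'a \<Rightarrow> complex).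
       bij_betw F (forms10 J1) (forms10 J2) \<and>
       (\<forall>\<alpha>\<in>cforms1. \<forall>\<beta>\<in>cforms1. F (\<lambda>x. \<alpha> x + \<beta> x) = (\<lambda>x. F \<alpha> x + F \<beta> x)) \<and>
       (\<forall>c. \<forall>\<alpha>\<in>cforms1. F (\<lambda>x. c * \<alpha> x) = (\<lambda>x. c * F \<alpha> x)) \<and>
       (\<forall>\<alpha>\<in>cforms1. F (conj_form \<alpha>) = conj_form (F \<alpha>)) \<and>
       (\<forall>\<alpha>\<in>cforms2. \<forall>\<beta>\<in>cforms2. G (\<lambda>x y. \<alpha> x y + \<beta> x y) = (\<lambda>x y. G \<alpha> x y + G \<beta> x y)) \<and>
       (\<forall>c. \<forall>\<alpha>\<in>cforms2. G (\<lambda>x y. c * \<alpha> x y) = (\<lambda>x y. c * G \<alpha> x y)) \<and>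
       (\<forall>\<alpha>\<in>cforms1. \<forall>\<beta>\<in>cforms1. G (wedge \<alpha> \<beta>) = wedge (F \<alpha>) (F \<beta>)) \<and>
       (\<forall>\<alpha>\<in>forms10 J1. G (ce_d br1 \<alpha>) = ce_d br2 (F \<alpha>)))"

section \<open>Block decompositions under *congruence\<close>

definition star_congruent :: "complex mat \<Rightarrow> complex mat \<Rightarrow> bool" where
  "star_congruent A B \<longleftrightarrow> (\<exists>k P. A \<in> carrier_mat k k \<and> B \<in> carrier_mat k k \<and>
     P \<in> carrier_mat k k \<and> invertible_mat P \<and> B = P * A * mat_adjoint P)"

text \<open>With indices from 0 the entries 1 are at \<open>j + k = m - 1\<close>, the entries \<open>\<i>\<close> at \<open>j + k = m\<close>.\<close>

definition Delta_mat :: "nat \<Rightarrow> complex mat" where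
  "Delta_mat m = mat m m (\<lambda>(j, k). if j + k + 1 = m then 1 else if j + k = m then \<i> else 0)"

definition H_mat :: "nat \<Rightarrow> complex \<Rightarrow> complex mat" where
  "H_mat m \<mu> = four_block_mat (0\<^sub>m m m) (1\<^sub>m m) (jordan_block m \<mu>) (0\<^sub>m m m)"

text \<open>\<open>Delta_block u m\<close> stands for \<open>u \<Delta>\<^sub>m\<close> and \<open>H_block \<mu> m\<close> for \<open>H\<close> of order \<open>2m\<close>.\<close>

datatype regular_block = Delta_block complex nat | H_block complex nat

fun block_mat :: "regular_block \<Rightarrow> complex mat" where
  "block_mat (Delta_block u m) = u \<cdot>\<^sub>m Delta_mat m"
| "block_mat (H_block \<mu> m) = H_mat m \<mu>"

fun valid_block :: "regular_block \<Rightarrow> bool" where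
  "valid_block (Delta_block u m) \<longleftrightarrow> cmod u = 1 \<and> m > 0"
| "valid_block (H_block \<mu> m) \<longleftrightarrow> cmod \<mu> > 1 \<and> m > 0"

definition cosquare :: "complex mat \<Rightarrow> complex mat" where
  "cosquare R = the (mat_inverse (mat_adjoint R)) * R"

text \<open>From a Jordan form (a list of pairs of block size and eigenvalue): the multiset containing,
  for each distinct eigenvalue in \<open>E\<close>, the multiset of the sizes of its Jordan blocks.\<close>

definition eigen_partitions :: "(nat \<times> complex) list \<Rightarrow> complex set \<Rightarrow> nat multiset multiset" where
  "eigen_partitions n_as E =
     image_mset (\<lambda>e. mset (map fst (filter (\<lambda>p. snd p = e) n_as))) (mset_set (snd ` set n_as \<inter> E))"

text \<open>The components of a configuration: sizes of the nilpotent blocks, partitions of the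
  unimodular eigenvalues of the cosquare, partitions of its eigenvalues of modulus > 1.\<close>

type_synonym configuration = "nat multiset \<times> nat multiset multiset \<times> nat multiset multiset"

text \<open>Stated as a relation; by the theorem of Horn and Sergeichuk every square matrix has exactly
  one configuration.\<close>

definition has_configuration :: "complex mat \<Rightarrow> configuration \<Rightarrow> bool" where
  "has_configuration M c \<longleftrightarrow>
     (\<exists>(ks :: nat list) (bs :: regular_block list) R n_as.
        0 \<notin> set ks \<and> (\<forall>b\<in>set bs. valid_block b) \<and>
        R = diag_block_mat (map block_mat bs) \<and>
        star_congruent M (diag_block_mat (map (\<lambda>k. jordan_block k 0) ks @ map block_mat bs)) \<and>
        jordan_nf (cosquare R) n_as \<and>
        c = (mset ks, eigen_partitions n_as {e. cmod e = 1}, eigen_partitions n_as {e. cmod e > 1}))"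

definition maximal_type :: "complex mat \<Rightarrow> bool" where
  "maximal_type M \<longleftrightarrow> invertible_mat M \<or>
     (let m = dim_row M; r = vec_space.rank m M in
      \<exists>S M' N. S \<in> carrier_mat m m \<and> invertible_mat S \<and>
        M' \<in> carrier_mat r r \<and> N \<in> carrier_mat r (m - r) \<and>
        S * M * mat_adjoint S = four_block_mat M' N (0\<^sub>m (m - r) r) (0\<^sub>m (m - r) (m - r)) \<and>
        vec_space.rank r N = m - r)"

section \<open>The numbers a and s\<close>

definition a_num :: "nat \<Rightarrow> nat" where
  "a_num m = card {c. \<exists>M \<in> carrier_mat m m. invertible_mat M \<and> has_configuration M c}"

text \<open>A tuple \<open>(m\<^sub>3, \<dots>)\<close> of length \<open>2r - m\<close> is a list; used only for \<open>m \<le> 2r\<close>, \<open>r < m\<close>, where the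
  natural number subtractions are exact.\<close>

definition D_set :: "nat \<Rightarrow> nat \<Rightarrow> nat list set" where
  "D_set m r = {ms. length ms = 2 * r - m \<and> sorted_wrt (\<ge>) ms \<and>
     (ms \<noteq> [] \<longrightarrow> hd ms \<le> m - r) \<and> sum_list ms \<le> 2 * r - m}"

definition s_num_rank :: "nat \<Rightarrow> nat \<Rightarrow> nat" where
  "s_num_rank m r = (\<Sum>ms\<in>D_set m r. a_num (2 * r - m - sum_list ms))"

definition s_num :: "nat \<Rightarrow> nat" where
  "s_num m = (\<Sum>r\<in>{(m + 1) div 2..<m}. s_num_rank m r)"

section \<open>Families\<close>

definition maximal_structures :: "nat \<Rightarrow> 'a::real_vector cstruct set" where
  "maximal_structures n =
     {(br, J). one_abelian n br J \<and> (\<exists>M. presented_by n br J M \<and> maximal_type M)}"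

definition equivalence_classes :: "nat \<Rightarrow> 'a::real_vector cstruct set set" where
  "equivalence_classes n = maximal_structures n //
     {(X, Y). X \<in> maximal_structures n \<and> Y \<in> maximal_structures n \<and> equivalent_structures X Y}"

text \<open>The set of configurations of the matrices presenting a structure. It is a singleton, since
  equivalent structures have the same configuration.\<close>

definition structure_configurations :: "nat \<Rightarrow> 'a::real_vector cstruct \<Rightarrow> configuration set" where
  "structure_configurations n X =
     {c. \<exists>M. presented_by n (fst X) (snd X) M \<and> has_configuration M c}"

definition regular_hermitian :: "nat \<Rightarrow> 'a::real_vector cstruct \<Rightarrow> bool" where
  "regular_hermitian n X \<longleftrightarrow>
     (\<exists>M. presented_by n (fst X) (snd X) M \<and> invertible_mat M \<and> mat_adjoint M = M)"

definition division_into_families :: "nat \<Rightarrow> 'a::real_vector cstruct set set set \<Rightarrow> bool" where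
  "division_into_families n \<F> \<longleftrightarrow>
     partition_on (equivalence_classes n) \<F> \<and>
     (\<forall>\<Phi>\<in>\<F>. \<forall>X\<in>\<Union>\<Phi>. \<forall>Y\<in>\<Union>\<Phi>. structure_configurations n X = structure_configurations n Y) \<and>
     (\<forall>\<Phi>\<in>\<F>. \<forall>X\<in>\<Union>\<Phi>. \<forall>Y\<in>\<Union>\<Phi>. regular_hermitian n X \<and> regular_hermitian n Y \<longrightarrow>
        equivalent_structures X Y)"

end

theory Submission
  imports Defs "Jordan_Normal_Form.Jordan_Normal_Form_Uniqueness"
begin

text \<open>
  The bound counts invariants. Two structures in one family have the same set of configurations, and
  two regular Hermitian ones in one family are equivalent; so it suffices to exhibit enough structures
  of which no two can share a family.

  The link with matrices is that equivalent structures \<open>J\<^sub>M\<close>, \<open>J\<^sub>M\<^sub>'\<close> satisfy \<open>M' = c P M P*\<close> with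
  \<open>c \<noteq> 0\<close> and \<open>P\<close> invertible (\<open>equivalent_imp_scaled_congruent\<close>): a map commuting with \<open>d\<close>
  preserves the closed forms and rescales the remaining basis form modulo closed forms. In the other
  direction every nonzero matrix occurs (\<open>exists_structure\<close>).

  The main step is that \<open>M' = c P M P*\<close> forces \<open>M\<close> and \<open>M'\<close> to have the same configuration
  (\<open>configuration_unique\<close>), which is the uniqueness half of the Horn-Sergeichuk theorem in the
  form needed here. Starting from the whole space, take left orthogonal complements for the form of
  \<open>M\<close> repeatedly. For a canonical form (nilpotent blocks plus a regular part) all subspaces obtained
  are spanned by basis vectors, and their dimensions determine the number of nilpotent blocks of each
  size. The large even-numbered subspaces carry the regular part together with vectors that are
  orthogonal to it, so \<open>P\<close> induces a congruence, up to the same scalar, of the regular parts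
  (\<open>regularization_unique\<close>). A congruence up to a scalar multiplies the cosquare, up to
  similarity, by a number of modulus 1; this only rotates its eigenvalues, and the uniqueness of the
  Jordan form finishes the proof. Hence the configurations of a structure form a singleton.

  It remains to count. Each configuration of a regular matrix of order \<open>m = n - 1\<close> gives a family,
  which is \<open>a(m)\<close> families. The configuration of the Hermitian matrices is among them, and instead of
  one it gives one family for each signature \<open>(p, m - p)\<close> up to order, that is
  \<open>\<lfloor>m/2\<rfloor> + 1 = \<lfloor>(n+1)/2\<rfloor>\<close> families: by Sylvester's law of inertia, applied with a
  real scalar of either sign, these are pairwise inequivalent (\<open>scaled_congruent_signature\<close>). In the
  singular case a tuple \<open>(m\<^sub>3, m\<^sub>4, \<dots>)\<close> lists the numbers of nilpotent blocks of size at least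
  3, 4, \<dots>. It determines, together with the rank, the sizes of these blocks (all at least 2), so the
  pairs of a tuple and a regular configuration of the complementary order give \<open>s(m)\<close> distinct
  configurations of singular matrices of maximal type.
\<close>

section \<open>Matrices and adjoints\<close>

lemma mat_adjoint_dim [simp]:
  "dim_row (mat_adjoint A) = dim_col A" "dim_col (mat_adjoint A) = dim_row A"
  unfolding mat_adjoint_def by auto

lemma mat_adjoint_carrier [intro]:
  "A \<in> carrier_mat n m \<Longrightarrow> mat_adjoint A \<in> carrier_mat m n"
  by auto

lemma mat_adjoint_index:
  fixes A :: "complex mat"
  assumes "A \<in> carrier_mat n n" "i < n" "j < n"
  shows "mat_adjoint A $$ (i, j) = cnj (A $$ (j, i))"
  using assms unfolding mat_adjoint_def by (auto simp: mat_of_rows_def)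

lemma mat_mult_index:
  assumes "A \<in> carrier_mat n m" "B \<in> carrier_mat m l" "i < n" "j < l"
  shows "(A * B) $$ (i, j) = (\<Sum>k<m. A $$ (i, k) * B $$ (k, j))"
  using assms by (auto simp: scalar_prod_def atLeast0LessThan)

lemma mat_adjoint_mult:
  fixes A B :: "complex mat"
  assumes A: "A \<in> carrier_mat n n" and B: "B \<in> carrier_mat n n"
  shows "mat_adjoint (A * B) = mat_adjoint B * mat_adjoint A"
proof (rule eq_matI)
  have AB: "A * B \<in> carrier_mat n n" using assms by auto
  fix i j assume "i < dim_row (mat_adjoint B * mat_adjoint A)" "j < dim_col (mat_adjoint B * mat_adjoint A)"
  hence ij: "i < n" "j < n" using assms by auto
  have "mat_adjoint (A * B) $$ (i, j) = cnj (\<Sum>k<n. A $$ (j, k) * B $$ (k, i))"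
    using mat_adjoint_index[OF AB ij] mat_mult_index[OF A B ij(2,1)] by simp
  also have "\<dots> = (\<Sum>k<n. mat_adjoint B $$ (i, k) * mat_adjoint A $$ (k, j))"
    unfolding cnj_sum by (rule sum.cong) (use ij mat_adjoint_index[OF A] mat_adjoint_index[OF B] in auto)
  also have "\<dots> = (mat_adjoint B * mat_adjoint A) $$ (i, j)"
    using mat_mult_index[OF mat_adjoint_carrier[OF B] mat_adjoint_carrier[OF A] ij] by simp
  finally show "mat_adjoint (A * B) $$ (i, j) = (mat_adjoint B * mat_adjoint A) $$ (i, j)" .
qed (use assms in auto)

lemma mat_adjoint_smult:
  fixes A :: "complex mat"
  assumes A: "A \<in> carrier_mat n n"
  shows "mat_adjoint (c \<cdot>\<^sub>m A) = cnj c \<cdot>\<^sub>m mat_adjoint A"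
proof (rule eq_matI)
  have cA: "c \<cdot>\<^sub>m A \<in> carrier_mat n n" using A by auto
  note C = mat_adjoint_carrier[OF A] mat_adjoint_carrier[OF cA]
  fix i j assume "i < dim_row (cnj c \<cdot>\<^sub>m mat_adjoint A)" "j < dim_col (cnj c \<cdot>\<^sub>m mat_adjoint A)"
  hence ij: "i < n" "j < n" using C by auto
  thus "mat_adjoint (c \<cdot>\<^sub>m A) $$ (i, j) = (cnj c \<cdot>\<^sub>m mat_adjoint A) $$ (i, j)"
    using mat_adjoint_index[OF A ij] mat_adjoint_index[OF cA ij] A C by auto
qed (use A in auto)

lemma mat_adjoint_one: "mat_adjoint (1\<^sub>m n) = (1\<^sub>m n :: complex mat)"
  by (rule eq_matI) (auto simp: mat_adjoint_index[of _ n])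

lemma mat_adjoint_adjoint:
  fixes A :: "complex mat"
  assumes A: "A \<in> carrier_mat n n"
  shows "mat_adjoint (mat_adjoint A) = A"
  by (rule eq_matI) (use A mat_adjoint_carrier[OF A] in \<open>auto simp: mat_adjoint_index[of _ n]\<close>)

lemma invertible_mat_iff:
  assumes "A \<in> carrier_mat n n"
  shows "invertible_mat A \<longleftrightarrow> (\<exists>B \<in> carrier_mat n n. A * B = 1\<^sub>m n \<and> B * A = 1\<^sub>m n)"
proof
  assume "invertible_mat A"
  then obtain B where B: "A * B = 1\<^sub>m (dim_row A)" "B * A = 1\<^sub>m (dim_row B)"
    unfolding invertible_mat_def inverts_mat_def by auto
  have "dim_col (A * B) = n" "dim_col (B * A) = dim_row B" unfolding B using assms by auto
  hence "B \<in> carrier_mat n n" using assms by auto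
  with B assms show "\<exists>B \<in> carrier_mat n n. A * B = 1\<^sub>m n \<and> B * A = 1\<^sub>m n" by auto
qed (use assms in \<open>auto simp: invertible_mat_def inverts_mat_def\<close>)

lemma invertible_mat_iff_det:
  fixes A :: "complex mat"
  assumes A: "A \<in> carrier_mat n n"
  shows "invertible_mat A \<longleftrightarrow> det A \<noteq> 0"
proof
  assume "invertible_mat A"
  then obtain B where B: "B \<in> carrier_mat n n" "A * B = 1\<^sub>m n" using invertible_mat_iff[OF A] by auto
  have "det A * det B = 1" using det_mult[OF A B(1)] B by simp
  thus "det A \<noteq> 0" by auto
next
  assume "det A \<noteq> 0"
  from det_non_zero_imp_unit[OF A this, of "()"] show "invertible_mat A"
    unfolding invertible_mat_iff[OF A] Units_def ring_mat_def by auto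
qed

lemma det_mat_adjoint_nz:
  fixes A :: "complex mat"
  assumes A: "A \<in> carrier_mat n n"
  shows "det (mat_adjoint A) \<noteq> 0 \<longleftrightarrow> det A \<noteq> 0"
proof -
  have *: "det (mat_adjoint B) \<noteq> 0" if B: "B \<in> carrier_mat n n" "det B \<noteq> 0" for B :: "complex mat"
  proof -
    from that obtain C where C: "C \<in> carrier_mat n n" "B * C = 1\<^sub>m n"
      using invertible_mat_iff[OF B(1)] invertible_mat_iff_det[OF B(1)] by auto
    have "mat_adjoint C * mat_adjoint B = 1\<^sub>m n"
      using mat_adjoint_mult[OF B(1) C(1)] C by (simp add: mat_adjoint_one)
    hence "det (mat_adjoint C) * det (mat_adjoint B) = 1"
      using det_mult[OF mat_adjoint_carrier[OF C(1)] mat_adjoint_carrier[OF B(1)]] by simp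
    thus ?thesis by auto
  qed
  show ?thesis using *[OF A] *[OF mat_adjoint_carrier[OF A]] mat_adjoint_adjoint[OF A] by auto
qed

lemma congruence_index:
  fixes A P :: "complex mat"
  assumes P: "P \<in> carrier_mat m m" and A: "A \<in> carrier_mat m m" and ij: "i < m" "j < m"
  shows "(P * A * mat_adjoint P) $$ (i, j) =
    (\<Sum>k<m. \<Sum>l<m. P $$ (i, k) * A $$ (k, l) * cnj (P $$ (j, l)))"
proof -
  have "(P * A * mat_adjoint P) $$ (i, j) = (\<Sum>l<m. (P * A) $$ (i, l) * mat_adjoint P $$ (l, j))"
    by (rule mat_mult_index) (use assms in auto)
  also have "\<dots> = (\<Sum>l<m. (\<Sum>k<m. P $$ (i, k) * A $$ (k, l)) * cnj (P $$ (j, l)))"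
    by (rule sum.cong) (use ij mat_mult_index[OF P A ij(1)] mat_adjoint_index[OF P] in auto)
  also have "\<dots> = (\<Sum>k<m. \<Sum>l<m. P $$ (i, k) * A $$ (k, l) * cnj (P $$ (j, l)))"
    unfolding sum_distrib_right by (rule sum.swap)
  finally show ?thesis .
qed

lemma congruence_inverse:
  fixes A P :: "complex mat"
  assumes P: "P \<in> carrier_mat m m" and A: "A \<in> carrier_mat m m"
    and Q: "Q \<in> carrier_mat m m" "Q * P = 1\<^sub>m m"
  shows "Q * (c \<cdot>\<^sub>m (P * A * mat_adjoint P)) * mat_adjoint Q = c \<cdot>\<^sub>m A"
proof -
  have aQ: "mat_adjoint Q \<in> carrier_mat m m" and aP: "mat_adjoint P \<in> carrier_mat m m" using P Q by auto
  have PAP: "P * A * mat_adjoint P \<in> carrier_mat m m" using P A aP by auto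
  have "Q * (P * A * mat_adjoint P) * mat_adjoint Q = (Q * P) * A * (mat_adjoint P * mat_adjoint Q)"
    using P A Q(1) aP aQ by (simp add: assoc_mult_mat[of _ m m _ m _ m])
  also have "mat_adjoint P * mat_adjoint Q = 1\<^sub>m m"
    using mat_adjoint_mult[OF Q(1) P] Q by (simp add: mat_adjoint_one)
  finally have *: "Q * (P * A * mat_adjoint P) * mat_adjoint Q = A" using Q A by simp
  have "Q * (c \<cdot>\<^sub>m (P * A * mat_adjoint P)) * mat_adjoint Q = c \<cdot>\<^sub>m (Q * (P * A * mat_adjoint P) * mat_adjoint Q)"
    using mult_smult_distrib[OF Q(1) PAP] mult_smult_assoc_mat[OF mult_carrier_mat[OF Q(1) PAP] aQ] by simp
  with * show ?thesis by simp
qed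

text \<open>Congruence up to a nonzero scalar is the relation between matrices presenting equivalent
  structures: the scalar comes from rescaling the non-closed form.\<close>

definition scaled_congruent :: "nat \<Rightarrow> complex mat \<Rightarrow> complex mat \<Rightarrow> bool" where
  "scaled_congruent m A B \<longleftrightarrow> A \<in> carrier_mat m m \<and> B \<in> carrier_mat m m \<and>
     (\<exists>c P. c \<noteq> 0 \<and> P \<in> carrier_mat m m \<and> invertible_mat P \<and> B = c \<cdot>\<^sub>m (P * A * mat_adjoint P))"

lemma smult_inverse_cancel: "c \<noteq> 0 \<Longrightarrow> inverse c \<cdot>\<^sub>m (c \<cdot>\<^sub>m A) = (A :: complex mat)"
  by (rule eq_matI) auto

lemma scaled_congruent_sym:
  assumes "scaled_congruent m A B" shows "scaled_congruent m B A"
proof -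
  from assms obtain c P where A: "A \<in> carrier_mat m m" and B: "B \<in> carrier_mat m m" and c: "c \<noteq> 0"
    and P: "P \<in> carrier_mat m m" "invertible_mat P" and eq: "B = c \<cdot>\<^sub>m (P * A * mat_adjoint P)"
    unfolding scaled_congruent_def by auto
  obtain Q where Q: "Q \<in> carrier_mat m m" "P * Q = 1\<^sub>m m" "Q * P = 1\<^sub>m m"
    using invertible_mat_iff[OF P(1)] P by auto
  have "Q * B * mat_adjoint Q = c \<cdot>\<^sub>m A" unfolding eq by (rule congruence_inverse[OF P(1) A Q(1,3)])
  hence "A = inverse c \<cdot>\<^sub>m (Q * B * mat_adjoint Q)"
    using smult_inverse_cancel[OF c, of A] by (simp only:)
  moreover have "invertible_mat Q" using invertible_mat_iff[OF Q(1)] P Q by auto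
  ultimately show ?thesis unfolding scaled_congruent_def using A B Q c
    by (metis inverse_nonzero_iff_nonzero)
qed

lemma scaled_congruent_trans:
  assumes "scaled_congruent m A B" "scaled_congruent m B C" shows "scaled_congruent m A C"
proof -
  from assms(1) obtain c P where A: "A \<in> carrier_mat m m" and B: "B \<in> carrier_mat m m" and c: "c \<noteq> 0"
    and P: "P \<in> carrier_mat m m" "invertible_mat P" and eq: "B = c \<cdot>\<^sub>m (P * A * mat_adjoint P)"
    unfolding scaled_congruent_def by auto
  from assms(2) obtain d Q where C: "C \<in> carrier_mat m m" and d: "d \<noteq> 0"
    and Q: "Q \<in> carrier_mat m m" "invertible_mat Q" and eq2: "C = d \<cdot>\<^sub>m (Q * B * mat_adjoint Q)"
    unfolding scaled_congruent_def by auto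
  have aQ: "mat_adjoint Q \<in> carrier_mat m m" and aP: "mat_adjoint P \<in> carrier_mat m m" using P Q by auto
  have PAP: "P * A * mat_adjoint P \<in> carrier_mat m m" using P A aP by auto
  have "Q * B * mat_adjoint Q = c \<cdot>\<^sub>m (Q * (P * A * mat_adjoint P) * mat_adjoint Q)"
    unfolding eq using mult_smult_distrib[OF Q(1) PAP] mult_smult_assoc_mat[OF mult_carrier_mat[OF Q(1) PAP] aQ] by simp
  also have "Q * (P * A * mat_adjoint P) * mat_adjoint Q = (Q * P) * A * (mat_adjoint (Q * P))"
    using P A Q(1) aP aQ by (simp add: assoc_mult_mat[of _ m m _ m _ m] mat_adjoint_mult[of _ m])
  finally have "C = (d * c) \<cdot>\<^sub>m ((Q * P) * A * (mat_adjoint (Q * P)))" unfolding eq2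
    by (intro eq_matI) auto
  moreover have "invertible_mat (Q * P)"
    using P Q det_mult[OF Q(1) P(1)] invertible_mat_iff_det[of _ m] by auto
  ultimately show ?thesis unfolding scaled_congruent_def using A C c d P(1) Q(1)
    by (metis mult_carrier_mat mult_eq_0_iff)
qed

lemma star_congruent_imp_scaled:
  assumes "star_congruent A B" "A \<in> carrier_mat m m" shows "scaled_congruent m A B"
proof -
  from assms obtain P where "B \<in> carrier_mat m m" "P \<in> carrier_mat m m" "invertible_mat P"
     "B = P * A * mat_adjoint P" unfolding star_congruent_def carrier_mat_def by auto
  moreover have "B = 1 \<cdot>\<^sub>m B" by (rule eq_matI) auto
  ultimately show ?thesis unfolding scaled_congruent_def using assms(2) by (metis zero_neq_one)
qed

lemma star_congruent_refl:
  assumes "A \<in> carrier_mat m m" shows "star_congruent A A"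
  unfolding star_congruent_def
  by (rule exI[of _ m], rule exI[of _ "1\<^sub>m m"])
     (use assms in \<open>auto simp: mat_adjoint_one invertible_mat_iff[of _ m] intro!: bexI[of _ "1\<^sub>m m"]\<close>)

lemma scaled_congruent_invertible:
  assumes "scaled_congruent m A B" shows "invertible_mat A \<longleftrightarrow> invertible_mat B"
proof -
  from assms obtain c P where A: "A \<in> carrier_mat m m" and B: "B \<in> carrier_mat m m" and c: "c \<noteq> 0"
    and P: "P \<in> carrier_mat m m" "invertible_mat P" and eq: "B = c \<cdot>\<^sub>m (P * A * mat_adjoint P)"
    unfolding scaled_congruent_def by auto
  have aP: "mat_adjoint P \<in> carrier_mat m m" using P by auto
  have "det B = c ^ m * (det P * det A * det (mat_adjoint P))"
    unfolding eq using det_mult[OF mult_carrier_mat[OF P(1) A] aP] det_mult[OF P(1) A] P A aP by simp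
  moreover have "det P \<noteq> 0" using P invertible_mat_iff_det by auto
  ultimately show ?thesis
    using invertible_mat_iff_det[OF A] invertible_mat_iff_det[OF B] det_mat_adjoint_nz[OF P(1)] c by auto
qed

section \<open>Iterated left orthogonal complements\<close>

definition coord_space :: "nat set \<Rightarrow> (nat \<Rightarrow> complex) set" where
  "coord_space S = {x. \<forall>i. i \<notin> S \<longrightarrow> x i = 0}"

text \<open>With fewer equations than unknowns the columns of the system are linearly dependent. Two equal
  columns are treated separately, because they form a dependent family but not a dependent set.\<close>

lemma homogeneous_system:
  fixes A :: "nat \<Rightarrow> nat \<Rightarrow> complex"
  assumes S: "finite S" and T: "finite T" and less: "card S < card T"
  shows "\<exists>x \<in> coord_space T. (\<exists>j. x j \<noteq> 0) \<and> (\<forall>i\<in>S. (\<Sum>j\<in>T. A i j * x j) = 0)"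
proof (cases "inj_on (\<lambda>j i. if i \<in> S then A i j else 0) T")
  case False
  then obtain a b where ab: "a \<in> T" "b \<in> T" "a \<noteq> b"
    "(\<lambda>i. if i \<in> S then A i a else 0) = (\<lambda>i. if i \<in> S then A i b else 0)"
    unfolding inj_on_def by blast
  have eq: "A i a = A i b" if "i \<in> S" for i using fun_cong[OF ab(4), of i] that by simp
  define x where "x = (\<lambda>j. if j = a then 1 else if j = b then -1 else (0::complex))"
  have "(\<Sum>j\<in>T. A i j * x j) = 0" if i: "i \<in> S" for i
  proof -
    have "(\<Sum>j\<in>T. A i j * x j) = (\<Sum>j\<in>{a,b}. A i j * x j)"
      by (rule sum.mono_neutral_right) (use ab T in \<open>auto simp: x_def\<close>)
    also have "\<dots> = 0" using ab(3) eq[OF i] by (simp add: x_def)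
    finally show ?thesis .
  qed
  moreover have "x \<in> coord_space T" "x a \<noteq> 0" using ab by (auto simp: coord_space_def x_def)
  ultimately show ?thesis by blast
next
  case True
  define v where "v = (\<lambda>(j::nat) (i::nat). if i \<in> S then A i j else (0::complex))"
  define e where "e = (\<lambda>(k::nat) (i::nat). if i = k then (1::complex) else (0::complex))"
  have inj: "inj_on v T" using True by (simp add: v_def)
  have sum_app: "(\<Sum>k\<in>K. f k) i = (\<Sum>k\<in>K. f k i)" for K :: "'b set" and f :: "'b \<Rightarrow> nat \<Rightarrow> complex" and i
    by (induction K rule: infinite_finite_induct) auto
  have "v j \<in> cfun.span (e ` S)" for j
  proof -
    have "v j = (\<Sum>k\<in>S. cscale (A k j) (e k))"
    proof
      fix i
      have "(\<Sum>k\<in>S. cscale (A k j) (e k)) i = (\<Sum>k\<in>S. if k = i then A k j else 0)"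
        unfolding sum_app cscale_def e_def by (rule sum.cong) auto
      also have "\<dots> = v j i" using S by (simp add: v_def)
      finally show "v j i = (\<Sum>k\<in>S. cscale (A k j) (e k)) i" by simp
    qed
    moreover have "(\<Sum>k\<in>S. cscale (A k j) (e k)) \<in> cfun.span (e ` S)"
      by (intro cfun.span_sum cfun.span_scale cfun.span_base imageI)
    ultimately show ?thesis by (simp only:)
  qed
  hence sub: "v ` T \<subseteq> cfun.span (e ` S)" by auto
  have "cfun.dependent (v ` T)"
  proof (rule ccontr)
    assume "cfun.independent (v ` T)"
    from cfun.independent_span_bound[OF _ this sub] S
    have "card (v ` T) \<le> card (e ` S)" by auto
    also have "\<dots> \<le> card S" by (rule card_image_le[OF S])
    finally show False using less card_image[OF inj] by simp
  qed
  then obtain u where u: "\<exists>w\<in>v ` T. u w \<noteq> 0" "(\<Sum>w\<in>v ` T. cscale (u w) w) = 0"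
    using cfun.dependent_finite[of "v ` T"] T by auto
  define x where "x = (\<lambda>j. if j \<in> T then u (v j) else 0)"
  have "(\<Sum>j\<in>T. A i j * x j) = 0" if i: "i \<in> S" for i
  proof -
    have "0 = (\<Sum>w\<in>v ` T. cscale (u w) w) i" using u(2) by simp
    also have "\<dots> = (\<Sum>j\<in>T. u (v j) * v j i)" unfolding sum_app
      using inj by (simp add: sum.reindex cscale_def)
    also have "\<dots> = (\<Sum>j\<in>T. A i j * x j)" by (rule sum.cong) (use i in \<open>auto simp: v_def x_def\<close>)
    finally show ?thesis by simp
  qed
  moreover have "x \<in> coord_space T" by (auto simp: coord_space_def x_def)
  moreover have "\<exists>j. x j \<noteq> 0" using u(1) by (auto simp: x_def)
  ultimately show ?thesis by blast
qed

text \<open>Vectors are functions supported on an initial segment; a matrix acts on them as row vectors,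
  so that the form of \<open>P * A * mat_adjoint P\<close> is the form of \<open>A\<close> pulled back along this action.\<close>

definition row_action :: "nat \<Rightarrow> complex mat \<Rightarrow> (nat \<Rightarrow> complex) \<Rightarrow> nat \<Rightarrow> complex" where
  "row_action m P x = (\<lambda>j. if j < m then \<Sum>i<m. x i * P $$ (i, j) else 0)"

definition mat_form :: "nat \<Rightarrow> complex mat \<Rightarrow> (nat \<Rightarrow> complex) \<Rightarrow> (nat \<Rightarrow> complex) \<Rightarrow> complex" where
  "mat_form m A x y = (\<Sum>i<m. \<Sum>j<m. x i * A $$ (i, j) * cnj (y j))"

lemma row_action_closed: "row_action m P x \<in> coord_space {..<m}"
  by (auto simp: row_action_def coord_space_def)

lemma row_action_mult:
  assumes P: "P \<in> carrier_mat m m" and Q: "Q \<in> carrier_mat m m"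
  shows "row_action m Q (row_action m P x) = row_action m (P * Q) x"
proof
  fix j
  have "(\<Sum>i<m. (\<Sum>k<m. x k * P $$ (k, i)) * Q $$ (i, j)) = (\<Sum>k<m. x k * (P * Q) $$ (k, j))" if j: "j < m"
  proof -
    have "(\<Sum>i<m. (\<Sum>k<m. x k * P $$ (k, i)) * Q $$ (i, j)) = (\<Sum>i<m. \<Sum>k<m. x k * (P $$ (k, i) * Q $$ (i, j)))"
      by (simp add: sum_distrib_right mult.assoc)
    also have "\<dots> = (\<Sum>k<m. \<Sum>i<m. x k * (P $$ (k, i) * Q $$ (i, j)))" by (rule sum.swap)
    also have "\<dots> = (\<Sum>k<m. x k * (P * Q) $$ (k, j))"
      by (rule sum.cong) (use mat_mult_index[OF P Q _ j] in \<open>auto simp: sum_distrib_left\<close>)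
    finally show ?thesis .
  qed
  thus "row_action m Q (row_action m P x) j = row_action m (P * Q) x j"
    by (auto simp: row_action_def)
qed

lemma row_action_one: "x \<in> coord_space {..<m} \<Longrightarrow> row_action m (1\<^sub>m m) x = x"
proof
  fix j assume x: "x \<in> coord_space {..<m}"
  have "(\<Sum>i<m. x i * 1\<^sub>m m $$ (i, j)) = (\<Sum>i<m. if i = j then x i else 0)" if "j < m"
    by (rule sum.cong) (use that in auto)
  thus "row_action m (1\<^sub>m m) x j = x j" using x by (auto simp: row_action_def coord_space_def)
qed

lemma mat_form_congruence:
  assumes P: "P \<in> carrier_mat m m" and A: "A \<in> carrier_mat m m"
  shows "mat_form m (c \<cdot>\<^sub>m (P * A * mat_adjoint P)) x y = c * mat_form m A (row_action m P x) (row_action m P y)"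
proof -
  have "mat_form m (c \<cdot>\<^sub>m (P * A * mat_adjoint P)) x y =
     (\<Sum>i<m. \<Sum>j<m. \<Sum>k<m. \<Sum>l<m. c * (x i * P $$ (i, k) * A $$ (k, l) * cnj (y j * P $$ (j, l))))"
    unfolding mat_form_def
  proof (intro sum.cong refl)
    fix i j assume "i \<in> {..<m}" "j \<in> {..<m}"
    hence ij: "i < m" "j < m" by auto
    have "(c \<cdot>\<^sub>m (P * A * mat_adjoint P)) $$ (i, j) = c * (P * A * mat_adjoint P) $$ (i, j)"
      using ij P A by auto
    thus "x i * (c \<cdot>\<^sub>m (P * A * mat_adjoint P)) $$ (i, j) * cnj (y j) =
       (\<Sum>k<m. \<Sum>l<m. c * (x i * P $$ (i, k) * A $$ (k, l) * cnj (y j * P $$ (j, l))))"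
      unfolding congruence_index[OF P A ij]
      by (simp add: sum_distrib_left sum_distrib_right mult_ac)
  qed
  also have "\<dots> = (\<Sum>k<m. \<Sum>l<m. \<Sum>i<m. \<Sum>j<m. c * (x i * P $$ (i, k) * A $$ (k, l) * cnj (y j * P $$ (j, l))))"
  proof -
    let ?f = "\<lambda>i j k l. c * (x i * P $$ (i, k) * A $$ (k, l) * cnj (y j * P $$ (j, l)))"
    have "(\<Sum>i<m. \<Sum>j<m. \<Sum>k<m. \<Sum>l<m. ?f i j k l) = (\<Sum>i<m. \<Sum>k<m. \<Sum>j<m. \<Sum>l<m. ?f i j k l)"
      by (intro sum.cong refl sum.swap)
    also have "\<dots> = (\<Sum>k<m. \<Sum>i<m. \<Sum>j<m. \<Sum>l<m. ?f i j k l)" by (rule sum.swap)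
    also have "\<dots> = (\<Sum>k<m. \<Sum>i<m. \<Sum>l<m. \<Sum>j<m. ?f i j k l)" by (intro sum.cong refl sum.swap)
    also have "\<dots> = (\<Sum>k<m. \<Sum>l<m. \<Sum>i<m. \<Sum>j<m. ?f i j k l)" by (intro sum.cong refl sum.swap)
    finally show ?thesis .
  qed
  also have "\<dots> = c * mat_form m A (row_action m P x) (row_action m P y)"
    unfolding mat_form_def row_action_def
    by (simp add: sum_distrib_left sum_distrib_right mult_ac cnj_sum)
  finally show ?thesis .
qed

definition left_perp :: "nat \<Rightarrow> complex mat \<Rightarrow> (nat \<Rightarrow> complex) set \<Rightarrow> (nat \<Rightarrow> complex) set" where
  "left_perp m A W = {x \<in> coord_space {..<m}. \<forall>w\<in>W. mat_form m A x w = 0}"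

lemma left_perp_iterates_congruence:
  assumes P: "P \<in> carrier_mat m m" "invertible_mat P" and A: "A \<in> carrier_mat m m" and c: "c \<noteq> 0"
    and B: "B = c \<cdot>\<^sub>m (P * A * mat_adjoint P)"
  shows "row_action m P ` ((left_perp m B ^^ k) (coord_space {..<m})) = (left_perp m A ^^ k) (coord_space {..<m})"
proof (induction k)
  case 0
  obtain Q where Q: "Q \<in> carrier_mat m m" "Q * P = 1\<^sub>m m" using invertible_mat_iff[OF P(1)] P by auto
  have "x \<in> row_action m P ` coord_space {..<m}" if "x \<in> coord_space {..<m}" for x
    using row_action_mult[OF Q(1) P(1), of x] row_action_one[OF that] row_action_closed[of m Q x] Q(2)
    by (metis image_eqI)
  thus ?case using row_action_closed by auto
next
  case (Suc k)
  let ?W = "(left_perp m B ^^ k) (coord_space {..<m})"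
  obtain Q where Q: "Q \<in> carrier_mat m m" "Q * P = 1\<^sub>m m" using invertible_mat_iff[OF P(1)] P by auto
  have "row_action m P ` left_perp m B ?W = left_perp m A (row_action m P ` ?W)"
  proof (intro equalityI subsetI)
    fix z assume "z \<in> row_action m P ` left_perp m B ?W"
    then show "z \<in> left_perp m A (row_action m P ` ?W)"
      using mat_form_congruence[OF P(1) A, of c] c row_action_closed unfolding left_perp_def B by auto
  next
    fix z assume z: "z \<in> left_perp m A (row_action m P ` ?W)"
    hence zc: "z \<in> coord_space {..<m}" by (simp add: left_perp_def)
    let ?x = "row_action m Q z"
    have zx: "z = row_action m P ?x"
      using row_action_mult[OF Q(1) P(1), of z] row_action_one[OF zc] Q(2) by simp
    have "?x \<in> left_perp m B ?W"
      using z zx mat_form_congruence[OF P(1) A, of c ?x] row_action_closed unfolding left_perp_def B by auto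
    thus "z \<in> row_action m P ` left_perp m B ?W" using zx by auto
  qed
  thus ?case using Suc.IH by simp
qed

text \<open>An injective linear map cannot lower the dimension.\<close>

lemma coord_space_image_card:
  assumes P: "P \<in> carrier_mat m m" "invertible_mat P" and ST: "S \<subseteq> {..<m}" "T \<subseteq> {..<m}"
    and sub: "row_action m P ` coord_space T \<subseteq> coord_space S"
  shows "card T \<le> card S"
proof (rule ccontr)
  assume "\<not> card T \<le> card S"
  hence less: "card S < card T" by simp
  have fin: "finite S" "finite T" using ST finite_subset by auto
  obtain x where x: "x \<in> coord_space T" "\<exists>j. x j \<noteq> 0" "\<forall>i\<in>S. (\<Sum>j\<in>T. P $$ (j, i) * x j) = 0"
    using homogeneous_system[OF fin less, of "\<lambda>i j. P $$ (j, i)"] by blast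
  have "row_action m P x i = 0" for i
  proof (cases "i \<in> S")
    case True
    have "(\<Sum>j<m. x j * P $$ (j, i)) = (\<Sum>j\<in>T. x j * P $$ (j, i))"
      by (rule sum.mono_neutral_right) (use ST x(1) in \<open>auto simp: coord_space_def\<close>)
    also have "\<dots> = 0" using x(3) True by (simp add: mult.commute)
    finally show ?thesis by (simp add: row_action_def)
  next
    case False
    moreover have "row_action m P x \<in> coord_space S" using sub x(1) by auto
    ultimately show ?thesis by (simp add: coord_space_def)
  qed
  moreover obtain Q where Q: "Q \<in> carrier_mat m m" "P * Q = 1\<^sub>m m" using invertible_mat_iff[OF P(1)] P by auto
  moreover have "x \<in> coord_space {..<m}" using x(1) ST by (auto simp: coord_space_def)
  ultimately have "x = row_action m Q (\<lambda>_. 0)"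
    using row_action_mult[OF P(1) Q(1), of x] row_action_one[of x m] by (metis ext)
  thus False using x(2) by (simp add: row_action_def split: if_splits)
qed

section \<open>The regularizing decomposition is unique\<close>

text \<open>The matrix \<open>M\<close> is a direct sum of nilpotent Jordan blocks, on the first \<open>s\<close> indices, and
  the regular matrix \<open>R\<close>. The blocks are encoded by \<open>e\<close>: \<open>e i\<close> is the number of steps from \<open>i\<close> to
  the end of its block. A block of size \<open>k\<close> thus takes each value below \<open>k\<close> once, and the number of
  indices with \<open>e i = t\<close> is the number of blocks of size greater than \<open>t\<close>.\<close>

locale nilpotent_regular =
  fixes s d :: nat and e :: "nat \<Rightarrow> nat" and R M :: "complex mat"
  assumes R: "R \<in> carrier_mat d d" and R_inv: "invertible_mat R"
    and M: "M \<in> carrier_mat (s + d) (s + d)"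
    and e_Suc: "\<And>i. i < s \<Longrightarrow> e i \<noteq> 0 \<Longrightarrow> Suc i < s \<and> e i = Suc (e (Suc i))"
    and M_nil: "\<And>i j. i < s \<Longrightarrow> j < s + d \<Longrightarrow> M $$ (i, j) = (if j = Suc i \<and> e i \<noteq> 0 then 1 else 0)"
    and M_zero: "\<And>i j. i < d \<Longrightarrow> j < s \<Longrightarrow> M $$ (s + i, j) = 0"
    and M_reg: "\<And>i j. i < d \<Longrightarrow> j < d \<Longrightarrow> M $$ (s + i, s + j) = R $$ (i, j)"
begin

lemma form_eq:
  "mat_form (s + d) M x y = (\<Sum>i | i < s \<and> e i \<noteq> 0. x i * cnj (y (Suc i)))
     + (\<Sum>i<d. \<Sum>j<d. x (s + i) * R $$ (i, j) * cnj (y (s + j)))"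
proof -
  have split: "(\<Sum>i<s+d. f i) = (\<Sum>i<s. f i) + (\<Sum>i<d. f (s + i))" for f :: "nat \<Rightarrow> complex"
    using sum.nat_group[of f] by (induction d) (auto simp: algebra_simps)
  have "mat_form (s + d) M x y = (\<Sum>i<s. \<Sum>j<s+d. x i * M $$ (i, j) * cnj (y j))
      + (\<Sum>i<d. \<Sum>j<s+d. x (s + i) * M $$ (s + i, j) * cnj (y j))"
    unfolding mat_form_def by (rule split)
  also have "(\<Sum>i<s. \<Sum>j<s+d. x i * M $$ (i, j) * cnj (y j)) = (\<Sum>i<s. if e i \<noteq> 0 then x i * cnj (y (Suc i)) else 0)"
  proof (intro sum.cong refl)
    fix i assume "i \<in> {..<s}" hence i: "i < s" by simp
    have "(\<Sum>j<s+d. x i * M $$ (i, j) * cnj (y j)) = (\<Sum>j<s+d. if j = Suc i then (if e i \<noteq> 0 then x i * cnj (y (Suc i)) else 0) else 0)"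
      by (rule sum.cong) (use M_nil[OF i] in auto)
    also have "\<dots> = (if e i \<noteq> 0 then x i * cnj (y (Suc i)) else 0)"
      using e_Suc[OF i] by auto
    finally show "(\<Sum>j<s+d. x i * M $$ (i, j) * cnj (y j)) = (if e i \<noteq> 0 then x i * cnj (y (Suc i)) else 0)" .
  qed
  also have "\<dots> = (\<Sum>i | i < s \<and> e i \<noteq> 0. x i * cnj (y (Suc i)))"
    unfolding sum.inter_filter[symmetric, OF finite_lessThan] by (rule sum.cong) auto
  also have "(\<Sum>i<d. \<Sum>j<s+d. x (s + i) * M $$ (s + i, j) * cnj (y j)) =
      (\<Sum>i<d. \<Sum>j<d. x (s + i) * R $$ (i, j) * cnj (y (s + j)))"
    unfolding split by (intro sum.cong refl) (simp add: M_zero M_reg)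
  finally show ?thesis .
qed

lemma form_unit:
  assumes "j < s + d"
  shows "mat_form (s + d) M x (\<lambda>i. if i = j then 1 else 0) =
    (if j < s then (if j \<noteq> 0 \<and> e (j - 1) \<noteq> 0 then x (j - 1) else 0)
     else (\<Sum>i<d. x (s + i) * R $$ (i, j - s)))"
proof -
  have 1: "(\<Sum>i | i < s \<and> e i \<noteq> 0. x i * cnj (if Suc i = j then 1 else 0)) =
      (if j \<noteq> 0 \<and> j - 1 < s \<and> e (j - 1) \<noteq> 0 then x (j - 1) else 0)"
  proof -
    have "(\<Sum>i | i < s \<and> e i \<noteq> 0. x i * cnj (if Suc i = j then 1 else 0)) =
       (\<Sum>i | i < s \<and> e i \<noteq> 0. if i = j - 1 then (if j \<noteq> 0 then x i else 0) else 0)"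
      by (rule sum.cong) auto
    thus ?thesis by (auto simp: sum.delta)
  qed
  have 2: "(\<Sum>l<d. x (s + i) * R $$ (i, l) * cnj (if s + l = j then 1 else 0)) =
      (if j < s then 0 else x (s + i) * R $$ (i, j - s))" for i
  proof -
    have "(\<Sum>l<d. x (s + i) * R $$ (i, l) * cnj (if s + l = j then 1 else 0)) =
      (\<Sum>l<d. if l = j - s then (if j < s then 0 else x (s + i) * R $$ (i, j - s)) else 0)"
      by (rule sum.cong) auto
    thus ?thesis using assms by auto
  qed
  have 3: "\<not> (j - 1 < s \<and> e (j - 1) \<noteq> 0)" if "\<not> j < s" "j \<noteq> 0"
    using e_Suc[of "j - 1"] that by auto
  show ?thesis unfolding form_eq using 1 2 3 by auto
qed

lemma regular_left_kernel:
  assumes "\<And>j. j < d \<Longrightarrow> (\<Sum>i<d. x (s + i) * R $$ (i, j)) = 0" "i < d"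
  shows "x (s + i) = 0"
proof -
  obtain Q where Q: "Q \<in> carrier_mat d d" "R * Q = 1\<^sub>m d" using invertible_mat_iff[OF R] R_inv by auto
  let ?y = "\<lambda>i. if i < d then x (s + i) else 0"
  have "row_action d R ?y = (\<lambda>_. 0)" using assms by (auto simp: row_action_def)
  hence "?y = row_action d Q (\<lambda>_. 0)"
    using row_action_mult[OF R Q(1), of ?y] row_action_one[of ?y d] Q by (auto simp: coord_space_def)
  from fun_cong[OF this, of i] show ?thesis using assms(2) by (simp add: row_action_def)
qed

text \<open>Taking a left complement forbids the predecessor, within its block, of each index of the
  given support, and it alternately drops and restores the regular part. Iterating from the whole space therefore forbids odd values
  of \<open>e\<close> one after the other at even stages, and allows even values one after the other at odd
  stages.\<close>

definition support :: "nat \<Rightarrow> nat set" where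
  "support k = (if even k then {i. i < s \<and> \<not> (odd (e i) \<and> e i < k)} \<union> {s..<s + d}
     else {i. i < s \<and> even (e i) \<and> e i < k})"

lemma support_subset: "support k \<subseteq> {..<s + d}"
  by (auto simp: support_def)

lemma left_perp_support: "left_perp (s + d) M (coord_space (support k)) = coord_space (support (Suc k))"
proof (intro equalityI subsetI)
  fix x assume x: "x \<in> left_perp (s + d) M (coord_space (support k))"
  have unit: "mat_form (s + d) M x (\<lambda>i. if i = j then 1 else 0) = 0" if "j \<in> support k" for j
    using x that unfolding left_perp_def by (auto simp: coord_space_def)
  have out: "x i = 0" if "\<not> i < s + d" for i using x that by (auto simp: left_perp_def coord_space_def)
  have nil: "x i = 0" if "i < s" "e i \<noteq> 0" "Suc i \<in> support k" for i
    using unit[OF that(3)] form_unit[of "Suc i" x] that e_Suc[OF that(1,2)] by simp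
  have reg: "x (s + i) = 0" if "even k" "i < d" for i
  proof (rule regular_left_kernel[OF _ that(2)])
    fix j assume j: "j < d"
    hence "s + j \<in> support k" using that by (simp add: support_def)
    from unit[OF this] form_unit[of "s + j" x] j show "(\<Sum>i<d. x (s + i) * R $$ (i, j)) = 0" by simp
  qed
  show "x \<in> coord_space (support (Suc k))"
    unfolding coord_space_def
  proof (intro CollectI allI impI)
    fix i assume i: "i \<notin> support (Suc k)"
    consider "\<not> i < s + d" | "i < s" | "s \<le> i" "i < s + d" by linarith
    thus "x i = 0"
    proof cases
      case 1 thus ?thesis by (rule out)
    next
      case 2
      show ?thesis
      proof (cases "e i = 0")
        case True with i 2 show ?thesis by (auto simp: support_def split: if_splits)
      next
        case False
        from e_Suc[OF 2 False] have "Suc i < s" "e i = Suc (e (Suc i))" by auto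
        hence "Suc i \<in> support k" using i 2 False by (auto simp: support_def split: if_splits)
        thus ?thesis using nil 2 False by blast
      qed
    next
      case 3
      hence "even k" using i by (auto simp: support_def split: if_splits)
      with reg[of "i - s"] 3 show ?thesis by simp
    qed
  qed
next
  fix x assume x: "x \<in> coord_space (support (Suc k))"
  have "x \<in> coord_space {..<s + d}" using x support_subset[of "Suc k"] by (auto simp: coord_space_def)
  moreover have "mat_form (s + d) M x w = 0" if w: "w \<in> coord_space (support k)" for w
  proof -
    have "x i * cnj (w (Suc i)) = 0" if "i < s" "e i \<noteq> 0" for i
    proof (cases "i \<in> support (Suc k)")
      case True
      from e_Suc[OF that] have "Suc i < s" "e i = Suc (e (Suc i))" by auto
      hence "Suc i \<notin> support k" using that True by (auto simp: support_def split: if_splits)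
      thus ?thesis using w by (auto simp: coord_space_def)
    qed (use x in \<open>auto simp: coord_space_def\<close>)
    moreover have "x (s + i) * cnj (w (s + j)) = 0" for i j
    proof (cases "even k")
      case True
      hence "s + i \<notin> support (Suc k)" by (simp add: support_def)
      thus ?thesis using x by (auto simp: coord_space_def)
    next
      case False
      hence "s + j \<notin> support k" by (simp add: support_def)
      thus ?thesis using w by (auto simp: coord_space_def)
    qed
    hence "x (s + i) * R $$ (i, j) * cnj (w (s + j)) = 0" for i j by auto
    ultimately show ?thesis unfolding form_eq by (auto intro!: sum.neutral)
  qed
  ultimately show "x \<in> left_perp (s + d) M (coord_space (support k))" by (simp add: left_perp_def)
qed

lemma left_perp_iterates: "(left_perp (s + d) M ^^ k) (coord_space {..<s + d}) = coord_space (support k)"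
proof (induction k)
  case 0
  have "support 0 = {..<s + d}" by (auto simp: support_def)
  thus ?case by simp
qed (simp add: left_perp_support)

lemma e_less: "i < s \<Longrightarrow> e i < s"
proof -
  have "i < s \<Longrightarrow> e i = n \<Longrightarrow> i + n < s" for n
    by (induction n arbitrary: i) (use e_Suc in force)+
  thus "i < s \<Longrightarrow> e i < s" by force
qed

definition e_count :: "nat \<Rightarrow> nat" where "e_count t = card {i. i < s \<and> e i = t}"

lemma card_support:
  shows "card (support (2 * l + 1)) = (\<Sum>t\<le>l. e_count (2 * t))"
    and "card (support (2 * l)) + (\<Sum>t<l. e_count (2 * t + 1)) = s + d"
proof -
  have "support (2 * l + 1) = (\<Union>t\<le>l. {i. i < s \<and> e i = 2 * t})"
    by (auto simp: support_def elim!: evenE)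
  also have "card \<dots> = (\<Sum>t\<le>l. e_count (2 * t))"
    unfolding e_count_def by (subst card_UN_disjoint) auto
  finally show "card (support (2 * l + 1)) = (\<Sum>t\<le>l. e_count (2 * t))" .
next
  let ?T = "\<Union>t<l. {i. i < s \<and> e i = 2 * t + 1}"
  have "{..<s+d} = support (2 * l) \<union> ?T"
    by (auto simp: support_def elim!: oddE)
  moreover have "support (2 * l) \<inter> ?T = {}" by (auto simp: support_def)
  moreover have "card ?T = (\<Sum>t<l. e_count (2 * t + 1))"
    unfolding e_count_def by (subst card_UN_disjoint) auto
  moreover have "finite (support (2 * l))" using support_subset finite_subset by blast
  ultimately show "card (support (2 * l)) + (\<Sum>t<l. e_count (2 * t + 1)) = s + d"
    by (metis (no_types, lifting) card_Un_disjoint card_lessThan finite_Un finite_lessThan)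
qed

end

text \<open>The iterated complements of \<open>M'\<close> are carried to those of \<open>M\<close>. Comparing the dimensions of
  consecutive odd-numbered subspaces gives the numbers of indices with a given even value of \<open>e\<close>, and
  even-numbered subspaces give those with an odd value. The scalar and congruence between the regular
  parts are read off from a diagonal block of \<open>P\<close>.\<close>

theorem regularization_unique:
  assumes N: "nilpotent_regular s d e R M" and N': "nilpotent_regular s' d' e' R' M'"
    and dims: "s + d = m" "s' + d' = m" and cong: "scaled_congruent m M M'"
  shows "\<forall>t. nilpotent_regular.e_count s e t = nilpotent_regular.e_count s' e' t"
    and "s = s'" and "scaled_congruent d R R'"
proof -
  interpret A: nilpotent_regular s d e R M by fact
  interpret B: nilpotent_regular s' d' e' R' M' by fact
  from cong obtain c P where c: "c \<noteq> 0" and P: "P \<in> carrier_mat m m" "invertible_mat P"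
    and M': "M' = c \<cdot>\<^sub>m (P * M * mat_adjoint P)" unfolding scaled_congruent_def by auto
  have Mc: "M \<in> carrier_mat m m" using A.M dims by simp
  have image: "row_action m P ` coord_space (B.support k) = coord_space (A.support k)" for k
    using left_perp_iterates_congruence[OF P Mc c M', of k] A.left_perp_iterates[of k] B.left_perp_iterates[of k] dims
    by simp
  have le: "card (B.support k) \<le> card (A.support k)" for k
    by (rule coord_space_image_card[OF P]) (use image A.support_subset B.support_subset dims in auto)
  have ge: "card (A.support k) \<le> card (B.support k)" for k
  proof -
    obtain Q where Q: "Q \<in> carrier_mat m m" "P * Q = 1\<^sub>m m" "Q * P = 1\<^sub>m m" using invertible_mat_iff[OF P(1)] P by auto
    have inv: "invertible_mat Q" using invertible_mat_iff[OF Q(1)] Q P by auto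
    have "row_action m Q ` coord_space (A.support k) \<subseteq> coord_space (B.support k)"
    proof
      fix z assume "z \<in> row_action m Q ` coord_space (A.support k)"
      then obtain x where x: "x \<in> coord_space (B.support k)" "z = row_action m Q (row_action m P x)"
        unfolding image[symmetric] by auto
      moreover have "x \<in> coord_space {..<m}" using x(1) B.support_subset[of k] dims by (auto simp: coord_space_def)
      ultimately show "z \<in> coord_space (B.support k)"
        using row_action_mult[OF P(1) Q(1)] Q(2) row_action_one by simp
    qed
    from coord_space_image_card[OF Q(1) inv _ _ this] A.support_subset B.support_subset dims
    show ?thesis by simp
  qed
  have card: "card (A.support k) = card (B.support k)" for k using le ge by (rule antisym[rotated])
  have even_t: "A.e_count (2 * l) = B.e_count (2 * l)" for l
  proof (cases l)
    case 0 thus ?thesis using A.card_support(1)[of 0] B.card_support(1)[of 0] card[of 1] by simp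
  next
    case (Suc k)
    thus ?thesis using A.card_support(1)[of k] B.card_support(1)[of k] card[of "2 * k + 1"]
       A.card_support(1)[of "Suc k"] B.card_support(1)[of "Suc k"] card[of "2 * Suc k + 1"] by simp
  qed
  have odd_t: "A.e_count (2 * l + 1) = B.e_count (2 * l + 1)" for l
    using A.card_support(2)[of l] B.card_support(2)[of l] card[of "2 * l"]
       A.card_support(2)[of "Suc l"] B.card_support(2)[of "Suc l"] card[of "2 * Suc l"] dims by simp
  show counts: "\<forall>t. A.e_count t = B.e_count t"
  proof
    fix t show "A.e_count t = B.e_count t"
      by (cases "even t") (use even_t odd_t in \<open>auto elim!: evenE oddE\<close>)
  qed
  have total: "s = (\<Sum>t<n. A.e_count t)" if "s \<le> n" for n
  proof -
    have "{..<s} = (\<Union>t<n. {i. i < s \<and> e i = t})" using A.e_less that by fastforce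
    also have "card \<dots> = (\<Sum>t<n. A.e_count t)" unfolding A.e_count_def by (subst card_UN_disjoint) auto
    finally show ?thesis by simp
  qed
  have total': "s' = (\<Sum>t<n. B.e_count t)" if "s' \<le> n" for n
  proof -
    have "{..<s'} = (\<Union>t<n. {i. i < s' \<and> e' i = t})" using B.e_less that by fastforce
    also have "card \<dots> = (\<Sum>t<n. B.e_count t)" unfolding B.e_count_def by (subst card_UN_disjoint) auto
    finally show ?thesis by simp
  qed
  show ss: "s = s'" using total[of "s + s'"] total'[of "s + s'"] counts by simp
  hence dd: "d = d'" using dims by simp
  define Q where "Q = mat d d (\<lambda>(i, j). P $$ (s + i, s + j))"
  have Q: "Q \<in> carrier_mat d d" by (simp add: Q_def)
  have R': "R' = c \<cdot>\<^sub>m (Q * R * mat_adjoint Q)"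
  proof (rule eq_matI)
    fix a b assume "a < dim_row (c \<cdot>\<^sub>m (Q * R * mat_adjoint Q))" "b < dim_col (c \<cdot>\<^sub>m (Q * R * mat_adjoint Q))"
    hence ab: "a < d" "b < d" using Q by auto
    \<comment> \<open>An even number, beyond which the supports no longer change.\<close>
    let ?k = "2 * (s + s')"
    let ?u = "\<lambda>a i. if i = s + a then 1 else (0::complex)"
    have row: "row_action m P (?u a) = (\<lambda>j. if j < m then P $$ (s + a, j) else 0)" if "a < d" for a
    proof
      fix j
      have "(\<Sum>i<m. ?u a i * P $$ (i, j)) = (\<Sum>i<m. if i = s + a then P $$ (i, j) else 0)"
        by (rule sum.cong) auto
      thus "row_action m P (?u a) j = (if j < m then P $$ (s + a, j) else 0)"
        using dims that by (auto simp: row_action_def)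
    qed
    \<comment> \<open>The regular basis vectors lie in the even-numbered subspaces, so their images have no
      component at an index with odd \<open>e\<close>; the nilpotent part of the form pairs an index with odd \<open>e\<close>
      with one with even \<open>e\<close>, and hence vanishes on them.\<close>
    have odd0: "P $$ (s + a, i) = 0" if "a < d" "i < s" "odd (e i)" for a i
    proof -
      have "?u a \<in> coord_space (B.support ?k)" using that dd ss by (auto simp: coord_space_def B.support_def)
      hence "row_action m P (?u a) \<in> coord_space (A.support ?k)" using image by blast
      moreover have "i \<notin> A.support ?k" using that A.e_less[OF that(2)] by (auto simp: A.support_def)
      ultimately have "row_action m P (?u a) i = 0" by (simp add: coord_space_def)
      thus ?thesis using row[OF that(1)] that dims by simp
    qed
    have "mat_form m M' (?u a) (?u b) = R' $$ (a, b)"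
    proof -
      have "mat_form m M' (?u a) (?u b) = (\<Sum>i<d. (?u a (s + i)) * R' $$ (i, b))"
        using B.form_unit[of "s' + b" "?u a", folded ss dd] ab dims(1) by simp
      also have "\<dots> = (\<Sum>i<d. if i = a then R' $$ (a, b) else 0)" by (rule sum.cong) auto
      finally show ?thesis using ab by simp
    qed
    hence "R' $$ (a, b) = c * mat_form m M (row_action m P (?u a)) (row_action m P (?u b))"
      unfolding M' mat_form_congruence[OF P(1) Mc] by simp
    also have "mat_form m M (row_action m P (?u a)) (row_action m P (?u b)) =
       (\<Sum>i<d. \<Sum>j<d. P $$ (s + a, s + i) * R $$ (i, j) * cnj (P $$ (s + b, s + j)))"
    proof -
      have "P $$ (s + a, i) * cnj (P $$ (s + b, Suc i)) = 0" if "i < s" "e i \<noteq> 0" for i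
      proof (cases "odd (e i)")
        case True thus ?thesis using odd0[OF ab(1) that(1)] by simp
      next
        case False
        with A.e_Suc[OF that] have "Suc i < s" "odd (e (Suc i))" by auto
        thus ?thesis using odd0[OF ab(2)] by simp
      qed
      thus ?thesis using A.form_eq row[OF ab(1)] row[OF ab(2)] dims by (auto simp: sum.neutral)
    qed
    also have "\<dots> = (Q * R * mat_adjoint Q) $$ (a, b)"
      unfolding congruence_index[OF Q A.R ab] by (intro sum.cong refl) (use ab in \<open>auto simp: Q_def\<close>)
    finally show "R' $$ (a, b) = (c \<cdot>\<^sub>m (Q * R * mat_adjoint Q)) $$ (a, b)" using ab Q A.R by simp
  qed (use Q B.R dd in auto)
  have "det Q \<noteq> 0"
  proof
    assume "det Q = 0"
    hence "det R' = 0"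
      unfolding R' using det_mult[OF mult_carrier_mat[OF Q A.R] mat_adjoint_carrier[OF Q]] det_mult[OF Q A.R] Q A.R by simp
    thus False using invertible_mat_iff_det[OF B.R] B.R_inv by simp
  qed
  thus "scaled_congruent d R R'"
    unfolding scaled_congruent_def using A.R B.R dd R' c Q invertible_mat_iff_det[OF Q] by blast
qed

section \<open>Canonical blocks\<close>

lemma mult_mat_vec_index:
  assumes "A \<in> carrier_mat n m" "v \<in> carrier_vec m" "i < n"
  shows "(A *\<^sub>v v) $ i = (\<Sum>k<m. A $$ (i, k) * v $ k)"
  using assms by (auto simp: scalar_prod_def atLeast0LessThan)

lemma det_nz_if_kernel_zero:
  fixes A :: "complex mat"
  assumes A: "A \<in> carrier_mat n n"
    and ker: "\<And>v j. v \<in> carrier_vec n \<Longrightarrow> (\<And>i. i < n \<Longrightarrow> (\<Sum>k<n. A $$ (i, k) * v $ k) = 0) \<Longrightarrow> j < n \<Longrightarrow> v $ j = 0"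
  shows "det A \<noteq> 0"
proof
  assume "det A = 0"
  then obtain v where v: "v \<in> carrier_vec n" "v \<noteq> 0\<^sub>v n" "A *\<^sub>v v = 0\<^sub>v n"
    using det_0_iff_vec_prod_zero_field[OF A] by auto
  have "(\<Sum>k<n. A $$ (i, k) * v $ k) = 0" if "i < n" for i
    using mult_mat_vec_index[OF A v(1) that] v(3) that by simp
  hence "v $ j = 0" if "j < n" for j using ker[OF v(1) _ that] by simp
  hence "v = 0\<^sub>v n" using v(1) by (intro eq_vecI) auto
  thus False using v(2) by simp
qed

text \<open>The matrix is triangular with respect to the antidiagonal, so a kernel vector vanishes entry
  by entry from the last to the first.\<close>

lemma det_Delta_mat: "det (Delta_mat m) \<noteq> 0"
proof (rule det_nz_if_kernel_zero[of _ m])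
  fix v :: "complex vec" and j
  assume v: "\<And>i. i < m \<Longrightarrow> (\<Sum>k<m. Delta_mat m $$ (i, k) * v $ k) = 0"
  have *: "v $ (m - 1 - i) + (if i = 0 then 0 else \<i> * v $ (m - i)) = 0" if i: "i < m" for i
  proof -
    have "(\<Sum>k<m. Delta_mat m $$ (i, k) * v $ k) =
      (\<Sum>k<m. (if k = m - 1 - i then v $ k else 0) + (if k = m - i then (if i = 0 then 0 else \<i> * v $ k) else 0))"
      by (rule sum.cong) (use i in \<open>auto simp: Delta_mat_def\<close>)
    also have "\<dots> = v $ (m - 1 - i) + (if i = 0 then 0 else \<i> * v $ (m - i))"
      using i by (simp add: sum.distrib)
    finally show ?thesis using v[OF i] by simp
  qed
  have "i < m \<Longrightarrow> v $ (m - 1 - i) = 0" for i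
  proof (induction i)
    case (Suc i)
    hence "v $ (m - Suc i) = 0" by simp
    thus ?case using *[OF Suc.prems] by simp
  qed (use *[of 0] in simp)
  from this[of "m - 1 - j"] show "j < m \<Longrightarrow> v $ j = 0" by simp
qed (simp add: Delta_mat_def)

lemma H_mat_carrier: "H_mat m \<mu> \<in> carrier_mat (m + m) (m + m)"
  unfolding H_mat_def by (rule four_block_carrier_mat) auto

lemma det_H_mat:
  assumes "\<mu> \<noteq> 0" shows "det (H_mat m \<mu>) \<noteq> 0"
proof (rule det_nz_if_kernel_zero[OF H_mat_carrier])
  fix v :: "complex vec" and j
  assume v: "\<And>i. i < m + m \<Longrightarrow> (\<Sum>k<m + m. H_mat m \<mu> $$ (i, k) * v $ k) = 0"
  have up: "v $ (m + i) = 0" if i: "i < m" for i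
  proof -
    have "(\<Sum>k<m + m. H_mat m \<mu> $$ (i, k) * v $ k) = (\<Sum>k<m + m. if k = m + i then v $ k else 0)"
      by (rule sum.cong) (use i in \<open>auto simp: H_mat_def\<close>)
    thus ?thesis using v[of i] i by simp
  qed
  have low: "\<mu> * v $ i + (if Suc i < m then v $ Suc i else 0) = 0" if i: "i < m" for i
  proof -
    have "(\<Sum>k<m + m. H_mat m \<mu> $$ (m + i, k) * v $ k) =
      (\<Sum>k<m + m. (if k = i then \<mu> * v $ k else 0) + (if k = Suc i then (if Suc i < m then v $ k else 0) else 0))"
      by (rule sum.cong) (use i in \<open>auto simp: H_mat_def\<close>)
    also have "\<dots> = \<mu> * v $ i + (if Suc i < m then v $ Suc i else 0)"
      using i by (simp add: sum.distrib)
    finally show ?thesis using v[of "m + i"] i by simp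
  qed
  have down: "t < m \<Longrightarrow> v $ (m - 1 - t) = 0" for t
  proof (induction t)
    case 0 thus ?case using low[of "m - 1"] assms by simp
  next
    case (Suc t)
    hence "Suc (m - 1 - Suc t) = m - 1 - t" by simp
    thus ?case using low[of "m - 1 - Suc t"] Suc assms by simp
  qed
  assume "j < m + m"
  thus "v $ j = 0" using up[of "j - m"] down[of "m - 1 - j"] by (cases "j < m") auto
qed

fun block_order :: "regular_block \<Rightarrow> nat" where
  "block_order (Delta_block u m) = m"
| "block_order (H_block \<mu> m) = m + m"

lemma block_mat_carrier: "block_mat b \<in> carrier_mat (block_order b) (block_order b)"
  by (cases b) (auto simp: Delta_mat_def H_mat_carrier)

lemma det_block_mat: "valid_block b \<Longrightarrow> det (block_mat b) \<noteq> 0"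
proof (cases b)
  case (Delta_block u m)
  assume "valid_block b"
  thus ?thesis using Delta_block det_Delta_mat[of m] by (auto simp: Delta_mat_def)
next
  case (H_block \<mu> m)
  assume "valid_block b"
  hence "\<mu> \<noteq> 0" using H_block by auto
  thus ?thesis using H_block det_H_mat by simp
qed

lemma blocks_carrier:
  "diag_block_mat (map block_mat bs) \<in> carrier_mat (\<Sum>b\<leftarrow>bs. block_order b) (\<Sum>b\<leftarrow>bs. block_order b)"
proof (induction bs)
  case (Cons b bs)
  thus ?case using block_mat_carrier[of b] by (auto simp: Let_def)
qed simp

lemma blocks_invertible:
  assumes "\<forall>b\<in>set bs. valid_block b"
  shows "invertible_mat (diag_block_mat (map block_mat bs))"
proof -
  have "det (diag_block_mat (map block_mat bs)) \<noteq> 0" using assms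
  proof (induction bs)
    case (Cons b bs)
    let ?n = "block_order b" and ?l = "\<Sum>b\<leftarrow>bs. block_order b"
    have "diag_block_mat (map block_mat (b # bs)) =
      four_block_mat (block_mat b) (0\<^sub>m ?n ?l) (0\<^sub>m ?l ?n) (diag_block_mat (map block_mat bs))"
      using carrier_matD[OF block_mat_carrier[of b]] carrier_matD[OF blocks_carrier[of bs]] by (simp add: Let_def)
    also have "det \<dots> = det (block_mat b) * det (diag_block_mat (map block_mat bs))"
      by (rule det_four_block_mat_lower_left_zero[OF block_mat_carrier _ _ blocks_carrier]) auto
    finally show ?case using Cons det_block_mat[of b] by simp
  qed simp
  thus ?thesis using invertible_mat_iff_det[OF blocks_carrier] by simp
qed

subsection \<open>Nilpotent blocks\<close>

text \<open>The values \<open>k - 1, \<dots>, 0\<close> for each block size \<open>k\<close>, concatenated: the function \<open>e\<close> of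
  the decomposition into nilpotent blocks of sizes \<open>ks\<close>.\<close>

definition steps_to_end :: "nat list \<Rightarrow> nat list" where
  "steps_to_end ks = concat (map (\<lambda>k. rev [0..<k]) ks)"

lemma length_steps_to_end: "length (steps_to_end ks) = sum_list ks"
  by (induction ks) (auto simp: steps_to_end_def)

lemma steps_to_end_Cons_nth:
  assumes "i < k + sum_list ks"
  shows "steps_to_end (k # ks) ! i = (if i < k then k - 1 - i else steps_to_end ks ! (i - k))"
  using assms by (auto simp: steps_to_end_def nth_append rev_nth)

abbreviation nilpotent_blocks :: "nat list \<Rightarrow> complex mat" where
  "nilpotent_blocks ks \<equiv> diag_block_mat (map (\<lambda>k. jordan_block k 0) ks)"

lemma nilpotent_blocks_carrier: "nilpotent_blocks ks \<in> carrier_mat (sum_list ks) (sum_list ks)"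
  by (induction ks) (auto simp: Let_def)

lemma nilpotent_blocks_entries:
  "i < sum_list ks \<Longrightarrow> j < sum_list ks \<Longrightarrow>
    nilpotent_blocks ks $$ (i, j) = (if j = Suc i \<and> steps_to_end ks ! i \<noteq> 0 then 1 else 0)"
proof (induction ks arbitrary: i j)
  case (Cons k ks)
  have c: "nilpotent_blocks ks \<in> carrier_mat (sum_list ks) (sum_list ks)" by (rule nilpotent_blocks_carrier)
  have "nilpotent_blocks (k # ks) = four_block_mat (jordan_block k 0) (0\<^sub>m k (sum_list ks)) (0\<^sub>m (sum_list ks) k) (nilpotent_blocks ks)"
    using c by (auto simp: Let_def)
  thus ?case using Cons c by (auto simp: steps_to_end_Cons_nth)
qed simp

lemma steps_to_end_Suc:
  "i < sum_list ks \<Longrightarrow> steps_to_end ks ! i \<noteq> 0 \<Longrightarrow>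
    Suc i < sum_list ks \<and> steps_to_end ks ! i = Suc (steps_to_end ks ! Suc i)"
proof (induction ks arbitrary: i)
  case (Cons k ks)
  show ?case
  proof (cases "i < k")
    case True
    thus ?thesis using Cons.prems by (auto simp: steps_to_end_Cons_nth)
  next
    case False
    hence "Suc (i - k) < sum_list ks \<and> steps_to_end ks ! (i - k) = Suc (steps_to_end ks ! Suc (i - k))"
      using Cons by (auto simp: steps_to_end_Cons_nth)
    thus ?thesis using False Cons.prems by (auto simp: steps_to_end_Cons_nth Suc_diff_le)
  qed
qed simp

lemma count_steps_to_end:
  "card {i. i < sum_list ks \<and> steps_to_end ks ! i = t} = length (filter (\<lambda>k. t < k) ks)"
proof -
  have 1: "length (filter (\<lambda>x. x = t) [0..<k]) = (if t < k then 1 else 0)" for k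
    by (induction k) auto
  have "card {i. i < sum_list ks \<and> steps_to_end ks ! i = t} = length (filter (\<lambda>x. x = t) (steps_to_end ks))"
    unfolding length_filter_conv_card length_steps_to_end ..
  also have "\<dots> = length (filter (\<lambda>k. t < k) ks)"
    by (induction ks) (auto simp: steps_to_end_def 1 rev_filter[symmetric])
  finally show ?thesis .
qed

text \<open>The multiplicity of \<open>t + 1\<close> is the difference of the numbers of entries exceeding \<open>t\<close>
  and \<open>t + 1\<close>.\<close>

lemma mset_eq_if_filter_eq:
  fixes ks ls :: "nat list"
  assumes "0 \<notin> set ks" "0 \<notin> set ls"
    and eq: "\<And>t. length (filter (\<lambda>k. t < k) ks) = length (filter (\<lambda>k. t < k) ls)"
  shows "mset ks = mset ls"
proof (rule multiset_eqI)
  have c: "length (filter (\<lambda>k. t < k) xs) = count (mset xs) (Suc t) + length (filter (\<lambda>k. Suc t < k) xs)" for t and xs :: "nat list"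
    by (induction xs) auto
  fix k show "count (mset ks) k = count (mset ls) k"
  proof (cases k)
    case 0 thus ?thesis using assms by (metis count_mset_0_iff)
  next
    case (Suc t)
    thus ?thesis using c[of t ks] c[of t ls] eq[of t] eq[of "Suc t"] by simp
  qed
qed

lemma canonical_form_split:
  "diag_block_mat (map (\<lambda>k. jordan_block k 0) ks @ map block_mat bs) =
    four_block_mat (nilpotent_blocks ks) (0\<^sub>m (sum_list ks) (\<Sum>b\<leftarrow>bs. block_order b))
      (0\<^sub>m (\<Sum>b\<leftarrow>bs. block_order b) (sum_list ks)) (diag_block_mat (map block_mat bs))"
  using nilpotent_blocks_carrier[of ks] blocks_carrier[of bs] by (simp add: diag_block_mat_append Let_def)

lemma canonical_form_nilpotent_regular:
  assumes "\<forall>b\<in>set bs. valid_block b"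
  shows "nilpotent_regular (sum_list ks) (\<Sum>b\<leftarrow>bs. block_order b) (\<lambda>i. steps_to_end ks ! i)
    (diag_block_mat (map block_mat bs)) (diag_block_mat (map (\<lambda>k. jordan_block k 0) ks @ map block_mat bs))"
proof -
  note c = nilpotent_blocks_carrier[of ks] blocks_carrier[of bs]
  show ?thesis unfolding canonical_form_split
    by (unfold_locales)
      (use c blocks_invertible[OF assms] steps_to_end_Suc in \<open>auto simp: nilpotent_blocks_entries\<close>)
qed

section \<open>The cosquare\<close>

lemma cosquare_eq:
  assumes R: "R \<in> carrier_mat n n" and B: "B \<in> carrier_mat n n" "B * mat_adjoint R = 1\<^sub>m n"
  shows "cosquare R = B * R"
proof -
  have aR: "mat_adjoint R \<in> carrier_mat n n" using R by auto
  have "det B * det (mat_adjoint R) = 1" using det_mult[OF B(1) aR] B(2) by simp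
  hence "det (mat_adjoint R) \<noteq> 0" by auto
  hence "mat_inverse (mat_adjoint R) \<noteq> None"
    using mat_inverse(1)[OF aR, where b = "()"] det_non_zero_imp_unit[OF aR, where b = "()"] by blast
  then obtain C where C: "mat_inverse (mat_adjoint R) = Some C" by auto
  from mat_inverse(2)[OF aR C] have C': "mat_adjoint R * C = 1\<^sub>m n" "C \<in> carrier_mat n n" by auto
  have "B = B * (mat_adjoint R * C)" using C' B by simp
  also have "\<dots> = C" using assoc_mult_mat[OF B(1) aR C'(2)] B(2) C'(2) by simp
  finally show ?thesis unfolding cosquare_def C by simp
qed

lemma smult_mult_smult:
  fixes A B :: "complex mat"
  assumes A: "A \<in> carrier_mat n m" and B: "B \<in> carrier_mat m l"
  shows "(a \<cdot>\<^sub>m A) * (b \<cdot>\<^sub>m B) = (a * b) \<cdot>\<^sub>m (A * B)"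
proof -
  have "(a \<cdot>\<^sub>m A) * (b \<cdot>\<^sub>m B) = a \<cdot>\<^sub>m (b \<cdot>\<^sub>m (A * B))"
    using mult_smult_assoc_mat[OF A, of "b \<cdot>\<^sub>m B" l a] mult_smult_distrib[OF A B] B by simp
  thus ?thesis by (auto intro!: eq_matI)
qed

text \<open>For \<open>R' = c Q R Q*\<close> the scalar enters the cosquare once through \<open>R'\<close> and once, conjugated and
  inverted, through its adjoint. What remains is the factor \<open>c / cnj c\<close>, of modulus 1.\<close>

lemma cosquare_scaled_congruent:
  assumes cong: "scaled_congruent n R R'" and inv: "invertible_mat R"
  shows "\<exists>\<zeta>. cmod \<zeta> = 1 \<and> similar_mat (cosquare R') (\<zeta> \<cdot>\<^sub>m cosquare R)"
proof -
  from cong obtain c Q where R: "R \<in> carrier_mat n n" and R': "R' \<in> carrier_mat n n" and c: "c \<noteq> 0"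
    and Q: "Q \<in> carrier_mat n n" "invertible_mat Q" and eq: "R' = c \<cdot>\<^sub>m (Q * R * mat_adjoint Q)"
    unfolding scaled_congruent_def by auto
  have aR: "mat_adjoint R \<in> carrier_mat n n" and aQ: "mat_adjoint Q \<in> carrier_mat n n" using R Q by auto
  obtain B where B: "B \<in> carrier_mat n n" "B * mat_adjoint R = 1\<^sub>m n"
    using invertible_mat_iff[OF aR] invertible_mat_iff_det[OF aR] invertible_mat_iff_det[OF R] inv det_mat_adjoint_nz[OF R]
    by auto
  obtain Qi where Qi: "Qi \<in> carrier_mat n n" "Qi * Q = 1\<^sub>m n" "Q * Qi = 1\<^sub>m n"
    using invertible_mat_iff[OF Q(1)] Q by auto
  have aQi: "mat_adjoint Qi \<in> carrier_mat n n" using Qi by auto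
  have QQ: "mat_adjoint Q * mat_adjoint Qi = 1\<^sub>m n" "mat_adjoint Qi * mat_adjoint Q = 1\<^sub>m n"
    using mat_adjoint_mult[OF Qi(1) Q(1), unfolded Qi(2) mat_adjoint_one]
      mat_adjoint_mult[OF Q(1) Qi(1), unfolded Qi(3) mat_adjoint_one] by simp_all
  define B' where "B' = inverse (cnj c) \<cdot>\<^sub>m (mat_adjoint Qi * B * Qi)"
  have B': "B' \<in> carrier_mat n n" using B Qi aQi by (simp add: B'_def)
  have X: "mat_adjoint Qi * B * Qi \<in> carrier_mat n n" using aQi B Qi by auto
  have Y: "Q * mat_adjoint R * mat_adjoint Q \<in> carrier_mat n n" using aR Q aQ by auto
  have Z: "Q * R * mat_adjoint Q \<in> carrier_mat n n" using R Q aQ by auto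
  have adj: "mat_adjoint R' = cnj c \<cdot>\<^sub>m (Q * mat_adjoint R * mat_adjoint Q)"
    unfolding eq using R Q aR aQ Z
    by (simp add: mat_adjoint_smult[of _ n] mat_adjoint_mult[of _ n] mat_adjoint_adjoint[of _ n] assoc_mult_mat[of _ n n _ n _ n])
  have cancel: "Qi * (Q * W) = W" if "W \<in> carrier_mat n n" for W
    using assoc_mult_mat[OF Qi(1) Q(1) that] Qi(2) that by simp
  have cancelB: "B * (mat_adjoint R * W) = W" if "W \<in> carrier_mat n n" for W
    using assoc_mult_mat[OF B(1) aR that] B(2) that by simp
  have "B' * mat_adjoint R' = (inverse (cnj c) * cnj c) \<cdot>\<^sub>m (mat_adjoint Qi * B * Qi * (Q * mat_adjoint R * mat_adjoint Q))"
    unfolding adj B'_def by (rule smult_mult_smult[OF X Y])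
  also have "mat_adjoint Qi * B * Qi * (Q * mat_adjoint R * mat_adjoint Q) = 1\<^sub>m n"
    using aQi B Qi Q aR aQ QQ(2) by (simp add: assoc_mult_mat[of _ n n _ n _ n] cancel cancelB)
  also have "(inverse (cnj c) * cnj c) \<cdot>\<^sub>m 1\<^sub>m n = 1\<^sub>m n" using c by (intro eq_matI) auto
  finally have inv': "B' * mat_adjoint R' = 1\<^sub>m n" .
  have BR: "B * R \<in> carrier_mat n n" using B R by auto
  let ?z = "inverse (cnj c) * c"
  have "cosquare R' = B' * R'" by (rule cosquare_eq[OF R' B' inv'])
  also have "\<dots> = ?z \<cdot>\<^sub>m (mat_adjoint Qi * B * Qi * (Q * R * mat_adjoint Q))"
    unfolding eq B'_def by (rule smult_mult_smult[OF X Z])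
  also have "mat_adjoint Qi * B * Qi * (Q * R * mat_adjoint Q) = mat_adjoint Qi * (B * R) * mat_adjoint Q"
    using aQi B Qi Q R aQ by (simp add: assoc_mult_mat[of _ n n _ n _ n] cancel)
  finally have "cosquare R' = ?z \<cdot>\<^sub>m (mat_adjoint Qi * (B * R) * mat_adjoint Q)" .
  also have "\<dots> = mat_adjoint Qi * (?z \<cdot>\<^sub>m (B * R)) * mat_adjoint Q"
    using mult_smult_distrib[OF aQi BR] mult_smult_assoc_mat[OF mult_carrier_mat[OF aQi BR] aQ] by simp
  finally have "similar_mat_wit (cosquare R') (?z \<cdot>\<^sub>m (B * R)) (mat_adjoint Qi) (mat_adjoint Q)"
    using QQ aQ aQi BR mult_carrier_mat[OF mult_carrier_mat[OF aQi, of "?z \<cdot>\<^sub>m (B * R)" n] aQ]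
    by (intro similar_mat_witI[of _ _ n]) auto
  moreover have "cosquare R = B * R" by (rule cosquare_eq[OF R B])
  moreover have "cmod ?z = 1" using c by (simp add: norm_mult norm_inverse)
  ultimately show ?thesis unfolding similar_mat_def by auto
qed

lemma jordan_nf_mset_unique:
  assumes "jordan_nf (A :: complex mat) as" "jordan_nf A bs"
  shows "mset as = mset bs"
proof (rule multiset_eqI)
  fix p :: "nat \<times> complex"
  obtain k ev where p: "p = (k, ev)" by force
  have len: "count (mset xs) q = length (filter ((=) q) xs)" for xs and q :: "nat \<times> complex" by (induction xs) auto
  show "count (mset as) p = count (mset bs) p"
  proof (cases "k = 0")
    case True
    hence "p \<notin> set as" "p \<notin> set bs" using assms p unfolding jordan_nf_def by force+
    thus ?thesis by (metis count_mset_0_iff)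
  next
    case False
    thus ?thesis unfolding p len
      using compute_nr_of_jordan_blocks[OF assms(1) False, of ev] compute_nr_of_jordan_blocks[OF assms(2) False, of ev] by simp
  qed
qed

lemma eigen_partitions_mset_cong:
  assumes "mset as = mset bs" shows "eigen_partitions as E = eigen_partitions bs E"
proof -
  have "set as = set bs" using assms by (metis set_mset_mset)
  moreover have "mset (map fst (filter (\<lambda>p. snd p = e) as)) = mset (map fst (filter (\<lambda>p. snd p = e) bs))" for e
    using assms by simp
  ultimately show ?thesis unfolding eigen_partitions_def by simp
qed

text \<open>A rotation permutes the eigenvalues while keeping the block sizes, and the partitions are listed
  without reference to the eigenvalues.\<close>

lemma eigen_partitions_rotate:
  assumes z: "\<zeta> \<noteq> 0" and E: "\<And>e. \<zeta> * e \<in> E \<longleftrightarrow> e \<in> E"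
  shows "eigen_partitions (map (\<lambda>(n, a). (n, \<zeta> * a)) as) E = eigen_partitions as E"
proof -
  let ?bs = "map (\<lambda>(n, a). (n, \<zeta> * a)) as"
  have inj: "inj_on ((*) \<zeta>) X" for X using z by (auto simp: inj_on_def)
  have "snd ` set ?bs \<inter> E = (*) \<zeta> ` (snd ` set as \<inter> E)"
  proof -
    have "snd ` set ?bs = (*) \<zeta> ` snd ` set as" by force
    thus ?thesis using E by auto
  qed
  hence "mset_set (snd ` set ?bs \<inter> E) = image_mset ((*) \<zeta>) (mset_set (snd ` set as \<inter> E))"
    using image_mset_mset_set[OF inj] by simp
  moreover have "map fst (filter (\<lambda>p. snd p = \<zeta> * e) ?bs) = map fst (filter (\<lambda>p. snd p = e) as)" for e
    by (induction as) (use z in auto)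
  ultimately show ?thesis unfolding eigen_partitions_def by (simp only: multiset.map_comp o_def)
qed

section \<open>Uniqueness of the configuration\<close>

text \<open>The scalar in the congruence of the matrices reappears in that of the regular parts, where it
  only rotates the spectrum of the cosquare. Scalars are allowed since a structure determines its
  matrix only up to them.\<close>

theorem configuration_unique:
  assumes M: "has_configuration M c" and M': "has_configuration M' c'"
    and cong: "scaled_congruent m M M'"
  shows "c = c'"
proof -
  from M obtain ks bs n_as where ks: "0 \<notin> set ks" and bs: "\<forall>b\<in>set bs. valid_block b"
    and F: "star_congruent M (diag_block_mat (map (\<lambda>k. jordan_block k 0) ks @ map block_mat bs))"
    and J: "jordan_nf (cosquare (diag_block_mat (map block_mat bs))) n_as"
    and c: "c = (mset ks, eigen_partitions n_as {e. cmod e = 1}, eigen_partitions n_as {e. cmod e > 1})"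
    unfolding has_configuration_def by blast
  from M' obtain ks' bs' n_as' where ks': "0 \<notin> set ks'" and bs': "\<forall>b\<in>set bs'. valid_block b"
    and F': "star_congruent M' (diag_block_mat (map (\<lambda>k. jordan_block k 0) ks' @ map block_mat bs'))"
    and J': "jordan_nf (cosquare (diag_block_mat (map block_mat bs'))) n_as'"
    and c': "c' = (mset ks', eigen_partitions n_as' {e. cmod e = 1}, eigen_partitions n_as' {e. cmod e > 1})"
    unfolding has_configuration_def by blast
  let ?D = "diag_block_mat (map (\<lambda>k. jordan_block k 0) ks @ map block_mat bs)"
  let ?D' = "diag_block_mat (map (\<lambda>k. jordan_block k 0) ks' @ map block_mat bs')"
  let ?R = "diag_block_mat (map block_mat bs)" and ?R' = "diag_block_mat (map block_mat bs')"
  let ?s = "sum_list ks" and ?d = "\<Sum>b\<leftarrow>bs. block_order b"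
  let ?s' = "sum_list ks'" and ?d' = "\<Sum>b\<leftarrow>bs'. block_order b"
  have carr: "M \<in> carrier_mat m m" "M' \<in> carrier_mat m m" using cong unfolding scaled_congruent_def by auto
  have DD: "scaled_congruent m ?D ?D'"
    using scaled_congruent_sym[OF star_congruent_imp_scaled[OF F carr(1)]] cong star_congruent_imp_scaled[OF F' carr(2)]
    by (blast intro: scaled_congruent_trans)
  hence Dc: "?D \<in> carrier_mat m m" "?D' \<in> carrier_mat m m" unfolding scaled_congruent_def by auto
  note N = canonical_form_nilpotent_regular[OF bs, of ks] canonical_form_nilpotent_regular[OF bs', of ks']
  have dims: "?s + ?d = m" "?s' + ?d' = m"
    using nilpotent_regular.M[OF N(1)] nilpotent_regular.M[OF N(2)] Dc by auto
  note U = regularization_unique[OF N dims DD]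
  have "length (filter (\<lambda>k. t < k) ks) = length (filter (\<lambda>k. t < k) ks')" for t
    using U(1) unfolding nilpotent_regular.e_count_def[OF N(1)] nilpotent_regular.e_count_def[OF N(2)] count_steps_to_end
    by blast
  hence mks: "mset ks = mset ks'" by (rule mset_eq_if_filter_eq[OF ks ks'])
  obtain z where z: "cmod z = 1" "similar_mat (cosquare ?R') (z \<cdot>\<^sub>m cosquare ?R)"
    using cosquare_scaled_congruent[OF U(3) blocks_invertible[OF bs]] by blast
  hence z0: "z \<noteq> 0" by auto
  have "jordan_nf (z \<cdot>\<^sub>m cosquare ?R) (map (\<lambda>(n, a). (n, z * a)) n_as)" by (rule jordan_nf_smult[OF J z0])
  hence "jordan_nf (cosquare ?R') (map (\<lambda>(n, a). (n, z * a)) n_as)"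
    using z(2) similar_mat_trans unfolding jordan_nf_def by blast
  from jordan_nf_mset_unique[OF J' this]
  have eq: "eigen_partitions n_as' E = eigen_partitions (map (\<lambda>(n, a). (n, z * a)) n_as) E" for E
    by (rule eigen_partitions_mset_cong)
  have "eigen_partitions n_as' {e. cmod e = 1} = eigen_partitions n_as {e. cmod e = 1}"
       "eigen_partitions n_as' {e. cmod e > 1} = eigen_partitions n_as {e. cmod e > 1}"
    unfolding eq by (rule eigen_partitions_rotate[OF z0]; simp add: norm_mult z)+
  thus ?thesis unfolding c c' mks by simp
qed

section \<open>Frames of (1,0)-forms\<close>

lemma cfun_sum_apply: "(\<Sum>k\<in>K. f k) x = (\<Sum>k\<in>K. f k x :: complex)"
  by (induction K rule: infinite_finite_induct) auto

text \<open>A basis of (1,0)-forms is given as a set of functions. These two lemmas pass to indexed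
  coefficients, in which the computations below are carried out.\<close>

lemma cfun_independent_iff:
  fixes \<omega> :: "nat \<Rightarrow> 'a \<Rightarrow> complex"
  shows "(inj_on \<omega> {..<n} \<and> cfun.independent (\<omega> ` {..<n})) \<longleftrightarrow>
    (\<forall>c. (\<forall>x. (\<Sum>j<n. c j * \<omega> j x) = 0) \<longrightarrow> (\<forall>j<n. c j = 0))" (is "?L \<longleftrightarrow> ?R")
proof -
  have dep: "cfun.dependent (\<omega> ` {..<n}) \<longleftrightarrow>
     (\<exists>u. (\<exists>w\<in>\<omega> ` {..<n}. u w \<noteq> 0) \<and> (\<Sum>w\<in>\<omega> ` {..<n}. cscale (u w) w) = 0)"
    by (rule cfun.dependent_finite) simp
  show ?thesis
  proof
    assume L: ?L
    show ?R
    proof (intro allI impI)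
      fix c j assume c: "\<forall>x. (\<Sum>j<n. c j * \<omega> j x) = 0" and j: "j < n"
      define u where "u = (\<lambda>w. c (the_inv_into {..<n} \<omega> w))"
      have u: "u (\<omega> i) = c i" if "i < n" for i using L that by (simp add: u_def the_inv_into_f_f)
      have "(\<Sum>w\<in>\<omega> ` {..<n}. cscale (u w) w) = 0"
      proof
        fix x
        have "(\<Sum>w\<in>\<omega> ` {..<n}. cscale (u w) w) x = (\<Sum>i<n. cscale (u (\<omega> i)) (\<omega> i) x)"
          unfolding cfun_sum_apply using L by (subst sum.reindex) auto
        also have "\<dots> = (\<Sum>i<n. c i * \<omega> i x)" by (rule sum.cong) (auto simp: cscale_def u)
        finally show "(\<Sum>w\<in>\<omega> ` {..<n}. cscale (u w) w) x = 0 x" using c by simp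
      qed
      moreover have "\<not> (\<exists>u. (\<exists>w\<in>\<omega> ` {..<n}. u w \<noteq> 0) \<and> (\<Sum>w\<in>\<omega> ` {..<n}. cscale (u w) w) = 0)"
        unfolding dep[symmetric] using L by (rule conjunct2)
      ultimately have "\<not> (\<exists>w\<in>\<omega> ` {..<n}. u w \<noteq> 0)" by iprover
      hence "u (\<omega> j) = 0" using j by simp
      thus "c j = 0" using u j by simp
    qed
  next
    assume R: ?R
    have inj: "inj_on \<omega> {..<n}"
    proof (rule inj_onI, rule ccontr)
      fix a b assume ab: "a \<in> {..<n}" "b \<in> {..<n}" "\<omega> a = \<omega> b" "a \<noteq> b"
      define c where "c = (\<lambda>j. if j = a then 1 else if j = b then -1 else (0::complex))"
      have "(\<Sum>j<n. c j * \<omega> j x) = 0" for x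
      proof -
        have "(\<Sum>j<n. c j * \<omega> j x) = (\<Sum>j\<in>{a, b}. c j * \<omega> j x)"
          by (rule sum.mono_neutral_right) (use ab in \<open>auto simp: c_def\<close>)
        also have "\<dots> = c a * \<omega> a x + c b * \<omega> b x" using ab(4) by simp
        also have "\<dots> = 0" unfolding ab(3) using ab(4) by (simp add: c_def)
        finally show ?thesis .
      qed
      hence "c a = 0" using R ab(1) by (elim allE[of _ c] impE) simp_all
      thus False by (simp add: c_def)
    qed
    have "u w = 0" if u: "(\<Sum>w\<in>\<omega> ` {..<n}. cscale (u w) w) = 0" and w: "w \<in> \<omega> ` {..<n}" for u w
    proof -
      have "(\<Sum>j<n. u (\<omega> j) * \<omega> j x) = 0" for x
      proof -
        have "(\<Sum>w\<in>\<omega> ` {..<n}. cscale (u w) w) x = (\<Sum>j<n. u (\<omega> j) * \<omega> j x)"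
          unfolding cfun_sum_apply sum.reindex[OF inj] by (simp add: cscale_def)
        thus ?thesis unfolding u by simp
      qed
      hence "\<forall>j<n. u (\<omega> j) = 0" using R by (elim allE[of _ "\<lambda>j. u (\<omega> j)"] impE) simp_all
      thus ?thesis using w by auto
    qed
    hence "\<not> (\<exists>u. (\<exists>w\<in>\<omega> ` {..<n}. u w \<noteq> 0) \<and> (\<Sum>w\<in>\<omega> ` {..<n}. cscale (u w) w) = 0)"
      by fast
    hence "cfun.independent (\<omega> ` {..<n})" unfolding dep .
    with inj show ?L by (rule conjI)
  qed
qed

lemma cfun_span_iff:
  fixes \<omega> :: "nat \<Rightarrow> 'a \<Rightarrow> complex"
  shows "\<alpha> \<in> cfun.span (\<omega> ` {..<n}) \<longleftrightarrow> (\<exists>c. \<alpha> = (\<lambda>x. \<Sum>j<n. c j * \<omega> j x))"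
proof
  assume "\<alpha> \<in> cfun.span (\<omega> ` {..<n})"
  thus "\<exists>c. \<alpha> = (\<lambda>x. \<Sum>j<n. c j * \<omega> j x)"
  proof (induction rule: cfun.span_induct_alt)
    case base
    show ?case by (rule exI[of _ "\<lambda>_. 0"]) auto
  next
    case (step c w \<beta>)
    then obtain k d where k: "k < n" "w = \<omega> k" and d: "\<beta> = (\<lambda>x. \<Sum>j<n. d j * \<omega> j x)" by auto
    have "cscale c w + \<beta> = (\<lambda>x. \<Sum>j<n. (d j + (if j = k then c else 0)) * \<omega> j x)"
    proof
      fix x
      have "(\<Sum>j<n. (d j + (if j = k then c else 0)) * \<omega> j x) = (\<Sum>j<n. d j * \<omega> j x) + (\<Sum>j<n. if j = k then c * \<omega> j x else 0)"
        unfolding sum.distrib[symmetric] by (rule sum.cong) (auto simp: algebra_simps)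
      thus "(cscale c w + \<beta>) x = (\<Sum>j<n. (d j + (if j = k then c else 0)) * \<omega> j x)"
        using k by (simp add: d cscale_def)
    qed
    thus ?case by (rule exI[of _ "\<lambda>j. d j + (if j = k then c else 0)"])
  qed
next
  assume "\<exists>c. \<alpha> = (\<lambda>x. \<Sum>j<n. c j * \<omega> j x)"
  then obtain c where "\<alpha> = (\<Sum>j<n. cscale (c j) (\<omega> j))"
    by (auto simp: fun_eq_iff cfun_sum_apply cscale_def)
  thus "\<alpha> \<in> cfun.span (\<omega> ` {..<n})"
    by (simp only:) (intro cfun.span_sum cfun.span_scale cfun.span_base imageI)
qed

lemma conj_form_in: "\<alpha> \<in> cforms1 \<Longrightarrow> conj_form \<alpha> \<in> cforms1"
proof -
  assume "\<alpha> \<in> cforms1"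
  hence "linear \<alpha>" by (simp add: cforms1_def)
  hence "linear (conj_form \<alpha>)"
    by (intro linearI) (simp_all add: conj_form_def linear_add linear_scale)
  thus ?thesis by (simp add: cforms1_def)
qed

lemma wedge_in: "\<alpha> \<in> cforms1 \<Longrightarrow> \<beta> \<in> cforms1 \<Longrightarrow> wedge \<alpha> \<beta> \<in> cforms2"
proof -
  assume "\<alpha> \<in> cforms1" "\<beta> \<in> cforms1"
  hence l: "linear \<alpha>" "linear \<beta>" by (simp_all add: cforms1_def)
  have "linear (\<lambda>x. wedge \<alpha> \<beta> x y)" "linear (\<lambda>y. wedge \<alpha> \<beta> x y)" for x y
    by (intro linearI; simp add: wedge_def linear_add[OF l(1)] linear_add[OF l(2)] linear_scale[OF l(1)] linear_scale[OF l(2)] scaleR_conv_of_real algebra_simps)+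
  thus ?thesis by (simp add: cforms2_def bilinear_def wedge_def)
qed

text \<open>Replacing \<open>x\<close> by \<open>J x\<close> multiplies the two summands of each wedge product by \<open>\<i>\<close> and \<open>-\<i>\<close>.
  Hence they can be separated: already \<open>\<Sum> A\<^sub>j\<^sub>k \<omega>\<^sub>j(x) cnj (\<omega>\<^sub>k(y))\<close> vanishes identically, and
  independence of the forms can be applied in \<open>x\<close> and then in \<open>y\<close>.\<close>

lemma wedges_independent:
  fixes \<omega> :: "nat \<Rightarrow> 'a::real_vector \<Rightarrow> complex"
  assumes J: "\<And>j x. j < m \<Longrightarrow> \<omega> j (J x) = \<i> * \<omega> j x"
    and ind: "\<forall>c. (\<forall>x. (\<Sum>j<m. c j * \<omega> j x) = 0) \<longrightarrow> (\<forall>j<m. c j = 0)"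
    and zero: "\<And>x y. (\<Sum>j<m. \<Sum>k<m. A j k * wedge (\<omega> j) (conj_form (\<omega> k)) x y) = 0"
    and jk: "j < m" "k < m"
  shows "A j k = 0"
proof -
  let ?s = "\<lambda>x y. \<Sum>j<m. \<Sum>k<m. A j k * (\<omega> j x * cnj (\<omega> k y))"
  have eq: "?s x y - ?s y x = 0" for x y
    using zero[of x y] unfolding wedge_def conj_form_def
    by (simp add: sum_subtractf right_diff_distrib)
  have Js: "?s (J x) y = \<i> * ?s x y" "?s y (J x) = - \<i> * ?s y x" for x y
    unfolding sum_distrib_left by (intro sum.cong refl; simp add: J)+
  have s0: "?s x y = 0" for x y
  proof -
    have "?s x y = ?s y x" using eq[of x y] by simp
    moreover have "\<i> * ?s x y + \<i> * ?s y x = 0" using eq[of "J x" y] unfolding Js by simp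
    ultimately have "2 * \<i> * ?s x y = 0" by (simp add: algebra_simps)
    thus ?thesis by simp
  qed
  have "(\<Sum>k<m. cnj (A j k) * \<omega> k y) = 0" for y
  proof -
    have "(\<Sum>j<m. (\<Sum>k<m. A j k * cnj (\<omega> k y)) * \<omega> j x) = 0" for x
    proof -
      have "(\<Sum>j<m. (\<Sum>k<m. A j k * cnj (\<omega> k y)) * \<omega> j x) = ?s x y"
        unfolding sum_distrib_right by (intro sum.cong refl) simp
      thus ?thesis using s0 by simp
    qed
    hence "(\<Sum>k<m. A j k * cnj (\<omega> k y)) = 0"
      using ind[rule_format, of "\<lambda>j. \<Sum>k<m. A j k * cnj (\<omega> k y)" j] jk(1) by blast
    hence "cnj (\<Sum>k<m. A j k * cnj (\<omega> k y)) = 0" by simp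
    thus ?thesis by simp
  qed
  hence "cnj (A j k) = 0" using ind[rule_format, of "\<lambda>k. cnj (A j k)" k] jk(2) by blast
  thus ?thesis by simp
qed

text \<open>A presentation unpacked into coefficients. The last conjunct holds because the matrix is nonzero;
  it makes the span of the first \<open>m\<close> forms the space of closed (1,0)-forms.\<close>

lemma presented_byD:
  fixes J :: "'a::real_vector \<Rightarrow> 'a"
  assumes pres: "presented_by (Suc m) br J M"
  shows "\<exists>\<omega>. (\<forall>j\<le>m. \<omega> j \<in> forms10 J) \<and>
    (\<forall>\<alpha>\<in>forms10 J. \<exists>c. \<alpha> = (\<lambda>x. (\<Sum>j<m. c j * \<omega> j x) + c m * \<omega> m x)) \<and>
    (\<forall>c. (\<forall>x. (\<Sum>j<m. c j * \<omega> j x) = 0) \<longrightarrow> (\<forall>j<m. c j = 0)) \<and>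
    (\<forall>j<m. ce_d br (\<omega> j) = (\<lambda>x y. 0)) \<and>
    ce_d br (\<omega> m) = (\<lambda>x y. \<Sum>j<m. \<Sum>k<m. M $$ (j, k) * wedge (\<omega> j) (conj_form (\<omega> k)) x y) \<and>
    (\<exists>x y. ce_d br (\<omega> m) x y \<noteq> 0)"
proof -
  from pres obtain \<omega> where M: "M \<in> carrier_mat m m" "M \<noteq> 0\<^sub>m m m"
    and ind: "inj_on \<omega> {..<Suc m} \<and> cfun.independent (\<omega> ` {..<Suc m})"
    and span: "cfun.span (\<omega> ` {..<Suc m}) = forms10 J"
    and closed: "\<forall>i<m. ce_d br (\<omega> i) = (\<lambda>x y. 0)"
    and d: "ce_d br (\<omega> m) = (\<lambda>x y. \<Sum>j<m. \<Sum>k<m. M $$ (j, k) * wedge (\<omega> j) (conj_form (\<omega> k)) x y)"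
    unfolding presented_by_def by auto
  have in10: "\<omega> j \<in> forms10 J" if "j \<le> m" for j
    unfolding span[symmetric] by (rule cfun.span_base) (use that in auto)
  have ex: "\<exists>c. \<alpha> = (\<lambda>x. (\<Sum>j<m. c j * \<omega> j x) + c m * \<omega> m x)" if "\<alpha> \<in> forms10 J" for \<alpha>
    using that unfolding span[symmetric] cfun_span_iff by simp
  have ind': "\<forall>c. (\<forall>x. (\<Sum>j<m. c j * \<omega> j x) = 0) \<longrightarrow> (\<forall>j<m. c j = 0)"
  proof (intro allI impI)
    fix c j assume c: "\<forall>x. (\<Sum>j<m. c j * \<omega> j x) = 0" and j: "j < m"
    let ?c = "\<lambda>j. if j = m then 0 else c j"
    have "(\<Sum>j<Suc m. ?c j * \<omega> j x) = 0" for x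
      using c by simp
    hence "?c j = 0"
      using ind[unfolded cfun_independent_iff, rule_format, of ?c j] j by simp
    thus "c j = 0" using j by simp
  qed
  have nz: "\<exists>x y. ce_d br (\<omega> m) x y \<noteq> 0"
  proof (rule ccontr)
    assume "\<not> ?thesis"
    hence zero: "(\<Sum>j<m. \<Sum>k<m. M $$ (j, k) * wedge (\<omega> j) (conj_form (\<omega> k)) x y) = 0" for x y
      unfolding d by simp
    have "M $$ (j, k) = 0" if "j < m" "k < m" for j k
    proof (rule wedges_independent[where A = "\<lambda>j k. M $$ (j, k)", OF _ ind' zero that])
      show "\<omega> j (J x) = \<i> * \<omega> j x" if "j < m" for j x
        using in10[of j] that by (simp add: forms10_def)
    qed
    hence "M = 0\<^sub>m m m" using M(1) by (intro eq_matI) auto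
    thus False using M by simp
  qed
  show ?thesis using in10 ex ind' closed d nz by (intro exI[of _ \<omega>]) simp
qed

section \<open>Equivalent structures have scaled congruent matrices\<close>

text \<open>An equivalence maps closed (1,0)-forms to closed ones, say with matrix \<open>q\<close>, and the last basis form
  to a multiple \<open>q m m\<close> of the last basis form plus closed forms. Expanding both sides of
  \<open>G (d \<omega>\<^sub>m) = d (F \<omega>\<^sub>m)\<close> in the independent wedge products gives \<open>P M\<^sub>1 P* = q m m M\<^sub>2\<close>, where \<open>P\<close> is the
  transpose of \<open>q\<close>.\<close>

theorem equivalent_imp_scaled_congruent:
  fixes J1 J2 :: "'a::real_vector \<Rightarrow> 'a"
  assumes p1: "presented_by (Suc m) br1 J1 M1" and p2: "presented_by (Suc m) br2 J2 M2"
    and equiv: "equivalent_structures (br1, J1) (br2, J2)"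
  shows "scaled_congruent m M1 M2"
proof -
  have M1: "M1 \<in> carrier_mat m m" "M1 \<noteq> 0\<^sub>m m m" and M2: "M2 \<in> carrier_mat m m"
    using p1 p2 unfolding presented_by_def by auto
  from presented_byD[OF p1] obtain \<omega> where
    w_in': "\<forall>j\<le>m. \<omega> j \<in> forms10 J1" and
    w_ind: "\<forall>c. (\<forall>x. (\<Sum>j<m. c j * \<omega> j x) = 0) \<longrightarrow> (\<forall>j<m. c j = 0)" and
    w_closed: "\<forall>j<m. ce_d br1 (\<omega> j) = (\<lambda>x y. 0)" and
    w_d: "ce_d br1 (\<omega> m) = (\<lambda>x y. \<Sum>j<m. \<Sum>k<m. M1 $$ (j, k) * wedge (\<omega> j) (conj_form (\<omega> k)) x y)"
    by (elim exE conjE)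
  from presented_byD[OF p2] obtain \<omega>' x0 y0 where
    w'_in': "\<forall>j\<le>m. \<omega>' j \<in> forms10 J2" and
    w'_ex: "\<forall>\<alpha>\<in>forms10 J2. \<exists>c. \<alpha> = (\<lambda>x. (\<Sum>j<m. c j * \<omega>' j x) + c m * \<omega>' m x)" and
    w'_ind: "\<forall>c. (\<forall>x. (\<Sum>j<m. c j * \<omega>' j x) = 0) \<longrightarrow> (\<forall>j<m. c j = 0)" and
    w'_closed: "\<forall>j<m. ce_d br2 (\<omega>' j) = (\<lambda>x y. 0)" and
    w'_d: "ce_d br2 (\<omega>' m) = (\<lambda>x y. \<Sum>j<m. \<Sum>k<m. M2 $$ (j, k) * wedge (\<omega>' j) (conj_form (\<omega>' k)) x y)" and
    w'_nz: "ce_d br2 (\<omega>' m) x0 y0 \<noteq> 0"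
    by (elim exE conjE)
  note w_in = w_in'[rule_format] and w'_in = w'_in'[rule_format]
  from equiv obtain F :: "('a \<Rightarrow> complex) \<Rightarrow> 'a \<Rightarrow> complex"
      and G :: "('a \<Rightarrow> 'a \<Rightarrow> complex) \<Rightarrow> 'a \<Rightarrow> 'a \<Rightarrow> complex" where
    F: "bij_betw F (forms10 J1) (forms10 J2)" and
    F_add': "\<forall>\<alpha>\<in>cforms1. \<forall>\<beta>\<in>cforms1. F (\<lambda>x. \<alpha> x + \<beta> x) = (\<lambda>x. F \<alpha> x + F \<beta> x)" and
    F_scale': "\<forall>c. \<forall>\<alpha>\<in>cforms1. F (\<lambda>x. c * \<alpha> x) = (\<lambda>x. c * F \<alpha> x)" and
    F_conj': "\<forall>\<alpha>\<in>cforms1. F (conj_form \<alpha>) = conj_form (F \<alpha>)" and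
    G_add': "\<forall>\<alpha>\<in>cforms2. \<forall>\<beta>\<in>cforms2. G (\<lambda>x y. \<alpha> x y + \<beta> x y) = (\<lambda>x y. G \<alpha> x y + G \<beta> x y)" and
    G_scale': "\<forall>c. \<forall>\<alpha>\<in>cforms2. G (\<lambda>x y. c * \<alpha> x y) = (\<lambda>x y. c * G \<alpha> x y)" and
    G_wedge': "\<forall>\<alpha>\<in>cforms1. \<forall>\<beta>\<in>cforms1. G (wedge \<alpha> \<beta>) = wedge (F \<alpha>) (F \<beta>)" and
    G_d': "\<forall>\<alpha>\<in>forms10 J1. G (ce_d br1 \<alpha>) = ce_d br2 (F \<alpha>)"
    unfolding equivalent_structures_def prod.case by (elim exE conjE)
  note F_add = F_add'[rule_format] and F_scale = F_scale'[rule_format] and F_conj = F_conj'[rule_format]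
    and G_add = G_add'[rule_format] and G_scale = G_scale'[rule_format] and G_wedge = G_wedge'[rule_format]
    and G_d = G_d'[rule_format]
  have in1: "\<alpha> \<in> cforms1" if "\<alpha> \<in> forms10 J1" for \<alpha> using that by (simp add: forms10_def)
  have zero1: "(\<lambda>x. 0) \<in> cforms1" by (simp add: cforms1_def linear_zero)
  have zero2: "(\<lambda>x y. 0) \<in> cforms2" by (simp add: cforms2_def bilinear_def linear_zero)
  have F0: "F (\<lambda>x. 0) = (\<lambda>x. 0)" using F_scale[OF zero1, of 0] by simp
  have G0: "G (\<lambda>x y. 0) = (\<lambda>x y. 0)" using G_scale[OF zero2, of 0] by simp
  have sum1: "(\<lambda>x. \<Sum>j\<in>S. c j * \<alpha> j x) \<in> cforms1 \<and>
      F (\<lambda>x. \<Sum>j\<in>S. c j * \<alpha> j x) = (\<lambda>x. \<Sum>j\<in>S. c j * F (\<alpha> j) x)"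
    if "finite S" "\<And>j. j \<in> S \<Longrightarrow> \<alpha> j \<in> cforms1" for S :: "nat set" and c \<alpha>
    using that
  proof (induction S)
    case (insert j S)
    have 1: "(\<lambda>x. c j * \<alpha> j x) \<in> cforms1"
      using insert.prems[of j] by (auto simp: cforms1_def intro!: linearI simp: linear_add linear_scale algebra_simps)
    have 2: "(\<lambda>x. \<Sum>j\<in>S. c j * \<alpha> j x) \<in> cforms1" and
      3: "F (\<lambda>x. \<Sum>j\<in>S. c j * \<alpha> j x) = (\<lambda>x. \<Sum>j\<in>S. c j * F (\<alpha> j) x)" using insert by auto
    have "(\<lambda>x. c j * \<alpha> j x + (\<Sum>j\<in>S. c j * \<alpha> j x)) \<in> cforms1"
      using 1 2 by (simp add: cforms1_def linear_compose_add)
    thus ?case using insert.hyps F_add[OF 1 2] F_scale[of "\<alpha> j" "c j"] insert.prems[of j] 3 by simp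
  qed (simp_all add: F0 zero1)
  have sum2: "(\<lambda>x y. \<Sum>p\<in>S. c p * \<beta> p x y) \<in> cforms2 \<and>
      G (\<lambda>x y. \<Sum>p\<in>S. c p * \<beta> p x y) = (\<lambda>x y. \<Sum>p\<in>S. c p * G (\<beta> p) x y)"
    if "finite S" "\<And>p. p \<in> S \<Longrightarrow> \<beta> p \<in> cforms2" for S :: "(nat \<times> nat) set" and c \<beta>
    using that
  proof (induction S)
    case (insert p S)
    have 1: "(\<lambda>x y. c p * \<beta> p x y) \<in> cforms2"
    proof -
      have l: "linear (\<lambda>y. \<beta> p x y)" "linear (\<lambda>x. \<beta> p x y)" "\<beta> p x x = 0" for x y
        using insert.prems[of p] by (auto simp: cforms2_def bilinear_def)
      have "linear (\<lambda>y. c p * \<beta> p x y)" "linear (\<lambda>x. c p * \<beta> p x y)" for x y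
        by (intro linearI; simp add: linear_add[OF l(1)] linear_add[OF l(2)] linear_scale[OF l(1)] linear_scale[OF l(2)] algebra_simps)+
      thus ?thesis using l(3) by (simp add: cforms2_def bilinear_def)
    qed
    have 2: "(\<lambda>x y. \<Sum>p\<in>S. c p * \<beta> p x y) \<in> cforms2" and
      3: "G (\<lambda>x y. \<Sum>p\<in>S. c p * \<beta> p x y) = (\<lambda>x y. \<Sum>p\<in>S. c p * G (\<beta> p) x y)" using insert by auto
    have "(\<lambda>x y. c p * \<beta> p x y + (\<Sum>p\<in>S. c p * \<beta> p x y)) \<in> cforms2"
      using 1 2 by (simp add: cforms2_def bilinear_def linear_compose_add)
    thus ?case using insert.hyps G_add[OF 1 2] G_scale[of "\<beta> p" "c p"] insert.prems[of p] 3 by simp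
  qed (simp_all add: G0 zero2)
  have "\<forall>j\<in>{..m}. \<exists>c. F (\<omega> j) = (\<lambda>x. (\<Sum>k<m. c k * \<omega>' k x) + c m * \<omega>' m x)"
  proof
    fix j assume "j \<in> {..m}"
    hence "F (\<omega> j) \<in> forms10 J2" using w_in bij_betwE[OF F] by simp
    thus "\<exists>c. F (\<omega> j) = (\<lambda>x. (\<Sum>k<m. c k * \<omega>' k x) + c m * \<omega>' m x)" by (rule w'_ex[rule_format])
  qed
  then obtain q where q: "\<And>j. j \<le> m \<Longrightarrow> F (\<omega> j) = (\<lambda>x. (\<Sum>k<m. q j k * \<omega>' k x) + q j m * \<omega>' m x)"
    unfolding bchoice_iff by auto
  have dF: "ce_d br2 (F (\<omega> j)) x y = q j m * ce_d br2 (\<omega>' m) x y" if "j \<le> m" for j x y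
  proof -
    have "\<omega>' k (br2 x y) = 0" if "k < m" for k
      using fun_cong[OF fun_cong[OF w'_closed[rule_format, OF that], of x], of y] by (simp add: ce_d_def)
    thus ?thesis unfolding q[OF that] by (simp add: ce_d_def)
  qed
  \<comment> \<open>A closed form is sent to a closed form, and the last basis form is not closed.\<close>
  have q0: "q j m = 0" if "j < m" for j
  proof -
    have "ce_d br2 (F (\<omega> j)) = (\<lambda>x y. 0)"
      using G_d[OF w_in, of j] w_closed[rule_format, OF that] G0 that by simp
    thus ?thesis using dF[of j x0 y0] that w'_nz by auto
  qed
  have Fw: "F (\<omega> j) = (\<lambda>x. \<Sum>k<m. q j k * \<omega>' k x)" if "j < m" for j
    using q[of j] q0[OF that] that by simp
  \<comment> \<open>The transpose of the matrix of \<open>F\<close> on closed forms.\<close>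
  define P where "P = mat m m (\<lambda>(a, j). q j a)"
  have P: "P \<in> carrier_mat m m" by (simp add: P_def)
  have detP: "det P \<noteq> 0"
  proof (rule det_nz_if_kernel_zero[OF P])
    fix v :: "complex vec" and j
    assume v: "v \<in> carrier_vec m" "\<And>i. i < m \<Longrightarrow> (\<Sum>k<m. P $$ (i, k) * v $ k) = 0" and j: "j < m"
    have vq: "(\<Sum>k<m. v $ k * q k i) = 0" if "i < m" for i
    proof -
      have "(\<Sum>k<m. v $ k * q k i) = (\<Sum>k<m. P $$ (i, k) * v $ k)"
        by (rule sum.cong) (use that in \<open>auto simp: P_def\<close>)
      thus ?thesis using v(2)[OF that] by simp
    qed
    let ?\<alpha> = "\<lambda>x. \<Sum>k<m. v $ k * \<omega> k x"
    have "F ?\<alpha> = (\<lambda>x. \<Sum>k<m. v $ k * F (\<omega> k) x)"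
      using sum1[of "{..<m}" \<omega> "\<lambda>k. v $ k"] in1[OF w_in] by auto
    also have "\<dots> = (\<lambda>x. \<Sum>k<m. \<Sum>i<m. v $ k * q k i * \<omega>' i x)"
      by (intro ext sum.cong refl) (simp add: Fw sum_distrib_left mult.assoc)
    also have "\<dots> = (\<lambda>x. \<Sum>i<m. (\<Sum>k<m. v $ k * q k i) * \<omega>' i x)"
      unfolding sum_distrib_right by (intro ext sum.swap)
    also have "\<dots> = (\<lambda>x. 0)" using vq by simp
    finally have "F ?\<alpha> = F (\<lambda>x. 0)" using F0 by simp
    moreover have "?\<alpha> \<in> forms10 J1"
    proof -
      have "?\<alpha> \<in> cforms1" using sum1[of "{..<m}" \<omega> "\<lambda>k. v $ k"] in1[OF w_in] by auto
      moreover have "?\<alpha> (J1 x) = \<i> * ?\<alpha> x" for x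
        unfolding sum_distrib_left by (rule sum.cong) (use w_in in \<open>auto simp: forms10_def\<close>)
      ultimately show ?thesis by (simp add: forms10_def)
    qed
    moreover have "(\<lambda>x. 0) \<in> forms10 J1" using zero1 by (simp add: forms10_def)
    ultimately have "?\<alpha> = (\<lambda>x. 0)" using F unfolding bij_betw_def inj_on_def by blast
    hence "\<forall>x. (\<Sum>k<m. v $ k * \<omega> k x) = 0" by (simp add: fun_eq_iff)
    thus "v $ j = 0" using w_ind[rule_format, of "\<lambda>k. v $ k" j] j by blast
  qed
  hence invP: "invertible_mat P" using invertible_mat_iff_det[OF P] by simp
  have PMP: "(P * M1 * mat_adjoint P) $$ (a, b) = q m m * M2 $$ (a, b)" if ab: "a < m" "b < m" for a b
  proof -
    let ?A = "\<lambda>a b. (P * M1 * mat_adjoint P) $$ (a, b)"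
    have "?A a b - q m m * M2 $$ (a, b) = 0"
    proof (rule wedges_independent[of m \<omega>' J2 "\<lambda>a b. ?A a b - q m m * M2 $$ (a, b)"])
      show "\<omega>' j (J2 x) = \<i> * \<omega>' j x" if "j < m" for j x
        using w'_in[of j] that by (simp add: forms10_def)
      show "\<forall>c. (\<forall>x. (\<Sum>j<m. c j * \<omega>' j x) = 0) \<longrightarrow> (\<forall>j<m. c j = 0)" by (rule w'_ind)
      fix x y
      have "q m m * ce_d br2 (\<omega>' m) x y = ce_d br2 (F (\<omega> m)) x y" using dF[of m] by simp
      also have "\<dots> = G (ce_d br1 (\<omega> m)) x y" using G_d[OF w_in[of m]] by simp
      also have "ce_d br1 (\<omega> m) = (\<lambda>x y. \<Sum>p\<in>{..<m} \<times> {..<m}. M1 $$ p * wedge (\<omega> (fst p)) (conj_form (\<omega> (snd p))) x y)"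
        unfolding w_d sum.cartesian_product by (simp add: case_prod_unfold)
      also have "G \<dots> = (\<lambda>x y. \<Sum>p\<in>{..<m} \<times> {..<m}. M1 $$ p * G (wedge (\<omega> (fst p)) (conj_form (\<omega> (snd p)))) x y)"
        by (rule sum2[THEN conjunct2]) (auto intro!: wedge_in conj_form_in simp: in1[OF w_in])
      also have "\<dots> x y = (\<Sum>j<m. \<Sum>k<m. M1 $$ (j, k) * wedge (F (\<omega> j)) (conj_form (F (\<omega> k))) x y)"
        unfolding sum.cartesian_product
        by (rule sum.cong) (auto simp: G_wedge F_conj in1[OF w_in] conj_form_in)
      also have "\<dots> = (\<Sum>j<m. \<Sum>k<m. \<Sum>a<m. \<Sum>b<m. q j a * M1 $$ (j, k) * cnj (q k b) * wedge (\<omega>' a) (conj_form (\<omega>' b)) x y)"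
      proof (intro sum.cong refl)
        fix j k assume "j \<in> {..<m}" "k \<in> {..<m}"
        hence jk: "j < m" "k < m" by auto
        have "wedge (F (\<omega> j)) (conj_form (F (\<omega> k))) x y =
          (\<Sum>a<m. \<Sum>b<m. q j a * cnj (q k b) * wedge (\<omega>' a) (conj_form (\<omega>' b)) x y)"
          unfolding wedge_def conj_form_def Fw[OF jk(1)] Fw[OF jk(2)]
          by (simp add: sum_product right_diff_distrib sum_subtractf mult_ac)
        thus "M1 $$ (j, k) * wedge (F (\<omega> j)) (conj_form (F (\<omega> k))) x y =
          (\<Sum>a<m. \<Sum>b<m. q j a * M1 $$ (j, k) * cnj (q k b) * wedge (\<omega>' a) (conj_form (\<omega>' b)) x y)"
          by (simp add: sum_distrib_left mult_ac)
      qed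
      also have "\<dots> = (\<Sum>a<m. \<Sum>b<m. \<Sum>j<m. \<Sum>k<m. q j a * M1 $$ (j, k) * cnj (q k b) * wedge (\<omega>' a) (conj_form (\<omega>' b)) x y)"
        (is "(\<Sum>j<m. \<Sum>k<m. \<Sum>a<m. \<Sum>b<m. ?f j k a b) = _")
      proof -
        have "(\<Sum>j<m. \<Sum>k<m. \<Sum>a<m. \<Sum>b<m. ?f j k a b) = (\<Sum>j<m. \<Sum>a<m. \<Sum>k<m. \<Sum>b<m. ?f j k a b)"
          by (intro sum.cong refl sum.swap)
        also have "\<dots> = (\<Sum>a<m. \<Sum>j<m. \<Sum>k<m. \<Sum>b<m. ?f j k a b)" by (rule sum.swap)
        also have "\<dots> = (\<Sum>a<m. \<Sum>j<m. \<Sum>b<m. \<Sum>k<m. ?f j k a b)" by (intro sum.cong refl sum.swap)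
        also have "\<dots> = (\<Sum>a<m. \<Sum>b<m. \<Sum>j<m. \<Sum>k<m. ?f j k a b)" by (intro sum.cong refl sum.swap)
        finally show ?thesis .
      qed
      also have "\<dots> = (\<Sum>a<m. \<Sum>b<m. ?A a b * wedge (\<omega>' a) (conj_form (\<omega>' b)) x y)"
      proof (intro sum.cong refl)
        fix a b assume "a \<in> {..<m}" "b \<in> {..<m}"
        hence ab: "a < m" "b < m" by auto
        have "?A a b = (\<Sum>j<m. \<Sum>k<m. q j a * M1 $$ (j, k) * cnj (q k b))"
          unfolding congruence_index[OF P M1(1) ab] by (intro sum.cong refl) (use ab in \<open>auto simp: P_def\<close>)
        thus "(\<Sum>j<m. \<Sum>k<m. q j a * M1 $$ (j, k) * cnj (q k b) * wedge (\<omega>' a) (conj_form (\<omega>' b)) x y) =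
           ?A a b * wedge (\<omega>' a) (conj_form (\<omega>' b)) x y" by (simp add: sum_distrib_right)
      qed
      finally have "q m m * ce_d br2 (\<omega>' m) x y = (\<Sum>a<m. \<Sum>b<m. ?A a b * wedge (\<omega>' a) (conj_form (\<omega>' b)) x y)" .
      moreover have "(\<Sum>a<m. \<Sum>b<m. (?A a b - q m m * M2 $$ (a, b)) * wedge (\<omega>' a) (conj_form (\<omega>' b)) x y) =
        (\<Sum>a<m. \<Sum>b<m. ?A a b * wedge (\<omega>' a) (conj_form (\<omega>' b)) x y) - q m m * ce_d br2 (\<omega>' m) x y"
        unfolding w'_d by (simp add: left_diff_distrib sum_subtractf sum_distrib_left mult.assoc)
      ultimately show "(\<Sum>a<m. \<Sum>b<m. (?A a b - q m m * M2 $$ (a, b)) * wedge (\<omega>' a) (conj_form (\<omega>' b)) x y) = 0"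
        by simp
    qed (rule ab)+
    thus ?thesis by simp
  qed
  have eq: "1 \<cdot>\<^sub>m (P * M1 * mat_adjoint P) = q m m \<cdot>\<^sub>m M2"
    by (rule eq_matI) (use P M1 M2 PMP in auto)
  obtain Q where Q: "Q \<in> carrier_mat m m" "Q * P = 1\<^sub>m m" using invertible_mat_iff[OF P] invP by auto
  have nz: "q m m \<noteq> 0"
  proof
    assume "q m m = 0"
    hence "1 \<cdot>\<^sub>m (P * M1 * mat_adjoint P) = 0\<^sub>m m m" unfolding eq using M2 by (intro eq_matI) auto
    hence "1 \<cdot>\<^sub>m M1 = Q * 0\<^sub>m m m * mat_adjoint Q" using congruence_inverse[OF P M1(1) Q, of 1] by simp
    also have "\<dots> = 0\<^sub>m m m" using Q by (simp add: left_mult_zero_mat[of _ m m] mat_adjoint_carrier)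
    finally have z: "1 \<cdot>\<^sub>m M1 = 0\<^sub>m m m" .
    have "M1 = 1 \<cdot>\<^sub>m M1" by (intro eq_matI) auto
    thus False using z M1(2) by simp
  qed
  have "M2 = inverse (q m m) \<cdot>\<^sub>m (P * M1 * mat_adjoint P)"
  proof (rule eq_matI)
    fix i j assume "i < dim_row (inverse (q m m) \<cdot>\<^sub>m (P * M1 * mat_adjoint P))" "j < dim_col (inverse (q m m) \<cdot>\<^sub>m (P * M1 * mat_adjoint P))"
    hence ij: "i < m" "j < m" using P by auto
    have "(inverse (q m m) \<cdot>\<^sub>m (P * M1 * mat_adjoint P)) $$ (i, j) = inverse (q m m) * (P * M1 * mat_adjoint P) $$ (i, j)"
      using ij P M1 by simp
    thus "M2 $$ (i, j) = (inverse (q m m) \<cdot>\<^sub>m (P * M1 * mat_adjoint P)) $$ (i, j)"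
      using PMP[OF ij] nz by simp
  qed (use P M2 in auto)
  thus ?thesis unfolding scaled_congruent_def using M1 M2 P invP nz by (metis inverse_nonzero_iff_nonzero)
qed

lemma equivalent_structures_refl: "equivalent_structures X X"
  unfolding equivalent_structures_def
  by (cases X) (auto simp: bij_betw_def inj_on_def intro!: exI[of _ "\<lambda>\<alpha>. \<alpha>"])

section \<open>Every nonzero matrix presents a structure\<close>

lemma sum_pairs: "(\<Sum>i<2 * n. f i) = (\<Sum>j<n. f (2 * j) + f (2 * j + 1))" for f :: "nat \<Rightarrow> 'b::comm_monoid_add"
  by (induction n) (auto simp: add.assoc)

lemma complex_coordinates:
  assumes "DIM('a) = 2 * n"
  shows "\<exists>(\<omega> :: nat \<Rightarrow> 'a::euclidean_space \<Rightarrow> complex) v. (\<forall>j. linear (\<omega> j)) \<and>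
    (\<forall>z. \<forall>j<n. \<omega> j (v z) = z j) \<and> (\<forall>x y. (\<forall>j<n. \<omega> j x = \<omega> j y) \<longrightarrow> x = y)"
proof -
  obtain b :: "nat \<Rightarrow> 'a" where b: "bij_betw b {..<2 * n} Basis"
    using ex_bij_betw_nat_finite[of "Basis :: 'a set"] assms by (auto simp: atLeast0LessThan)
  have bb: "b i \<bullet> b k = (if i = k then 1 else 0)" if "i < 2 * n" "k < 2 * n" for i k
    using b that inner_Basis[of "b i" "b k"] unfolding bij_betw_def inj_on_def by fastforce
  define \<omega> where "\<omega> = (\<lambda>j x. Complex (x \<bullet> b (2 * j)) (x \<bullet> b (2 * j + 1)))"
  define v where "v = (\<lambda>z. \<Sum>j<n. Re (z j) *\<^sub>R b (2 * j) + Im (z j) *\<^sub>R b (2 * j + 1))"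
  have b1: "b (2 * k) \<bullet> b (2 * j) = (if k = j then 1 else 0)" "b (2 * k) \<bullet> b (2 * j + 1) = 0"
    "b (2 * k + 1) \<bullet> b (2 * j) = 0" "b (2 * k + 1) \<bullet> b (2 * j + 1) = (if k = j then 1 else 0)"
    if "k < n" "j < n" for k j
  proof -
    have "2 * k + 1 \<noteq> 2 * j" "2 * k \<noteq> 2 * j + 1" by presburger+
    thus "b (2 * k) \<bullet> b (2 * j) = (if k = j then 1 else 0)" "b (2 * k) \<bullet> b (2 * j + 1) = 0"
    "b (2 * k + 1) \<bullet> b (2 * j) = 0" "b (2 * k + 1) \<bullet> b (2 * j + 1) = (if k = j then 1 else 0)"
      using that by (simp_all add: bb)
  qed
  have "linear (\<omega> j)" for j
    by (intro linearI) (auto simp: \<omega>_def complex_eq_iff inner_add_left)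
  moreover have "\<omega> j (v z) = z j" if j: "j < n" for z j
  proof -
    have "v z \<bullet> b (2 * j) = (\<Sum>k<n. if k = j then Re (z k) else 0)"
      unfolding v_def inner_sum_left
      by (rule sum.cong) (use j b1[OF _ j] in \<open>simp_all add: inner_add_left\<close>)
    moreover have "v z \<bullet> b (2 * j + 1) = (\<Sum>k<n. if k = j then Im (z k) else 0)"
      unfolding v_def inner_sum_left
      by (rule sum.cong) (use j b1[OF _ j] in \<open>simp_all add: inner_add_left\<close>)
    ultimately show ?thesis using j by (simp add: \<omega>_def complex_eq_iff)
  qed
  moreover have "x = y" if xy: "\<forall>j<n. \<omega> j x = \<omega> j y" for x y
  proof -
    have v: "x = (\<Sum>j<n. Re (\<omega> j x) *\<^sub>R b (2 * j) + Im (\<omega> j x) *\<^sub>R b (2 * j + 1))" for x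
    proof -
      have "x = (\<Sum>u\<in>Basis. (x \<bullet> u) *\<^sub>R u)" by (rule euclidean_representation[symmetric])
      also have "\<dots> = (\<Sum>i<2 * n. (x \<bullet> b i) *\<^sub>R b i)"
        by (rule sum.reindex_bij_betw[OF b, symmetric])
      also have "\<dots> = (\<Sum>j<n. Re (\<omega> j x) *\<^sub>R b (2 * j) + Im (\<omega> j x) *\<^sub>R b (2 * j + 1))"
        unfolding sum_pairs \<omega>_def by simp
      finally show ?thesis .
    qed
    have "(\<Sum>j<n. Re (\<omega> j x) *\<^sub>R b (2 * j) + Im (\<omega> j x) *\<^sub>R b (2 * j + 1)) =
      (\<Sum>j<n. Re (\<omega> j y) *\<^sub>R b (2 * j) + Im (\<omega> j y) *\<^sub>R b (2 * j + 1))"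
      by (rule sum.cong) (use xy in auto)
    thus ?thesis using v[of x] v[of y] by metis
  qed
  ultimately show ?thesis by blast
qed

text \<open>In complex coordinates take \<open>J\<close> to be multiplication by \<open>\<i>\<close>, and let the bracket take values in the
  line of the last coordinate, where it is minus the 2-form prescribed by \<open>M\<close>. That 2-form ignores the
  last coordinate, so iterated brackets vanish, and it is invariant under \<open>J\<close>, so \<open>J\<close> is abelian. On a
  (1,0)-form the operator \<open>\<partial>\<close>-bar is then \<open>d\<close>, whose kernel is spanned by the other coordinates.\<close>

theorem exists_structure:
  assumes M: "M \<in> carrier_mat m m" "M \<noteq> 0\<^sub>m m m" and DIM: "DIM('a) = 2 * Suc m"
  shows "\<exists>(br :: 'a::euclidean_space bracket) J. one_abelian (Suc m) br J \<and> presented_by (Suc m) br J M"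
proof -
  from complex_coordinates[OF DIM] obtain \<omega> :: "nat \<Rightarrow> 'a \<Rightarrow> complex" and v :: "(nat \<Rightarrow> complex) \<Rightarrow> 'a" where
    lin': "\<forall>j. linear (\<omega> j)" and wv': "\<forall>z. \<forall>j<Suc m. \<omega> j (v z) = z j" and
    ext': "\<forall>x y. (\<forall>j<Suc m. \<omega> j x = \<omega> j y) \<longrightarrow> x = y"
    by (elim exE conjE)
  note lin = lin'[rule_format] and wv = wv'[rule_format] and ext = ext'[rule_format]
  note lsimps = linear_add[OF lin] linear_scale[OF lin] linear_neg[OF lin] linear_diff[OF lin] linear_0[OF lin]
  define J where "J = (\<lambda>x. v (\<lambda>j. \<i> * \<omega> j x))"
  define \<Phi> where "\<Phi> = (\<lambda>x y. \<Sum>j<m. \<Sum>k<m. M $$ (j, k) * wedge (\<omega> j) (conj_form (\<omega> k)) x y)"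
  define br where "br = (\<lambda>x y. v (\<lambda>j. if j = m then - \<Phi> x y else 0))"
  have wJ: "\<omega> j (J x) = \<i> * \<omega> j x" if "j < Suc m" for j x using wv[OF that] by (simp add: J_def)
  have wbr: "\<omega> j (br x y) = (if j = m then - \<Phi> x y else 0)" if "j < Suc m" for j x y
    using wv[OF that] by (simp add: br_def)
  have Jlin: "linear J" by (intro linearI ext) (simp_all add: wJ lsimps algebra_simps)
  have JJ: "J (J x) = - x" for x by (rule ext) (simp add: wJ lsimps)
  have P_add: "\<Phi> (x + y) z = \<Phi> x z + \<Phi> y z" "\<Phi> z (x + y) = \<Phi> z x + \<Phi> z y" for x y z
    unfolding \<Phi>_def wedge_def conj_form_def lsimps sum.distrib[symmetric]
    by (intro sum.cong refl; simp add: algebra_simps)+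
  have P_scale: "\<Phi> (c *\<^sub>R x) z = c *\<^sub>R \<Phi> x z" "\<Phi> z (c *\<^sub>R x) = c *\<^sub>R \<Phi> z x" for c x z
    unfolding \<Phi>_def wedge_def conj_form_def lsimps scaleR_sum_right
    by (intro sum.cong refl; simp add: algebra_simps)+
  have P_neg: "\<Phi> (- x) z = - \<Phi> x z" for x z
    unfolding \<Phi>_def wedge_def conj_form_def lsimps sum_negf[symmetric]
    by (intro sum.cong refl; simp add: algebra_simps)
  have P_J: "\<Phi> (J x) (J y) = \<Phi> x y" for x y
    unfolding \<Phi>_def wedge_def conj_form_def by (intro sum.cong refl) (simp add: wJ algebra_simps)
  have P_self: "\<Phi> x x = 0" for x
    unfolding \<Phi>_def by (rule sum.neutral) (simp add: wedge_def)
  have P_zero: "\<Phi> x y = 0" if "\<And>j. j < m \<Longrightarrow> \<omega> j y = 0" for x y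
    unfolding \<Phi>_def wedge_def conj_form_def using that by (auto intro!: sum.neutral)
  have bil: "bilinear br"
    unfolding bilinear_def by (intro conjI allI linearI ext) (simp_all add: wbr lsimps P_add P_scale)
  have br_zero: "br x y = 0" if "\<And>j. j < m \<Longrightarrow> \<omega> j y = 0" for x y
    by (rule ext) (simp add: wbr lsimps P_zero[OF that])
  have "br x x = 0" for x by (rule ext) (simp add: wbr lsimps P_self)
  moreover have brbr: "br x (br y z) = 0" for x y z by (rule br_zero) (simp add: wbr)
  ultimately have lie: "lie_bracket br" unfolding lie_bracket_def using bil by simp
  have lc1: "\<omega> j y = 0" if "y \<in> lower_central br 1" "j < m" for y j
  proof -
    have "y \<in> span {br a b | a b. b \<in> UNIV}" using that by simp
    thus ?thesis
    proof (induction rule: span_induct)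
      case base
      show ?case unfolding real_vector.subspace_def by (auto simp: lsimps)
    next
      case (step x) thus ?case using that(2) by (auto simp: wbr)
    qed
  qed
  have "{br x y | x y. y \<in> lower_central br 1} = {0}"
  proof -
    have "0 \<in> lower_central br 1" by (simp add: span_zero)
    moreover have "br x y = 0" if "y \<in> lower_central br 1" for x y by (rule br_zero) (rule lc1[OF that])
    ultimately have "br 0 0 = 0" "\<forall>x. \<forall>y\<in>lower_central br 1. br x y = 0" "0 \<in> lower_central br 1" by blast+
    note * = this
    have "z = br 0 0" if "z \<in> {0}" for z using that *(1) by simp
    thus ?thesis using *(2,3) by fast
  qed
  hence "lower_central br (Suc 1) = {0}" unfolding lower_central.simps(2)[of br 1] by (simp only: span_insert_0 span_empty)
  hence nil: "nilpotent_bracket br" unfolding nilpotent_bracket_def by blast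
  have brJ: "br (J x) (J y) = br x y" for x y by (rule ext) (simp add: wbr P_J)
  have brJ2: "br (J x) y = - br x (J y)" for x y
  proof (rule ext)
    fix j assume "j < Suc m"
    thus "\<omega> j (br (J x) y) = \<omega> j (- br x (J y))"
      using P_J[of "J x" y] by (simp add: wbr lsimps JJ P_neg)
  qed
  have J0: "J (- x) = - J x" for x by (rule linear_neg[OF Jlin])
  have brneg: "br x (- y) = - br x y" for x y
    by (rule ext) (use P_scale(2)[of x "-1" y] in \<open>simp add: wbr lsimps\<close>)
  have cs: "complex_structure br J" unfolding complex_structure_def
    using Jlin JJ by (simp add: brJ brJ2 J0 brneg)
  hence ab: "abelian_structure br J" unfolding abelian_structure_def using brJ by blast
  have in10: "\<omega> j \<in> forms10 J" if "j < Suc m" for j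
    using lin wJ[OF that] by (simp add: forms10_def cforms1_def)
  have ind: "\<forall>c. (\<forall>x. (\<Sum>j<k. c j * \<omega> j x) = 0) \<longrightarrow> (\<forall>j<k. c j = 0)" if k: "k \<le> Suc m" for k
  proof (intro allI impI)
    fix c j assume c: "\<forall>x. (\<Sum>j<k. c j * \<omega> j x) = 0" and j: "j < k"
    have "(\<Sum>i<k. c i * \<omega> i (v (\<lambda>i. if i = j then 1 else 0))) = (\<Sum>i<k. if i = j then c i else 0)"
      by (rule sum.cong) (use k in \<open>auto simp: wv\<close>)
    thus "c j = 0" using c j by simp
  qed
  have expand: "\<alpha> = (\<lambda>x. \<Sum>j<Suc m. \<alpha> (v (\<lambda>i. if i = j then 1 else 0)) * \<omega> j x)" if a: "\<alpha> \<in> forms10 J" for \<alpha>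
  proof
    fix x
    let ?e = "\<lambda>j. v (\<lambda>i. if i = j then 1 else 0)"
    have la: "linear \<alpha>" and aJ: "\<alpha> (J y) = \<i> * \<alpha> y" for y using a by (auto simp: forms10_def cforms1_def)
    have "x = (\<Sum>j<Suc m. Re (\<omega> j x) *\<^sub>R ?e j + Im (\<omega> j x) *\<^sub>R J (?e j))"
    proof (rule ext)
      fix k assume k: "k < Suc m"
      have "\<omega> k (\<Sum>j<Suc m. Re (\<omega> j x) *\<^sub>R ?e j + Im (\<omega> j x) *\<^sub>R J (?e j)) =
        (\<Sum>j<Suc m. if j = k then \<omega> j x else 0)"
        unfolding linear_sum[OF lin] lsimps
        by (rule sum.cong) (use k in \<open>auto simp: wJ wv complex_eq_iff\<close>)
      thus "\<omega> k x = \<omega> k (\<Sum>j<Suc m. Re (\<omega> j x) *\<^sub>R ?e j + Im (\<omega> j x) *\<^sub>R J (?e j))" using k by simp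
    qed
    hence "\<alpha> x = \<alpha> (\<Sum>j<Suc m. Re (\<omega> j x) *\<^sub>R ?e j + Im (\<omega> j x) *\<^sub>R J (?e j))" by simp
    also have "\<dots> = (\<Sum>j<Suc m. \<alpha> (?e j) * \<omega> j x)"
      unfolding linear_sum[OF la] linear_add[OF la] linear_scale[OF la] aJ
      by (intro sum.cong refl) (auto simp: complex_eq_iff algebra_simps)
    finally show "\<alpha> x = (\<Sum>j<Suc m. \<alpha> (?e j) * \<omega> j x)" .
  qed
  have sub10: "cfun.subspace (forms10 J)"
    unfolding cfun.subspace_def
    by (auto simp: forms10_def cforms1_def cscale_def linear_zero algebra_simps intro!: linearI simp: linear_add linear_scale zero_fun_def)
  have span10: "cfun.span (\<omega> ` {..<Suc m}) = forms10 J"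
  proof
    show "cfun.span (\<omega> ` {..<Suc m}) \<subseteq> forms10 J"
      by (rule cfun.span_minimal) (use in10 sub10 in auto)
    show "forms10 J \<subseteq> cfun.span (\<omega> ` {..<Suc m})"
      by (rule subsetI, subst cfun_span_iff, rule exI, rule expand)
  qed
  have closed: "ce_d br (\<omega> i) = (\<lambda>x y. 0)" if "i < m" for i
    using that by (simp add: ce_d_def wbr)
  have dm: "ce_d br (\<omega> m) = \<Phi>" by (simp add: ce_d_def wbr)
  have pres: "presented_by (Suc m) br J M"
    unfolding presented_by_def
    using M ind[of "Suc m"] cfun_independent_iff[of \<omega> "Suc m"] span10 closed dm[unfolded \<Phi>_def]
    by (intro conjI exI[of _ \<omega>]) simp_all
  obtain x0 y0 where nz: "\<Phi> x0 y0 \<noteq> 0"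
  proof (rule ccontr)
    assume "\<not> thesis"
    hence z: "\<Phi> x y = 0" for x y using that by blast
    have "M $$ (j, k) = 0" if "j < m" "k < m" for j k
    proof (rule wedges_independent[where A = "\<lambda>j k. M $$ (j, k)" and \<omega> = \<omega> and J = J and m = m, OF _ ind _ that])
      show "(\<Sum>j<m. \<Sum>k<m. M $$ (j, k) * wedge (\<omega> j) (conj_form (\<omega> k)) x y) = 0" for x y
        using z[of x y] by (simp add: \<Phi>_def)
    qed (simp_all add: wJ)
    hence "M = 0\<^sub>m m m" using M(1) by (intro eq_matI) auto
    thus False using M by simp
  qed
  have "{\<alpha> \<in> forms10 J. dbar br J \<alpha> = (\<lambda>x y. 0)} = cfun.span (\<omega> ` {..<m})"
  proof (intro equalityI subsetI)
    fix \<alpha> assume "\<alpha> \<in> {\<alpha> \<in> forms10 J. dbar br J \<alpha> = (\<lambda>x y. 0)}"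
    hence a: "\<alpha> \<in> forms10 J" "dbar br J \<alpha> x0 y0 = 0" by auto
    let ?c = "\<lambda>j. \<alpha> (v (\<lambda>i. if i = j then 1 else 0))"
    have "\<alpha> (br x0 y0) = (\<Sum>j<Suc m. ?c j * \<omega> j (br x0 y0))" by (rule fun_cong[OF expand[OF a(1)]])
    also have "\<dots> = - ?c m * \<Phi> x0 y0" by (simp add: wbr)
    finally have "?c m * \<Phi> x0 y0 = 0" using a(2) by (simp add: dbar_def part11_def ce_d_def brJ)
    hence "?c m = 0" using nz by simp
    hence "(\<lambda>x. \<Sum>j<Suc m. ?c j * \<omega> j x) = (\<lambda>x. \<Sum>j<m. ?c j * \<omega> j x)" by simp
    with expand[OF a(1)] have "\<alpha> = (\<lambda>x. \<Sum>j<m. ?c j * \<omega> j x)" by (rule trans)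
    thus "\<alpha> \<in> cfun.span (\<omega> ` {..<m})" unfolding cfun_span_iff by (rule exI[of _ ?c])
  next
    fix \<alpha> assume "\<alpha> \<in> cfun.span (\<omega> ` {..<m})"
    then obtain c where c: "\<alpha> = (\<lambda>x. \<Sum>j<m. c j * \<omega> j x)" unfolding cfun_span_iff by blast
    have "\<alpha> \<in> cfun.span (\<omega> ` {..<m})" by fact
    also have "\<dots> \<subseteq> forms10 J" by (rule cfun.span_minimal) (use in10 sub10 in auto)
    finally show "\<alpha> \<in> {\<alpha> \<in> forms10 J. dbar br J \<alpha> = (\<lambda>x y. 0)}"
      by (simp add: dbar_def part11_def ce_d_def c wbr)
  qed
  moreover have "cfun.dim (cfun.span (\<omega> ` {..<m})) = m"
    using cfun.dim_span_eq_card_independent[of "\<omega> ` {..<m}"] ind[of m] cfun_independent_iff[of \<omega> m]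
      card_image[of \<omega> "{..<m}"] by simp
  ultimately have "one_abelian (Suc m) br J" unfolding one_abelian_def using lie nil ab by simp
  with pres show ?thesis by blast
qed

section \<open>Regular Hermitian matrices\<close>

definition signature_mat :: "nat \<Rightarrow> nat \<Rightarrow> complex mat" where
  "signature_mat m p = mat m m (\<lambda>(i, j). if i = j then (if i < p then 1 else - 1) else 0)"

lemma signature_mat_carrier: "signature_mat m p \<in> carrier_mat m m"
  by (simp add: signature_mat_def)

lemma signature_mat_index:
  "i < m \<Longrightarrow> j < m \<Longrightarrow> signature_mat m p $$ (i, j) = (if i = j then (if i < p then 1 else - 1) else 0)"
  by (simp add: signature_mat_def)

lemma signature_mat_adjoint: "mat_adjoint (signature_mat m p) = signature_mat m p"
  by (rule eq_matI)
    (auto simp: mat_adjoint_index[OF signature_mat_carrier] signature_mat_index carrier_matD[OF signature_mat_carrier])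

definition signature_form :: "nat \<Rightarrow> nat \<Rightarrow> (nat \<Rightarrow> complex) \<Rightarrow> real" where
  "signature_form m p x = (\<Sum>i<m. (if i < p then 1 else - 1) * (cmod (x i))\<^sup>2)"

lemma signature_mat_square: "signature_mat m p * signature_mat m p = 1\<^sub>m m"
proof (rule eq_matI)
  fix i j assume "i < dim_row (1\<^sub>m m)" "j < dim_col (1\<^sub>m m)"
  hence ij: "i < m" "j < m" by auto
  have "(\<Sum>k<m. signature_mat m p $$ (i, k) * signature_mat m p $$ (k, j)) =
    (\<Sum>k<m. if k = i then (if i = j then 1 else 0) else 0)"
    by (rule sum.cong) (use ij in \<open>auto simp: signature_mat_def\<close>)
  thus "(signature_mat m p * signature_mat m p) $$ (i, j) = 1\<^sub>m m $$ (i, j)"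
    using mat_mult_index[OF signature_mat_carrier signature_mat_carrier ij] ij by simp
qed (simp_all add: signature_mat_def)

lemma signature_mat_invertible: "invertible_mat (signature_mat m p)"
  unfolding invertible_mat_iff[OF signature_mat_carrier]
  using signature_mat_square signature_mat_carrier by blast

lemma signature_mat_form:
  "mat_form m (signature_mat m p) x x = of_real (signature_form m p x)"
proof -
  have "mat_form m (signature_mat m p) x x = (\<Sum>i<m. \<Sum>j<m. if j = i then of_real ((if i < p then 1 else - 1) * (cmod (x i))\<^sup>2) else 0)"
    unfolding mat_form_def
    by (intro sum.cong refl) (auto simp: signature_mat_def mult.commute complex_norm_square[symmetric] simp del: of_real_power)
  also have "\<dots> = (\<Sum>i<m. of_real ((if i < p then 1 else - 1) * (cmod (x i))\<^sup>2))"
    by (intro sum.cong refl) simp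
  finally show ?thesis by (simp add: signature_form_def)
qed

text \<open>Sylvester's law of inertia. The scalar turns out to be real. If it is positive, a dimension count
  produces, for \<open>p \<noteq> q\<close>, a nonzero vector on which one form is definite and the other has the wrong
  sign. If it is negative, the same argument gives \<open>m - q \<le> p\<close>, which for \<open>p, q \<le> m/2\<close> again forces
  \<open>p = q\<close>.\<close>

lemma scaled_congruent_signature:
  assumes cong: "scaled_congruent m (signature_mat m p) (signature_mat m q)"
    and p: "2 * p \<le> m" and q: "2 * q \<le> m"
  shows "p = q"
proof (cases "m = 0")
  case False
  from cong obtain c P where c: "c \<noteq> 0" and P: "P \<in> carrier_mat m m"
    and eq: "signature_mat m q = c \<cdot>\<^sub>m (P * signature_mat m p * mat_adjoint P)"
    unfolding scaled_congruent_def by auto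
  let ?Q = "signature_form m"
  have form: "complex_of_real (?Q q x) = c * of_real (?Q p (row_action m P x))" for x
    using mat_form_congruence[OF P signature_mat_carrier, of c p x x] unfolding eq[symmetric] signature_mat_form .
  \<comment> \<open>Both Hermitian forms are real and not identically zero, so the scalar is real.\<close>
  define r where "r = Re c"
  have r: "c = of_real r"
  proof -
    let ?e = "\<lambda>i. if i = 0 then 1 else (0::complex)"
    have "?Q q ?e = (\<Sum>i<m. if i = 0 then (if 0 < q then 1 else - 1) else 0)"
      unfolding signature_form_def by (rule sum.cong) auto
    hence nz: "?Q q ?e \<noteq> 0" using False by simp
    have f: "complex_of_real (?Q q ?e) = c * of_real (?Q p (row_action m P ?e))" by (rule form)
    have "?Q p (row_action m P ?e) \<noteq> 0" using f nz by auto
    hence "c = of_real (?Q q ?e / ?Q p (row_action m P ?e))" using f by (simp add: field_simps)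
    thus ?thesis unfolding r_def by (metis Re_complex_of_real)
  qed
  have form: "?Q q x = r * ?Q p (row_action m P x)" for x
    using form[of x] unfolding r by (metis of_real_eq_iff of_real_mult)
  have r0: "r \<noteq> 0" using c r by auto
  have witness: "\<exists>x. (\<exists>j<m. x j \<noteq> 0) \<and> (\<forall>j. j \<notin> T \<longrightarrow> x j = 0) \<and> (\<forall>i\<in>S. row_action m P x i = 0)"
    if S: "S \<subseteq> {..<m}" and T: "T \<subseteq> {..<m}" and less: "card S < card T" for S T
  proof -
    have fin: "finite S" "finite T" using S T finite_subset by auto
    obtain x where x: "x \<in> coord_space T" "\<exists>j. x j \<noteq> 0" "\<forall>i\<in>S. (\<Sum>j\<in>T. P $$ (j, i) * x j) = 0"
      using homogeneous_system[OF fin less, of "\<lambda>i j. P $$ (j, i)"] by blast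
    have "row_action m P x i = 0" if i: "i \<in> S" for i
    proof -
      have "(\<Sum>j<m. x j * P $$ (j, i)) = (\<Sum>j\<in>T. x j * P $$ (j, i))"
        by (rule sum.mono_neutral_right) (use T x(1) in \<open>auto simp: coord_space_def\<close>)
      also have "\<dots> = 0" using x(3) i by (simp add: mult.commute)
      finally show ?thesis by (simp add: row_action_def)
    qed
    moreover have "\<exists>j<m. x j \<noteq> 0" using x(1,2) T by (auto simp: coord_space_def)
    ultimately show ?thesis using x(1) by (auto simp: coord_space_def)
  qed
  have pos: "?Q k x > 0" if x: "\<exists>j<m. x j \<noteq> 0" "\<forall>j. j \<notin> {..<k} \<longrightarrow> x j = 0" for k x
  proof -
    obtain j where j: "j < m" "x j \<noteq> 0" using x(1) by blast
    show ?thesis unfolding signature_form_def by (rule sum_pos2[of _ j]) (use j x(2) in auto)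
  qed
  have neg: "?Q k x < 0" if x: "\<exists>j<m. x j \<noteq> 0" "\<forall>j. j \<notin> {k..<m} \<longrightarrow> x j = 0" for k x
  proof -
    obtain j where j: "j < m" "x j \<noteq> 0" using x(1) by blast
    have "0 < (\<Sum>i<m. - ((if i < k then 1 else - 1) * (cmod (x i))\<^sup>2))"
      by (rule sum_pos2[of _ j]) (use j x(2) in auto)
    thus ?thesis by (simp add: sum_negf signature_form_def)
  qed
  have nonpos: "?Q k x \<le> 0" if "\<forall>i\<in>{..<k}. x i = 0" for k x
    unfolding signature_form_def by (rule sum_nonpos) (use that in auto)
  have nonneg: "?Q k x \<ge> 0" if "\<forall>i\<in>{k..<m}. x i = 0" for k x
    unfolding signature_form_def by (rule sum_nonneg) (use that in auto)
  show ?thesis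
  proof (cases "r > 0")
    case True
    have "\<not> p < q"
    proof
      assume less: "p < q"
      have "\<exists>x. (\<exists>j<m. x j \<noteq> 0) \<and> (\<forall>j. j \<notin> {..<q} \<longrightarrow> x j = 0) \<and> (\<forall>i\<in>{..<p}. row_action m P x i = 0)"
        by (rule witness) (use p q less in auto)
      then obtain x where x: "\<exists>j<m. x j \<noteq> 0" "\<forall>j. j \<notin> {..<q} \<longrightarrow> x j = 0" "\<forall>i\<in>{..<p}. row_action m P x i = 0" by blast
      have "0 < r * ?Q p (row_action m P x)" using pos[OF x(1,2)] form[of x] by simp
      thus False using True nonpos[OF x(3)] by (simp add: zero_less_mult_iff)
    qed
    moreover have "\<not> q < p"
    proof
      assume less: "q < p"
      have "\<exists>x. (\<exists>j<m. x j \<noteq> 0) \<and> (\<forall>j. j \<notin> {q..<m} \<longrightarrow> x j = 0) \<and> (\<forall>i\<in>{p..<m}. row_action m P x i = 0)"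
        by (rule witness) (use p q less in auto)
      then obtain x where x: "\<exists>j<m. x j \<noteq> 0" "\<forall>j. j \<notin> {q..<m} \<longrightarrow> x j = 0" "\<forall>i\<in>{p..<m}. row_action m P x i = 0" by blast
      have "r * ?Q p (row_action m P x) < 0" using neg[OF x(1,2)] form[of x] by simp
      thus False using True nonneg[OF x(3)] by (simp add: mult_less_0_iff)
    qed
    ultimately show ?thesis by simp
  next
    case False
    hence r: "r < 0" using r0 by simp
    have "\<not> p < m - q"
    proof
      assume less: "p < m - q"
      have "\<exists>x. (\<exists>j<m. x j \<noteq> 0) \<and> (\<forall>j. j \<notin> {q..<m} \<longrightarrow> x j = 0) \<and> (\<forall>i\<in>{..<p}. row_action m P x i = 0)"
        by (rule witness) (use p q less in auto)
      then obtain x where x: "\<exists>j<m. x j \<noteq> 0" "\<forall>j. j \<notin> {q..<m} \<longrightarrow> x j = 0" "\<forall>i\<in>{..<p}. row_action m P x i = 0" by blast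
      have "r * ?Q p (row_action m P x) < 0" using neg[OF x(1,2)] form[of x] by simp
      thus False using r nonpos[OF x(3)] by (simp add: mult_less_0_iff)
    qed
    thus ?thesis using p q by linarith
  qed
qed (use p q in auto)

lemma diag_block_mat_singletons:
  "diag_block_mat (map (\<lambda>a. mat (Suc 0) (Suc 0) (\<lambda>_. a)) as) =
    mat (length as) (length as) (\<lambda>(i, j). if i = j then as ! i else 0)"
proof (induction as)
  case (Cons a as)
  show ?case
    by (rule eq_matI) (use Cons in \<open>auto simp: Let_def nth_Cons'\<close>)
qed (auto intro!: eq_matI)

definition hermitian_configuration :: "nat \<Rightarrow> configuration" where
  "hermitian_configuration m = ({#}, {#replicate_mset m 1#}, {#})"

text \<open>The blocks are \<open>\<plusminus>\<Delta>\<^sub>1\<close>. A Hermitian matrix has the identity as cosquare, so the signature is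
  not visible in the configuration.\<close>

lemma signature_mat_configuration:
  assumes m: "m > 0"
  shows "has_configuration (signature_mat m p) (hermitian_configuration m)"
proof -
  define bs where "bs = map (\<lambda>i. Delta_block (if i < p then 1 else - 1) 1) [0..<m]"
  define as where "as = map (\<lambda>i. if i < p then 1 else - 1 :: complex) [0..<m]"
  have block: "block_mat (Delta_block u 1) = mat (Suc 0) (Suc 0) (\<lambda>_. u)" for u
    by (rule eq_matI) (auto simp: Delta_mat_def)
  have "diag_block_mat (map block_mat bs) = diag_block_mat (map (\<lambda>a. mat (Suc 0) (Suc 0) (\<lambda>_. a)) as)"
    unfolding bs_def as_def map_map o_def block ..
  also have "\<dots> = signature_mat m p"
    unfolding diag_block_mat_singletons by (rule eq_matI) (auto simp: as_def signature_mat_def)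
  finally have R: "diag_block_mat (map block_mat bs) = signature_mat m p" .
  have cosq: "cosquare (signature_mat m p) = 1\<^sub>m m"
    using cosquare_eq[OF signature_mat_carrier signature_mat_carrier, of m p p]
    by (simp add: signature_mat_adjoint signature_mat_square)
  define ns where "ns = replicate m (1 :: nat, 1 :: complex)"
  have "jordan_matrix (replicate k (1 :: nat, 1 :: complex)) = 1\<^sub>m k" for k
  proof (induction k)
    case (Suc k)
    have "jordan_matrix (replicate (Suc k) (1 :: nat, 1 :: complex)) =
      four_block_mat (jordan_block 1 1) (0\<^sub>m 1 k) (0\<^sub>m k 1) (1\<^sub>m k)"
      using Suc by (simp add: jordan_matrix_Cons sum_list_replicate)
    also have "\<dots> = 1\<^sub>m (Suc k)" by (rule eq_matI) auto
    finally show ?case .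
  qed (auto simp: jordan_matrix_def)
  hence J: "jordan_nf (cosquare (signature_mat m p)) ns"
    unfolding jordan_nf_def cosq ns_def by (auto intro: similar_mat_refl[of _ m])
  have "snd ` set ns = {1}" using m by (simp add: ns_def)
  hence E: "eigen_partitions ns {e. cmod e = 1} = {#replicate_mset m 1#}" "eigen_partitions ns {e. cmod e > 1} = {#}"
    unfolding eigen_partitions_def by (simp_all add: ns_def mset_replicate filter_replicate)
  show ?thesis unfolding has_configuration_def hermitian_configuration_def
  proof (intro exI conjI)
    show "star_congruent (signature_mat m p) (diag_block_mat (map (\<lambda>k. jordan_block k 0) [] @ map block_mat bs))"
      using R star_congruent_refl[OF signature_mat_carrier] by simp
    show "jordan_nf (cosquare (signature_mat m p)) ns" by (rule J)
    show "signature_mat m p = diag_block_mat (map block_mat bs)" using R by simp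
    show "\<forall>b\<in>set bs. valid_block b" by (auto simp: bs_def)
  qed (use E in auto)
qed

section \<open>Maximal type of the canonical singular matrices\<close>

text \<open>The columns in \<open>J\<close> are independent, and adding any other column adds the zero vector; so they form
  a maximal independent set of columns.\<close>

lemma rank_eq_card_nonzero_cols:
  fixes A :: "complex mat"
  assumes A: "A \<in> carrier_mat n nc" and J: "J \<subseteq> {..<nc}"
    and zero: "\<And>i j. i < n \<Longrightarrow> j < nc \<Longrightarrow> j \<notin> J \<Longrightarrow> A $$ (i, j) = 0"
    and ind: "\<And>x j. (\<And>i. i < n \<Longrightarrow> (\<Sum>j\<in>J. A $$ (i, j) * x j) = 0) \<Longrightarrow> j \<in> J \<Longrightarrow> x j = 0"
  shows "vec_space.rank n A = card J"
proof -
  interpret vec_space "TYPE(complex)" n .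
  have fin: "finite J" using J finite_subset by auto
  define js where "js = sorted_list_of_set J"
  have js: "set js = J" "distinct js" "length js = card J" using fin by (auto simp: js_def)
  define B where "B = mat_of_cols n (map (col A) js)"
  have B: "B \<in> carrier_mat n (length js)" unfolding B_def using mat_of_cols_carrier(1)[of n "map (col A) js"] by simp
  have cB: "cols B = map (col A) js" unfolding B_def
    by (rule cols_mat_of_cols) (use A in \<open>auto simp: col_dim\<close>)
  have inj: "inj_on (col A) J"
  proof (rule inj_onI, rule ccontr)
    fix a b assume ab: "a \<in> J" "b \<in> J" "col A a = col A b" "a \<noteq> b"
    have "(\<Sum>j\<in>J. A $$ (i, j) * (if j = a then 1 else if j = b then - 1 else 0)) = 0" if i: "i < n" for i
    proof -
      have "a < nc" "b < nc" using ab(1,2) J by auto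
      hence eq: "A $$ (i, a) = A $$ (i, b)"
        using arg_cong[OF ab(3), of "\<lambda>v. v $ i"] A i by simp
      let ?x = "\<lambda>j. if j = a then 1 else if j = b then - 1 else 0 :: complex"
      have "(\<Sum>j\<in>J. A $$ (i, j) * ?x j) = (\<Sum>j\<in>{a, b}. A $$ (i, j) * ?x j)"
        by (rule sum.mono_neutral_right) (use ab(1,2) fin in auto)
      also have "\<dots> = A $$ (i, a) * ?x a + A $$ (i, b) * ?x b" using ab(4) by simp
      also have "\<dots> = 0" unfolding eq using ab(4) by simp
      finally show ?thesis .
    qed
    from ind[of "\<lambda>j. if j = a then 1 else if j = b then - 1 else 0", OF this ab(1)] show False by simp
  qed
  have dB: "distinct (cols B)" using js inj by (simp add: cB distinct_map)
  have li: "lin_indpt (set (cols B))"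
  proof
    assume "lin_dep (set (cols B))"
    from lin_depE[OF B this dB] obtain v where v: "v \<in> carrier_vec (length js)" "v \<noteq> 0\<^sub>v (length js)" "B *\<^sub>v v = 0\<^sub>v n"
      by blast
    define f where "f = the_inv_into {..<length js} ((!) js)"
    have f: "f (js ! t) = t" if "t < length js" for t
      unfolding f_def by (rule the_inv_into_f_f) (use that js(2) in \<open>auto simp: inj_on_nth\<close>)
    have "(\<Sum>j\<in>J. A $$ (i, j) * v $ f j) = 0" if i: "i < n" for i
    proof -
      have "(\<Sum>j\<in>J. A $$ (i, j) * v $ f j) = (\<Sum>t<length js. A $$ (i, js ! t) * v $ f (js ! t))"
        using bij_betw_nth[OF js(2), of "{..<length js}" "set js"] js(1)
        by (simp add: sum.reindex_bij_betw[symmetric, of "(!) js" "{..<length js}" J])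
      also have "\<dots> = (\<Sum>t<length js. B $$ (i, t) * v $ t)"
      proof (rule sum.cong)
        fix t assume "t \<in> {..<length js}"
        hence t: "t < length js" by simp
        hence "js ! t < nc" using js(1) J nth_mem by blast
        thus "A $$ (i, js ! t) * v $ f (js ! t) = B $$ (i, t) * v $ t"
          using t i f A by (simp add: B_def mat_of_cols_index)
      qed simp
      also have "\<dots> = (B *\<^sub>v v) $ i" using mult_mat_vec_index[OF B v(1) i] by simp
      finally show ?thesis using v(3) i by simp
    qed
    from ind[of "\<lambda>j. v $ f j", OF this] have z: "v $ f j = 0" if "j \<in> J" for j using that by blast
    have "v $ t = 0" if "t < length js" for t using z[of "js ! t"] f[OF that] that js(1) nth_mem[of t js] by simp
    hence "v = 0\<^sub>v (length js)" using v(1) by (intro eq_vecI) auto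
    thus False using v(2) by simp
  qed
  have "maximal (set (cols B)) (\<lambda>T. T \<subseteq> set (cols A) \<and> lin_indpt T)"
    unfolding maximal_def
  proof (intro conjI allI impI)
    show "set (cols B) \<subseteq> set (cols A)"
    proof -
      have "set (cols B) = col A ` J" by (simp add: cB js)
      moreover have "set (cols A) = col A ` {..<nc}" using A by (auto simp: cols_def)
      ultimately show ?thesis using J by auto
    qed
    show "lin_indpt (set (cols B))" by (rule li)
    fix T assume T: "set (cols B) \<subseteq> T \<and> T \<subseteq> set (cols A) \<and> lin_indpt T"
    have "w \<in> set (cols B)" if w: "w \<in> T" for w
    proof -
      obtain j where j: "j < nc" "w = col A j" using w T A unfolding cols_def by auto
      have "j \<in> J"
      proof (rule ccontr)
        assume "j \<notin> J"
        hence "w = 0\<^sub>v n" using zero[OF _ j(1)] j A by (intro eq_vecI) auto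
        moreover have "0\<^sub>v n \<notin> T"
        proof (rule zero_nin_lin_indpt)
          show "T \<subseteq> carrier_vec n" using T A cols_dim[of A] by auto
          show "lin_indpt T" using T by blast
          show "UNIV \<noteq> {0 :: complex}" by (metis UNIV_I singletonD zero_neq_one)
        qed
        ultimately show False using w by simp
      qed
      thus ?thesis using j(2) js(1) by (simp add: cB)
    qed
    thus "T = set (cols B)" using T by auto
  qed
  from rank_card_indpt[OF A this] have "rank A = card (set (cols B))" .
  also have "\<dots> = card J" unfolding cB using distinct_card[OF dB] js(3) by (simp add: cB)
  finally show ?thesis .
qed

context nilpotent_regular
begin

lemma regular_right_kernel:
  assumes y: "\<And>i. i < d \<Longrightarrow> (\<Sum>j<d. R $$ (i, j) * y j) = 0" and j: "j < d"
  shows "y j = 0"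
proof -
  obtain Q where Q: "Q \<in> carrier_mat d d" "Q * R = 1\<^sub>m d" using invertible_mat_iff[OF R] R_inv by auto
  have v: "vec d y \<in> carrier_vec d" by simp
  have "R *\<^sub>v vec d y = 0\<^sub>v d"
  proof (rule eq_vecI)
    fix i assume "i < dim_vec (0\<^sub>v d :: complex vec)"
    hence i: "i < d" by simp
    have "(R *\<^sub>v vec d y) $ i = (\<Sum>j<d. R $$ (i, j) * y j)"
      unfolding mult_mat_vec_index[OF R v i] by (rule sum.cong) auto
    thus "(R *\<^sub>v vec d y) $ i = 0\<^sub>v d $ i" using y[OF i] i by simp
  qed (use R in simp)
  hence "Q *\<^sub>v (R *\<^sub>v vec d y) = 0\<^sub>v d" using Q by auto
  hence "vec d y = 0\<^sub>v d" using assoc_mult_mat_vec[OF Q(1) R v] Q(2) v by simp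
  from arg_cong[OF this, of "\<lambda>v. v $ j"] show ?thesis using j by simp
qed

text \<open>The zero columns are those at the beginnings of the nilpotent blocks. There are as many of them
  as of the ends of blocks, which are the zero rows; the rank is expressed by the latter because
  they are the rows to be moved down for the maximal type.\<close>

lemma rank_M: "vec_space.rank (s + d) M = s + d - card {i. i < s \<and> e i = 0}"
proof -
  let ?C = "Suc ` {i. i < s \<and> e i \<noteq> 0}"
  let ?J = "?C \<union> {s..<s + d}"
  have C: "?C \<subseteq> {..<s}" using e_Suc by auto
  have J: "?J \<subseteq> {..<s + d}" using C by auto
  have fin: "finite ?J" by simp
  have "vec_space.rank (s + d) M = card ?J"
  proof (rule rank_eq_card_nonzero_cols[OF M J])
    fix i j assume ij: "i < s + d" "j < s + d" "j \<notin> ?J"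
    hence j: "j < s" "j \<notin> ?C" by auto
    show "M $$ (i, j) = 0"
    proof (cases "i < s")
      case True thus ?thesis using M_nil[OF True ij(2)] j by auto
    next
      case False thus ?thesis using M_zero[of "i - s" j] ij j by simp
    qed
  next
    fix x j assume x: "\<And>i. i < s + d \<Longrightarrow> (\<Sum>j\<in>?J. M $$ (i, j) * x j) = 0" and j: "j \<in> ?J"
    show "x j = 0"
    proof (cases "j \<in> ?C")
      case True
      then obtain i where i: "i < s" "e i \<noteq> 0" "j = Suc i" by auto
      have "(\<Sum>k\<in>?J. M $$ (i, k) * x k) = (\<Sum>k\<in>?J. if k = j then x k else 0)"
      proof (rule sum.cong)
        fix k assume "k \<in> ?J"
        hence "k < s + d" using J by auto
        thus "M $$ (i, k) * x k = (if k = j then x k else 0)" using M_nil[OF i(1)] i by simp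
      qed simp
      also have "\<dots> = x j" using j fin by (simp only: sum.delta if_True)
      finally show ?thesis using x[of i] i(1) by simp
    next
      case False
      hence j': "s \<le> j" "j < s + d" using j by auto
      have "x (s + t) = 0" if t: "t < d" for t
      proof (rule regular_right_kernel[OF _ t])
        fix i assume i: "i < d"
        have "(\<Sum>k\<in>?J. M $$ (s + i, k) * x k) = (\<Sum>k\<in>{s..<s + d}. M $$ (s + i, k) * x k)"
          by (rule sum.mono_neutral_right[OF fin]) (use C M_zero[OF i] in auto)
        also have "\<dots> = (\<Sum>k<d. M $$ (s + i, s + k) * x (s + k))"
          using sum.shift_bounds_nat_ivl[of "\<lambda>k. M $$ (s + i, k) * x k" 0 s d]
          by (simp add: add.commute atLeast0LessThan)
        also have "\<dots> = (\<Sum>k<d. R $$ (i, k) * x (s + k))"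
          by (rule sum.cong) (use M_reg[OF i] in auto)
        finally show "(\<Sum>k<d. R $$ (i, k) * x (s + k)) = 0" using x[of "s + i"] i by simp
      qed
      from this[of "j - s"] show ?thesis using j' by simp
    qed
  qed
  also have "card ?J = card ?C + d"
    using C by (subst card_Un_disjoint) auto
  also have "card ?C = s - card {i. i < s \<and> e i = 0}"
  proof -
    have "card ?C = card ({..<s} - {i. i < s \<and> e i = 0})"
      by (subst card_image) (auto intro!: arg_cong[of _ _ card])
    also have "\<dots> = s - card {i. i < s \<and> e i = 0}" by (subst card_Diff_subset) auto
    finally show ?thesis .
  qed
  finally have "vec_space.rank (s + d) M = s - card {i. i < s \<and> e i = 0} + d" .
  moreover have "card {i. i < s \<and> e i = 0} \<le> s"
    using card_mono[of "{..<s}" "{i. i < s \<and> e i = 0}"] by auto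
  ultimately show ?thesis by simp
qed

text \<open>A permutation \<open>\<pi>\<close> moves the zero rows to the bottom. The columns moved along with them are unit
  vectors, with their 1 in the row before the end of the block. As no block has size 1, that row is
  not itself an end, so these columns remain independent when the bottom rows are cut off.\<close>

lemma maximal_type_M:
  assumes two: "\<And>i. i < s \<Longrightarrow> e i = 0 \<Longrightarrow> i \<noteq> 0 \<and> e (i - 1) \<noteq> 0"
  shows "maximal_type M"
proof -
  define m where "m = s + d"
  define E where "E = {i. i < s \<and> e i = 0}"
  define l where "l = card E"
  define r where "r = m - l"
  have E: "E \<subseteq> {..<m}" "finite E" by (auto simp: E_def m_def)
  have lm: "l \<le> m" using card_mono[OF _ E(1)] by (simp add: l_def)
  have rl: "r + l = m" "m - r = l" using lm by (auto simp: r_def)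
  have Mc: "M \<in> carrier_mat m m" using M by (simp add: m_def)
  have rank: "vec_space.rank m M = r" using rank_M by (simp add: m_def r_def l_def E_def)
  have "\<exists>\<pi>. bij_betw \<pi> {..<m} {..<m} \<and> \<pi> ` {r..<m} = E"
  proof -
    have "card {..<r} = card ({..<m} - E)" using E card_Diff_subset[OF E(2,1)] by (simp add: r_def l_def)
    then obtain f where f: "bij_betw f {..<r} ({..<m} - E)"
      using finite_same_card_bij[of "{..<r}" "{..<m} - E"] by auto
    have "card {r..<m} = card E" using rl by (simp add: l_def)
    then obtain g where g: "bij_betw g {r..<m} E"
      using finite_same_card_bij[of "{r..<m}" E] E by auto
    define \<pi> where "\<pi> = (\<lambda>i. if i < r then f i else g i)"
    have 1: "bij_betw \<pi> {..<r} ({..<m} - E)" using f by (subst bij_betw_cong[of _ \<pi> f]) (auto simp: \<pi>_def)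
    have 2: "bij_betw \<pi> {r..<m} E" using g by (subst bij_betw_cong[of _ \<pi> g]) (auto simp: \<pi>_def)
    have "bij_betw \<pi> ({..<r} \<union> {r..<m}) (({..<m} - E) \<union> E)"
      by (rule bij_betw_combine[OF 1 2]) auto
    moreover have "{..<r} \<union> {r..<m} = {..<m}" "({..<m} - E) \<union> E = {..<m}" using E rl by auto
    ultimately show ?thesis using 2 by (auto simp: bij_betw_def)
  qed
  then obtain \<pi> where \<pi>: "bij_betw \<pi> {..<m} {..<m}" and \<pi>E: "\<pi> ` {r..<m} = E" by blast
  have \<pi>_less: "\<pi> i < m" if "i < m" for i using bij_betwE[OF \<pi>] that by auto
  have \<pi>_inj: "\<pi> i = \<pi> j \<longleftrightarrow> i = j" if "i < m" "j < m" for i j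
    using \<pi> that by (auto simp: bij_betw_def inj_on_def)
  define S where "S = mat m m (\<lambda>(i, j). if j = \<pi> i then 1 else (0 :: complex))"
  have S: "S \<in> carrier_mat m m" by (simp add: S_def)
  have S_index: "S $$ (i, j) = (if j = \<pi> i then 1 else 0)" if "i < m" "j < m" for i j
    using that by (simp add: S_def)
  have aS: "mat_adjoint S \<in> carrier_mat m m" using S by auto
  have "S * mat_adjoint S = 1\<^sub>m m"
  proof (rule eq_matI)
    fix i j assume "i < dim_row (1\<^sub>m m)" "j < dim_col (1\<^sub>m m)"
    hence ij: "i < m" "j < m" by auto
    have "(S * mat_adjoint S) $$ (i, j) = (\<Sum>k<m. if k = \<pi> i then (if i = j then 1 else 0) else 0)"
      unfolding mat_mult_index[OF S aS ij]
      by (rule sum.cong) (use ij \<pi>_inj[OF ij] in \<open>auto simp: mat_adjoint_index[OF S] S_index\<close>)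
    thus "(S * mat_adjoint S) $$ (i, j) = 1\<^sub>m m $$ (i, j)" using ij \<pi>_less by simp
  qed (use S in auto)
  hence S_inv: "invertible_mat S"
    using mat_mult_left_right_inverse[OF S aS] aS invertible_mat_iff[OF S] by blast
  have SMS: "(S * M * mat_adjoint S) $$ (i, j) = M $$ (\<pi> i, \<pi> j)" if ij: "i < m" "j < m" for i j
  proof -
    have "(S * M * mat_adjoint S) $$ (i, j) =
      (\<Sum>a<m. \<Sum>b<m. if b = \<pi> j then (if a = \<pi> i then M $$ (a, b) else 0) else 0)"
      unfolding congruence_index[OF S Mc ij] by (intro sum.cong refl) (use ij in \<open>auto simp: S_def\<close>)
    also have "\<dots> = (\<Sum>a<m. if a = \<pi> i then M $$ (a, \<pi> j) else 0)"
      using \<pi>_less[OF ij(2)] by simp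
    also have "\<dots> = M $$ (\<pi> i, \<pi> j)" using \<pi>_less[OF ij(1)] by simp
    finally show ?thesis .
  qed
  define M' where "M' = mat r r (\<lambda>(i, j). M $$ (\<pi> i, \<pi> j))"
  define N where "N = mat r l (\<lambda>(i, j). M $$ (\<pi> i, \<pi> (r + j)))"
  have row0: "M $$ (\<pi> i, k) = 0" if "r \<le> i" "i < m" "k < m" for i k
  proof -
    have "\<pi> i \<in> E" using that \<pi>E by auto
    thus ?thesis using M_nil[of "\<pi> i" k] that(3) by (simp add: E_def m_def)
  qed
  have block: "S * M * mat_adjoint S = four_block_mat M' N (0\<^sub>m l r) (0\<^sub>m l l)"
    (is "?L = ?R")
  proof (rule eq_matI)
    have d: "dim_row ?R = m" "dim_col ?R = m" using rl by (auto simp: M'_def N_def)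
    fix i j assume "i < dim_row ?R" "j < dim_col ?R"
    hence ij: "i < m" "j < m" using d by auto
    show "?L $$ (i, j) = ?R $$ (i, j)"
      unfolding SMS[OF ij] using ij rl row0[of i] \<pi>_less[OF ij(2)]
      by (auto simp: M'_def N_def)
  qed (use S Mc rl in \<open>auto simp: M'_def N_def\<close>)
  have "vec_space.rank r N = card {..<l}"
  proof (rule rank_eq_card_nonzero_cols)
    show "N \<in> carrier_mat r l" by (simp add: N_def)
    fix x j assume x: "\<And>i. i < r \<Longrightarrow> (\<Sum>j\<in>{..<l}. N $$ (i, j) * x j) = 0" and "j \<in> {..<l}"
    hence j: "j < l" by simp
    define z where "z = \<pi> (r + j)"
    have z: "z \<in> E" using \<pi>E j rl by (auto simp: z_def)
    hence zs: "z < s" "z \<noteq> 0" "e (z - 1) \<noteq> 0" using two by (auto simp: E_def)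
    have "z - 1 \<in> {..<m}" using zs by (simp add: m_def)
    then obtain i where i: "i < m" "\<pi> i = z - 1" using \<pi> unfolding bij_betw_def by (metis imageE lessThan_iff)
    have ir: "i < r"
    proof (rule ccontr)
      assume "\<not> i < r"
      hence "\<pi> i \<in> E" unfolding \<pi>E[symmetric] using i(1) by (intro imageI) simp
      thus False using i zs by (simp add: E_def)
    qed
    have "(\<Sum>k\<in>{..<l}. N $$ (i, k) * x k) = (\<Sum>k\<in>{..<l}. if k = j then x k else 0)"
    proof (rule sum.cong)
      fix k assume "k \<in> {..<l}"
      hence k: "k < l" by simp
      have "M $$ (z - 1, \<pi> (r + k)) = (if \<pi> (r + k) = z then 1 else 0)"
        using M_nil[of "z - 1" "\<pi> (r + k)"] zs \<pi>_less[of "r + k"] k rl by (auto simp: m_def)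
      moreover have "\<pi> (r + k) = z \<longleftrightarrow> k = j" unfolding z_def using \<pi>_inj[of "r + k" "r + j"] k j rl by auto
      ultimately show "N $$ (i, k) * x k = (if k = j then x k else 0)" using ir k i by (simp add: N_def)
    qed simp
    thus "x j = 0" using x[OF ir] j by simp
  qed (simp_all add: N_def)
  hence rankN: "vec_space.rank r N = l" by simp
  have M'c: "M' \<in> carrier_mat r r" and Nc: "N \<in> carrier_mat r l" by (simp_all add: M'_def N_def)
  have "dim_row M = m" using Mc by simp
  thus ?thesis unfolding maximal_type_def Let_def \<open>dim_row M = m\<close> rank rl(2)
    using S S_inv M'c Nc block rankN by blast
qed

end

section \<open>Configurations of regular matrices and of singular matrices of maximal type\<close>

definition regular_configurations :: "nat \<Rightarrow> configuration set" where
  "regular_configurations m = {c. \<exists>M \<in> carrier_mat m m. invertible_mat M \<and> has_configuration M c}"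

text \<open>An invertible matrix has no nilpotent block, since the last row of such a block is zero.\<close>

lemma regular_configurationE:
  assumes "c \<in> regular_configurations d"
  obtains bs n_as where "\<forall>b\<in>set bs. valid_block b" "(\<Sum>b\<leftarrow>bs. block_order b) = d"
    "jordan_nf (cosquare (diag_block_mat (map block_mat bs))) n_as"
    "c = ({#}, eigen_partitions n_as {e. cmod e = 1}, eigen_partitions n_as {e. cmod e > 1})"
proof -
  from assms obtain M where M: "M \<in> carrier_mat d d" "invertible_mat M" and h: "has_configuration M c"
    unfolding regular_configurations_def by auto
  from h obtain ks bs n_as where ks: "0 \<notin> set ks" and bs: "\<forall>b\<in>set bs. valid_block b"
    and F: "star_congruent M (diag_block_mat (map (\<lambda>k. jordan_block k 0) ks @ map block_mat bs))"
    and J: "jordan_nf (cosquare (diag_block_mat (map block_mat bs))) n_as"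
    and c: "c = (mset ks, eigen_partitions n_as {e. cmod e = 1}, eigen_partitions n_as {e. cmod e > 1})"
    unfolding has_configuration_def by blast
  let ?D = "diag_block_mat (map (\<lambda>k. jordan_block k 0) ks @ map block_mat bs)"
  let ?s = "sum_list ks" and ?d = "\<Sum>b\<leftarrow>bs. block_order b"
  note sc = star_congruent_imp_scaled[OF F M(1)]
  have D: "?D \<in> carrier_mat d d" using sc unfolding scaled_congruent_def by auto
  have Dinv: "invertible_mat ?D" using scaled_congruent_invertible[OF sc] M(2) by simp
  interpret N: nilpotent_regular ?s ?d "\<lambda>i. steps_to_end ks ! i" "diag_block_mat (map block_mat bs)" ?D
    by (rule canonical_form_nilpotent_regular[OF bs])
  have dim: "?s + ?d = d" using N.M D by auto
  have "?s = 0"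
  proof (rule ccontr)
    assume "?s \<noteq> 0"
    define i where "i = ?s - 1"
    have i: "i < ?s" "i < d" "Suc i = ?s" using \<open>?s \<noteq> 0\<close> dim unfolding i_def by linarith+
    have e0: "steps_to_end ks ! i = 0" using N.e_Suc[OF i(1)] i(3) by auto
    obtain Q where Q: "Q \<in> carrier_mat d d" "?D * Q = 1\<^sub>m d" using invertible_mat_iff[OF D] Dinv by auto
    have "(?D * Q) $$ (i, i) = (\<Sum>k<d. ?D $$ (i, k) * Q $$ (k, i))" by (rule mat_mult_index[OF D Q(1) i(2,2)])
    also have "\<dots> = 0" by (rule sum.neutral) (use N.M_nil[OF i(1)] e0 dim in auto)
    finally show False using Q(2) i(2) by simp
  qed
  hence "\<forall>k\<in>set ks. k = 0" by simp
  hence "ks = []" using ks by (cases ks) auto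
  thus ?thesis using that[OF bs _ J] c dim \<open>?s = 0\<close> by simp
qed

lemma steps_to_end_two:
  "\<forall>k\<in>set ks. 2 \<le> k \<Longrightarrow> i < sum_list ks \<Longrightarrow> steps_to_end ks ! i = 0 \<Longrightarrow>
    i \<noteq> 0 \<and> steps_to_end ks ! (i - 1) \<noteq> 0"
proof (induction ks arbitrary: i)
  case (Cons k ks)
  show ?case
  proof (cases "i < k")
    case True
    thus ?thesis using Cons.prems by (auto simp: steps_to_end_Cons_nth)
  next
    case False
    have i: "i < k + sum_list ks" "steps_to_end ks ! (i - k) = 0" "i - k < sum_list ks"
      using Cons.prems(2,3) False by (simp_all add: steps_to_end_Cons_nth)
    have "i - k \<noteq> 0 \<and> steps_to_end ks ! (i - k - 1) \<noteq> 0"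
      by (rule Cons.IH[OF _ i(3,2)]) (use Cons.prems(1) in simp)
    moreover from this have "\<not> i - 1 < k" "i - 1 - k = i - k - 1" by linarith+
    ultimately show ?thesis using i(1) by (simp add: steps_to_end_Cons_nth)
  qed
qed simp

text \<open>Adding nilpotent blocks to a canonical form of a regular matrix changes only the first component
  of the configuration.\<close>

lemma singular_configuration_realized:
  assumes c: "c \<in> regular_configurations d" and ks: "\<forall>k\<in>set ks. 2 \<le> k" "ks \<noteq> []"
    and m: "sum_list ks + d = m"
  shows "\<exists>M \<in> carrier_mat m m. M \<noteq> 0\<^sub>m m m \<and> maximal_type M \<and> has_configuration M (mset ks, snd c)"
proof -
  from regular_configurationE[OF c] obtain bs n_as where bs: "\<forall>b\<in>set bs. valid_block b"
    and d: "(\<Sum>b\<leftarrow>bs. block_order b) = d"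
    and J: "jordan_nf (cosquare (diag_block_mat (map block_mat bs))) n_as"
    and c': "c = ({#}, eigen_partitions n_as {e. cmod e = 1}, eigen_partitions n_as {e. cmod e > 1})" .
  let ?D = "diag_block_mat (map (\<lambda>k. jordan_block k 0) ks @ map block_mat bs)"
  interpret N: nilpotent_regular "sum_list ks" d "\<lambda>i. steps_to_end ks ! i" "diag_block_mat (map block_mat bs)" ?D
    using canonical_form_nilpotent_regular[OF bs, of ks] unfolding d .
  have D: "?D \<in> carrier_mat m m" using N.M m by simp
  have max: "maximal_type ?D" by (rule N.maximal_type_M) (rule steps_to_end_two[OF ks(1)])
  have pos: "0 < sum_list ks" using ks by (cases ks) auto
  define i where "i = sum_list ks - 1"
  have i: "i < sum_list ks" "Suc i = sum_list ks" using pos by (auto simp: i_def)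
  have "steps_to_end ks ! i = 0" using N.e_Suc[OF i(1)] i(2) by auto
  from steps_to_end_two[OF ks(1) i(1) this] have i1: "i \<noteq> 0" "steps_to_end ks ! (i - 1) \<noteq> 0" by auto
  have "?D $$ (i - 1, i) = 1" using N.M_nil[of "i - 1" i] i i1 by simp
  moreover have "i < m" using i m by simp
  ultimately have nz: "?D \<noteq> 0\<^sub>m m m" using i1(1) by auto
  have "has_configuration ?D (mset ks, snd c)"
    unfolding has_configuration_def
  proof (intro exI conjI)
    show "0 \<notin> set ks" using ks(1) by auto
    show "star_congruent ?D ?D" by (rule star_congruent_refl[OF D])
    show "jordan_nf (cosquare (diag_block_mat (map block_mat bs))) n_as" by (rule J)
    show "(mset ks, snd c) = (mset ks, eigen_partitions n_as {e. cmod e = 1}, eigen_partitions n_as {e. cmod e > 1})"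
      by (simp add: c')
  qed (use bs in auto)
  thus ?thesis using D nz max by blast
qed

subsection \<open>Tuples and block sizes\<close>

text \<open>The sizes of the \<open>l\<close> nilpotent blocks when the entries of \<open>ms\<close> are the numbers of blocks of size at
  least 3, 4, \<dots>: two plus the conjugate partition of \<open>ms\<close>.\<close>

definition block_sizes :: "nat \<Rightarrow> nat list \<Rightarrow> nat list" where
  "block_sizes l ms = map (\<lambda>t. 2 + length (filter (\<lambda>x. t < x) ms)) [0..<l]"

lemma sum_block_sizes:
  assumes "\<forall>x\<in>set ms. x \<le> l"
  shows "sum_list (block_sizes l ms) = 2 * l + sum_list ms"
proof -
  have "sum_list (block_sizes l ms) = 2 * l + (\<Sum>t\<leftarrow>[0..<l]. length (filter (\<lambda>x. t < x) ms))"
    unfolding block_sizes_def sum_list_addf by (simp add: sum_list_triv)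
  also have "(\<Sum>t\<leftarrow>[0..<l]. length (filter (\<lambda>x. t < x) ms)) = sum_list ms"
    using assms
  proof (induction ms)
    case (Cons x ms)
    have "(\<Sum>t\<leftarrow>[0..<l]. length (filter (\<lambda>y. t < y) (x # ms))) =
      (\<Sum>t\<leftarrow>[0..<l]. (if t < x then 1 else 0) + length (filter (\<lambda>y. t < y) ms))"
      by (rule arg_cong[of _ _ sum_list], rule map_cong) auto
    also have "\<dots> = (\<Sum>t\<leftarrow>[0..<l]. if t < x then 1 else 0) + sum_list ms"
      using Cons by (simp add: sum_list_addf)
    also have "(\<Sum>t\<leftarrow>[0..<l]. if t < x then 1 else (0 :: nat)) = (\<Sum>t\<in>{0..<l}. if t < x then 1 else 0)"
      by (simp add: interv_sum_list_conv_sum_set_nat)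
    also have "\<dots> = card ({0..<l} \<inter> {t. t < x})" by (simp add: sum.If_cases)
    also have "{0..<l} \<inter> {t. t < x} = {0..<x}" using Cons.prems by auto
    finally show ?case by simp
  qed simp
  finally show ?thesis .
qed

text \<open>In a non-increasing list the entries exceeding \<open>t\<close> form an initial segment.\<close>

lemma sorted_filter_length:
  assumes s: "sorted_wrt (\<ge>) ms" and k: "k < length ms"
  shows "k < length (filter (\<lambda>x. t < x) ms) \<longleftrightarrow> t < (ms ! k :: nat)"
  using assms
proof (induction ms arbitrary: k)
  case (Cons x ms)
  show ?case
  proof (cases k)
    case 0
    have "filter (\<lambda>x. t < x) ms = []" if "\<not> t < x" using Cons.prems(1) that by (auto simp: filter_empty_conv)
    thus ?thesis using 0 by auto
  next
    case (Suc j)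
    have j: "j < length ms" "sorted_wrt (\<ge>) ms" using Cons.prems Suc by auto
    have "ms ! j \<le> x" using Cons.prems(1) nth_mem[OF j(1)] by simp
    hence "t < x" if "t < ms ! j" using that by linarith
    moreover have "filter (\<lambda>x. t < x) ms = []" if "\<not> t < x" using Cons.prems(1) that by (auto simp: filter_empty_conv)
    ultimately show ?thesis using Cons.IH[OF j(2,1)] Suc by auto
  qed
qed simp

text \<open>Conjugating the partition twice gives it back.\<close>

lemma block_sizes_determine:
  assumes s: "sorted_wrt (\<ge>) ms" and le: "\<forall>x\<in>set ms. x \<le> l" and k: "k < length ms"
  shows "length (filter (\<lambda>b. k + 2 < b) (block_sizes l ms)) = ms ! k"
proof -
  have "length (filter (\<lambda>b. k + 2 < b) (block_sizes l ms)) = length (filter (\<lambda>t. t < ms ! k) [0..<l])"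
    unfolding block_sizes_def filter_map length_map o_def
    using sorted_filter_length[OF s k] by simp
  also have "\<dots> = card {t. t < l \<and> t < ms ! k}"
    unfolding length_filter_conv_card by (rule arg_cong[of _ _ card]) auto
  also have "{t. t < l \<and> t < ms ! k} = {..<ms ! k}" using le k nth_mem[OF k] by fastforce
  finally show ?thesis by simp
qed

lemma block_sizes_inj:
  assumes "sorted_wrt (\<ge>) ms" "\<forall>x\<in>set ms. x \<le> l" "sorted_wrt (\<ge>) ms'" "\<forall>x\<in>set ms'. x \<le> l"
    and len: "length ms = length ms'" and eq: "mset (block_sizes l ms) = mset (block_sizes l ms')"
  shows "ms = ms'"
proof (rule nth_equalityI[OF len])
  fix k assume k: "k < length ms"
  have "length (filter (\<lambda>b. k + 2 < b) (block_sizes l ms)) = size (filter_mset (\<lambda>b. k + 2 < b) (mset (block_sizes l ms)))"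
    by (metis mset_filter size_mset)
  also have "\<dots> = length (filter (\<lambda>b. k + 2 < b) (block_sizes l ms'))" unfolding eq by (metis mset_filter size_mset)
  finally show "ms ! k = ms' ! k"
    using block_sizes_determine[OF assms(1,2) k] block_sizes_determine[OF assms(3,4), of k] k len by simp
qed

lemma D_setD:
  assumes "ms \<in> D_set m r"
  shows "length ms = 2 * r - m" "sorted_wrt (\<ge>) ms" "\<forall>x\<in>set ms. x \<le> m - r" "sum_list ms \<le> 2 * r - m"
proof -
  show 1: "length ms = 2 * r - m" "sorted_wrt (\<ge>) ms" "sum_list ms \<le> 2 * r - m"
    using assms by (auto simp: D_set_def)
  show "\<forall>x\<in>set ms. x \<le> m - r"
    using 1(2) assms by (cases ms) (force simp: D_set_def)+
qed

lemma finite_D_set: "finite (D_set m r)"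
proof (rule finite_subset)
  show "D_set m r \<subseteq> {ms. set ms \<subseteq> {..m - r} \<and> length ms = 2 * r - m}"
    using D_setD by blast
qed (rule finite_lists_length_eq, simp)

text \<open>The index set over which \<open>s(m)\<close> counts: a rank, a tuple, and a configuration of regular matrices
  of the remaining order.\<close>

definition singular_indices :: "nat \<Rightarrow> (nat \<times> nat list \<times> configuration) set" where
  "singular_indices m = (SIGMA r:{(m + 1) div 2..<m}. SIGMA ms:D_set m r. regular_configurations (2 * r - m - sum_list ms))"

definition singular_configuration :: "nat \<Rightarrow> nat \<times> nat list \<times> configuration \<Rightarrow> configuration" where
  "singular_configuration m = (\<lambda>(r, ms, c). (mset (block_sizes (m - r) ms), snd c))"

lemma fst_regular_configuration: "c \<in> regular_configurations d \<Longrightarrow> fst c = {#}"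
  by (erule regular_configurationE) simp

text \<open>The number of blocks is \<open>m - r\<close>, which gives the rank; then the block sizes give the tuple.\<close>

lemma singular_configuration_inj: "inj_on (singular_configuration m) (singular_indices m)"
proof (rule inj_onI)
  fix x y assume xy: "x \<in> singular_indices m" "y \<in> singular_indices m"
    and eq: "singular_configuration m x = singular_configuration m y"
  obtain r ms c where x: "x = (r, ms, c)" by (cases x)
  obtain r' ms' c' where y: "y = (r', ms', c')" by (cases y)
  have r: "r < m" "r' < m" and ms: "ms \<in> D_set m r" "ms' \<in> D_set m r'"
    and c: "c \<in> regular_configurations (2 * r - m - sum_list ms)" "c' \<in> regular_configurations (2 * r' - m - sum_list ms')"
    using xy by (auto simp: singular_indices_def x y)
  have e: "mset (block_sizes (m - r) ms) = mset (block_sizes (m - r') ms')" "snd c = snd c'"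
    using eq by (auto simp: singular_configuration_def x y)
  have "m - r = m - r'" using arg_cong[OF e(1), of size] by (simp add: block_sizes_def)
  hence rr: "r' = r" using r by simp
  have "ms = ms'"
    by (rule block_sizes_inj[of _ "m - r"]) (use D_setD[OF ms(1)] D_setD[OF ms(2)] e(1) rr in auto)
  moreover have "c = c'" using fst_regular_configuration[OF c(1)] fst_regular_configuration[OF c(2)] e(2)
    by (simp add: prod_eq_iff)
  ultimately show "x = y" by (simp add: x y rr)
qed

text \<open>Finiteness is needed because \<open>card\<close> of an infinite set of configurations would be 0. It is
  supplied in the end by the finiteness of the set of families.\<close>

lemma card_singular_indices:
  assumes fin: "finite (singular_indices m)"
  shows "card (singular_indices m) = s_num m"
proof -
  have finA: "finite (regular_configurations (2 * r - m - sum_list ms))"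
    if "r \<in> {(m + 1) div 2..<m}" "ms \<in> D_set m r" for r ms
  proof -
    have "(\<lambda>c. (r, ms, c)) ` regular_configurations (2 * r - m - sum_list ms) \<subseteq> singular_indices m"
      using that by (auto simp: singular_indices_def)
    from finite_subset[OF this fin] show ?thesis by (rule finite_imageD) (simp add: inj_on_def)
  qed
  have "card (singular_indices m) =
    (\<Sum>r\<in>{(m + 1) div 2..<m}. card (SIGMA ms:D_set m r. regular_configurations (2 * r - m - sum_list ms)))"
    unfolding singular_indices_def using finA finite_D_set by (intro card_SigmaI ballI finite_SigmaI) auto
  also have "\<dots> = (\<Sum>r\<in>{(m + 1) div 2..<m}. \<Sum>ms\<in>D_set m r. card (regular_configurations (2 * r - m - sum_list ms)))"
    using finA finite_D_set by (intro sum.cong refl card_SigmaI ballI) auto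
  also have "\<dots> = s_num m"
    unfolding s_num_def s_num_rank_def a_num_def regular_configurations_def ..
  finally show ?thesis .
qed

lemma singular_index_realized:
  assumes x: "x \<in> singular_indices m"
  shows "\<exists>M \<in> carrier_mat m m. M \<noteq> 0\<^sub>m m m \<and> maximal_type M \<and> has_configuration M (singular_configuration m x)"
    and "fst (singular_configuration m x) \<noteq> {#}"
proof -
  obtain r ms c where xe: "x = (r, ms, c)" by (cases x)
  have r: "(m + 1) div 2 \<le> r" "r < m" and ms: "ms \<in> D_set m r"
    and c: "c \<in> regular_configurations (2 * r - m - sum_list ms)"
    using x by (auto simp: singular_indices_def xe)
  have m2: "m \<le> 2 * r" using r by linarith
  have ne: "block_sizes (m - r) ms \<noteq> []" using r by (simp add: block_sizes_def)
  have ge: "\<forall>k\<in>set (block_sizes (m - r) ms). 2 \<le> k" by (auto simp: block_sizes_def)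
  have "sum_list (block_sizes (m - r) ms) + (2 * r - m - sum_list ms) = m"
    using sum_block_sizes[OF D_setD(3)[OF ms]] D_setD(4)[OF ms] m2 r by simp
  from singular_configuration_realized[OF c ge ne this]
  show "\<exists>M \<in> carrier_mat m m. M \<noteq> 0\<^sub>m m m \<and> maximal_type M \<and> has_configuration M (singular_configuration m x)"
    by (simp add: singular_configuration_def xe)
  show "fst (singular_configuration m x) \<noteq> {#}" using ne by (simp add: singular_configuration_def xe)
qed

section \<open>The lower bound\<close>

lemma structure_configurations_eq:
  assumes p: "presented_by (Suc m) (fst X) (snd X) M" and c: "has_configuration M c"
  shows "structure_configurations (Suc m) X = {c}"
proof -
  have "c' = c" if "presented_by (Suc m) (fst X) (snd X) M'" "has_configuration M' c'" for M' c'
    using configuration_unique[OF c that(2) equivalent_imp_scaled_congruent[OF p that(1)]]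
      equivalent_structures_refl[of "(fst X, snd X)"] by simp
  thus ?thesis using p c unfolding structure_configurations_def by blast
qed

text \<open>A structure lies in its own equivalence class, and the families cover all classes.\<close>

lemma family_of_structure:
  assumes F: "division_into_families n \<F>" and X: "X \<in> maximal_structures n"
  shows "\<exists>\<Phi>\<in>\<F>. X \<in> \<Union>\<Phi>"
proof -
  let ?R = "{(X, Y). X \<in> maximal_structures n \<and> Y \<in> maximal_structures n \<and> equivalent_structures X Y}"
  have "?R `` {X} \<in> equivalence_classes n" unfolding equivalence_classes_def using X by (rule quotientI)
  moreover have "partition_on (equivalence_classes n) \<F>"
    using F unfolding division_into_families_def by (rule conjunct1)
  hence "equivalence_classes n = \<Union>\<F>" by (rule partition_onD1)
  ultimately obtain \<Phi> where "\<Phi> \<in> \<F>" "?R `` {X} \<in> \<Phi>" by blast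
  moreover have "X \<in> ?R `` {X}" using X equivalent_structures_refl[of X] by simp
  ultimately show ?thesis by blast
qed

theorem theorem4p35:
  fixes n :: nat and \<F> :: "'a::euclidean_space cstruct set set set"
  assumes "n \<ge> 2"
    and "DIM('a) = 2 * n"
    and "division_into_families n \<F>"
  shows "infinite \<F> \<or> card \<F> \<ge> (n + 1) div 2 + a_num (n - 1) - 1 + s_num (n - 1)"
proof (cases "finite \<F>")
  case fin: True
  define m where "m = n - 1"
  have n: "n = Suc m" and m: "0 < m" using assms(1) by (auto simp: m_def)
  let ?H = "hermitian_configuration m"
  \<comment> \<open>Labels of structures that must lie in different families: \<open>Inl p\<close> stands for the Hermitian
    matrix with \<open>p\<close> positive and \<open>m - p\<close> negative entries, \<open>Inr c\<close> for a matrix with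
    configuration \<open>c\<close>. The Hermitian configuration is excluded from the latter, since it is already
    represented.\<close>
  define \<Lambda> where "\<Lambda> = Inl ` {..m div 2} \<union> Inr ` ((regular_configurations m - {?H}) \<union> singular_configuration m ` singular_indices m)"
  define mat_ok where "mat_ok = (\<lambda>lab M. M \<in> carrier_mat m m \<and> M \<noteq> 0\<^sub>m m m \<and> maximal_type M \<and>
     (case lab of Inl p \<Rightarrow> M = signature_mat m p | Inr c \<Rightarrow> has_configuration M c))"
  have nz: "M \<noteq> 0\<^sub>m m m" if "M \<in> carrier_mat m m" "invertible_mat M" for M :: "complex mat"
  proof
    assume "M = 0\<^sub>m m m"
    hence "det M = 0" using m by simp
    thus False using invertible_mat_iff_det[OF that(1)] that(2) by simp
  qed
  have ex_mat: "\<exists>M. mat_ok x M" if x: "x \<in> \<Lambda>" for x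
  proof -
    consider p where "x = Inl p" | c where "x = Inr c" "c \<in> regular_configurations m"
      | i where "x = Inr (singular_configuration m i)" "i \<in> singular_indices m"
      using x unfolding \<Lambda>_def by blast
    thus ?thesis
    proof cases
      case 1
      thus ?thesis using nz[OF signature_mat_carrier signature_mat_invertible] signature_mat_carrier signature_mat_invertible
        by (auto simp: mat_ok_def maximal_type_def)
    next
      case 2
      then obtain M where "M \<in> carrier_mat m m" "invertible_mat M" "has_configuration M c"
        by (auto simp: regular_configurations_def)
      thus ?thesis using nz 2 by (auto simp: mat_ok_def maximal_type_def)
    next
      case 3
      thus ?thesis using singular_index_realized(1)[OF 3(2)] by (auto simp: mat_ok_def)
    qed
  qed
  have ex: "\<exists>\<Phi>. \<Phi> \<in> \<F> \<and> (\<exists>X M. X \<in> \<Union>\<Phi> \<and> presented_by n (fst X) (snd X) M \<and> mat_ok x M)"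
    if x: "x \<in> \<Lambda>" for x
  proof -
    obtain M where M: "mat_ok x M" using ex_mat[OF x] by blast
    hence "\<exists>(br :: 'a bracket) J. one_abelian (Suc m) br J \<and> presented_by (Suc m) br J M"
      by (intro exists_structure) (use assms(2) n in \<open>auto simp: mat_ok_def\<close>)
    then obtain br :: "'a bracket" and J where s: "one_abelian n br J" "presented_by n br J M" using n by blast
    hence "(br, J) \<in> maximal_structures n" using M by (auto simp: maximal_structures_def mat_ok_def)
    from family_of_structure[OF assms(3) this] show ?thesis using s M by (metis fst_conv snd_conv)
  qed
  define \<phi> where "\<phi> = (\<lambda>x. SOME \<Phi>. \<Phi> \<in> \<F> \<and> (\<exists>X M. X \<in> \<Union>\<Phi> \<and> presented_by n (fst X) (snd X) M \<and> mat_ok x M))"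
  have \<phi>: "\<phi> x \<in> \<F> \<and> (\<exists>X M. X \<in> \<Union>(\<phi> x) \<and> presented_by n (fst X) (snd X) M \<and> mat_ok x M)" if "x \<in> \<Lambda>" for x
    unfolding \<phi>_def by (rule someI_ex[OF ex[OF that]])
  define conf where "conf = (\<lambda>x. case x of Inl (p :: nat) \<Rightarrow> ?H | Inr c \<Rightarrow> c)"
  have conf: "has_configuration M (conf x)" if "mat_ok x M" for x M
    using that signature_mat_configuration[OF m] by (auto simp: mat_ok_def conf_def split: sum.splits)
  have inj: "inj_on \<phi> \<Lambda>"
  proof (rule inj_onI)
    fix x y assume x: "x \<in> \<Lambda>" and y: "y \<in> \<Lambda>" and eq: "\<phi> x = \<phi> y"
    obtain X M where X: "X \<in> \<Union>(\<phi> x)" "presented_by n (fst X) (snd X) M" "mat_ok x M" using \<phi>[OF x] by blast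
    obtain Y K where Y: "Y \<in> \<Union>(\<phi> x)" "presented_by n (fst Y) (snd Y) K" "mat_ok y K" using \<phi>[OF y, folded eq] by blast
    have mem: "\<phi> x \<in> \<F>" using \<phi>[OF x] by blast
    note div = assms(3)[unfolded division_into_families_def, THEN conjunct2]
    have same: "structure_configurations n X = structure_configurations n Y"
      by (rule div[THEN conjunct1, rule_format, OF mem X(1) Y(1)])
    have herm: "regular_hermitian n X \<and> regular_hermitian n Y \<longrightarrow> equivalent_structures X Y"
      using div[THEN conjunct2, THEN bspec, OF mem, THEN bspec, OF X(1), THEN bspec, OF Y(1)] .
    have cc: "conf x = conf y"
      using structure_configurations_eq[OF X(2)[unfolded n] conf[OF X(3)]]
        structure_configurations_eq[OF Y(2)[unfolded n] conf[OF Y(3)]] same n by simp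
    have notH: "c \<noteq> ?H" if label: "Inr c \<in> \<Lambda>" for c
    proof
      assume c: "c = ?H"
      then obtain i where i: "i \<in> singular_indices m" "c = singular_configuration m i"
        using label unfolding \<Lambda>_def by blast
      have "fst c \<noteq> {#}" unfolding i(2) by (rule singular_index_realized(2)[OF i(1)])
      thus False by (simp add: c hermitian_configuration_def)
    qed
    show "x = y"
    proof (cases x)
      case (Inr c)
      thus ?thesis using cc notH[of c] x by (cases y) (auto simp: conf_def)
    next
      case (Inl p)
      show ?thesis
      proof (cases y)
        case (Inr c)
        thus ?thesis using cc notH[of c] y Inl by (auto simp: conf_def)
      next
        case Q: (Inl q)
        have MK: "M = signature_mat m p" "K = signature_mat m q" using X(3) Y(3) Inl Q by (auto simp: mat_ok_def)
        have "regular_hermitian n X" "regular_hermitian n Y"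
          unfolding regular_hermitian_def using X(2) Y(2) MK signature_mat_invertible signature_mat_adjoint by blast+
        hence "equivalent_structures (fst X, snd X) (fst Y, snd Y)" using herm by simp
        from equivalent_imp_scaled_congruent[OF X(2)[unfolded n] Y(2)[unfolded n] this]
        have "scaled_congruent m (signature_mat m p) (signature_mat m q)" unfolding MK .
        moreover have "2 * p \<le> m" "2 * q \<le> m" using x y Inl Q by (auto simp: \<Lambda>_def)
        ultimately have "p = q" by (rule scaled_congruent_signature)
        thus ?thesis using Inl Q by simp
      qed
    qed
  qed
  have sub: "\<phi> ` \<Lambda> \<subseteq> \<F>" using \<phi> by blast
  have finL: "finite \<Lambda>" using inj_on_finite[OF inj sub fin] .
  have le: "card \<Lambda> \<le> card \<F>" by (rule card_inj_on_le[OF inj sub fin])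
  let ?C = "regular_configurations m" and ?S = "singular_configuration m ` singular_indices m"
  have finCS: "finite ((?C - {?H}) \<union> ?S)"
  proof -
    have "Inr ` ((?C - {?H}) \<union> ?S) \<subseteq> \<Lambda>" by (auto simp: \<Lambda>_def)
    hence "finite (Inr ` ((?C - {?H}) \<union> ?S) :: (nat + configuration) set)" using finL finite_subset by blast
    thus ?thesis by (rule finite_imageD) simp
  qed
  have HC: "?H \<in> ?C"
    using signature_mat_configuration[OF m, of 0] signature_mat_carrier[of m 0] signature_mat_invertible[of m 0]
    unfolding regular_configurations_def by blast
  have "card \<Lambda> = card (Inl ` {..m div 2} :: (nat + configuration) set) + card (Inr ` ((?C - {?H}) \<union> ?S) :: (nat + configuration) set)"
    unfolding \<Lambda>_def using finCS by (intro card_Un_disjoint) auto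
  also have "\<dots> = m div 2 + 1 + card ((?C - {?H}) \<union> ?S)" by (simp add: card_image)
  also have "card ((?C - {?H}) \<union> ?S) = card (?C - {?H}) + card ?S"
  proof (rule card_Un_disjoint)
    show "(?C - {?H}) \<inter> ?S = {}"
    proof (rule equals0I)
      fix c assume "c \<in> (?C - {?H}) \<inter> ?S"
      then obtain i where c: "c \<in> ?C" and i: "i \<in> singular_indices m" "c = singular_configuration m i" by blast
      have "fst c \<noteq> {#}" unfolding i(2) by (rule singular_index_realized(2)[OF i(1)])
      thus False using fst_regular_configuration[OF c] by simp
    qed
  qed (use finCS in auto)
  also have "card ?S = s_num m"
    using card_image[OF singular_configuration_inj[of m]] card_singular_indices[of m]
      finite_imageD[OF _ singular_configuration_inj[of m]] finCS by simp
  also have "card (?C - {?H}) = a_num m - 1"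
    using HC finCS by (simp add: a_num_def regular_configurations_def card_Diff_singleton)
  finally have "card \<Lambda> = m div 2 + 1 + (a_num m - 1 + s_num m)" .
  moreover have "a_num m \<ge> 1"
  proof -
    have "finite ?C" using finCS by simp
    hence "card ?C > 0" using HC card_gt_0_iff by blast
    thus ?thesis by (simp add: a_num_def regular_configurations_def)
  qed
  moreover have "(n + 1) div 2 = m div 2 + 1" using n by simp
  ultimately have "card \<F> \<ge> (n + 1) div 2 + a_num (n - 1) - 1 + s_num (n - 1)"
    using le unfolding m_def[symmetric] by simp
  thus ?thesis ..
qed simp

end
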